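(* Let $\tilde M^{2n+s}$ be an indefinite $S$-manifold with structure $(\phi,\xi_\alpha,\eta^\alpha,g)$, and let $M=N^\perp\times_f N^T$ be a warped product $CR$-submanifold of $\tilde M^{2n+s}$, tangent to the structure vector fields $\xi_\alpha$, such that $N^\perp$ is a totally real submanifold and $N^T$ is a $\phi$-holomorphic (invariant) submanifold of $\tilde M^{2n+s}$. Then $M$ is a $CR$-product.
   Context: Indefinite $S$-manifold: a $(2n+s)$-dimensional manifold $\tilde M$ with a $(1,1)$-tensor field $\phi$ of constant rank, global vector fields $\xi_1,\dots,\xi_s$, 1-forms $\eta^1,\dots,\eta^s$ and a semi-Riemannian metric $g$ (also written $\tilde g$) such that $\phi^2=-I+\sum_\alpha\eta^\alpha\otimes\xi_\alpha$, $\eta^\alpha(\xi_\beta)=\delta^\alpha_\beta$, $g(\phi X,\phi Y)=g(X,Y)-\sum_\alpha\epsilon_\alpha\eta^\alpha(X)\eta^\alpha(Y)$, where $\epsilon_\alpha=+1$ or $-1$ according to whether $\xi_\alpha$ is spacelike or timelike (so $\eta^\alpha(X)=\epsilon_\alpha g(X,\xi_\alpha)$); the structure is normal ($[\phi,\phi]+2\sum_\alpha d\eta^\alpha\otimes\xi_\alpha=0$) and $d\eta^\alpha=\Phi$ for every $\alpha$, where $\Phi(X,Y)=g(X,\phi Y)$ and $d\eta(X,Y)=\frac12(X\eta(Y)-Y\eta(X)-\eta([X,Y]))$. Its Levi-Civita connection satisfies $(\tilde\nabla_X\phi)Y=g(\phi X,\phi Y)\tilde\xi+\tilde\eta(Y)\phi^2X$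 with $\tilde\xi=\sum_\alpha\xi_\alpha$, $\tilde\eta=\sum_\alpha\epsilon_\alpha\eta^\alpha$, and $\tilde\nabla_X\xi_\alpha=-\epsilon_\alpha\phi X$. Submanifolds are nondegenerate. A submanifold $N$ is invariant ($\phi$-holomorphic) if $\phi(TN)\subset TN$ and totally real (anti-invariant) if $\phi(TN)\subset (TN)^\perp$. Warped product: $N_1\times_f N_2$ is $N_1\times N_2$ with metric $g_1+f^2g_2$, where $f$ is a positive differentiable function on the first factor $N_1$ (so here $f$ is a function on $N^\perp$). A warped product $CR$-submanifold $N^\perp\times_fN^T$ of $\tilde M$ is a submanifold whose induced metric is of this form. Each structure vector field case considered is: the $\xi_\alpha$ are tangent to $N^T$, or the $\xi_\alpha$ are tangent to $N^\perp$. $CR$-product (contact $CR$-product): a contact $CR$-submanifold which is locally a Riemannian product of a $\phi$-invariant submanifold $N^T$ tangent to the $\xi_\alpha$ and a totally real submanifold $N^\perp$ of $\tilde M$. A submanifold $M$ tangent to the $\xi_\alpha$ is a contact $CR$-submanifold if $TM=D\oplus D^\perp$ (orthogonal) with $\phi D\subset D$ and $\phi D^\perp\subset (TM)^\perp$. *)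

theory Defs
  imports "HOL-Analysis.Analysis"
begin

section \<open>Smooth manifolds modelled on Euclidean spaces\<close>

(* Meaningful for open S only. *)
primrec C_k_on :: "nat \<Rightarrow> 'a::euclidean_space set \<Rightarrow> ('a \<Rightarrow> 'b::real_normed_vector) \<Rightarrow> bool" where
  "C_k_on 0 S f \<longleftrightarrow> continuous_on S f"
| "C_k_on (Suc k) S f \<longleftrightarrow> (\<forall>x\<in>S. f differentiable (at x)) \<and>
     (\<forall>v. C_k_on k S (\<lambda>x. frechet_derivative f (at x) v))"

definition smooth_on :: "'a::euclidean_space set \<Rightarrow> ('a \<Rightarrow> 'b::real_normed_vector) \<Rightarrow> bool" where
  "smooth_on S f \<longleftrightarrow> (\<forall>k. C_k_on k S f)"

(* A chart is its domain together with a coordinate map, whose values outside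
   the domain are irrelevant. *)
type_synonym ('p, 'e) chart = "'p set \<times> ('p \<Rightarrow> 'e)"
type_synonym ('p, 'e) atlas = "('p, 'e) chart set"

definition cinv :: "('p, 'e) chart \<Rightarrow> 'e \<Rightarrow> 'p" where
  "cinv c = inv_into (fst c) (snd c)"

definition is_chart :: "('p::topological_space, 'e::euclidean_space) chart \<Rightarrow> bool" where
  "is_chart c \<longleftrightarrow> open (fst c) \<and> open (snd c ` fst c) \<and>
     homeomorphism (fst c) (snd c ` fst c) (snd c) (cinv c)"

(* The manifold is the whole type 'p; any smooth atlas may be used, not only a maximal one. *)
definition smooth_manifold ::
  "('p::{t2_space,second_countable_topology}, 'e::euclidean_space) atlas \<Rightarrow> bool" where
  "smooth_manifold A \<longleftrightarrow> (\<forall>c\<in>A. is_chart c) \<and> (\<Union>c\<in>A. fst c) = UNIV \<and>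
     (\<forall>c\<in>A. \<forall>d\<in>A. smooth_on (snd c ` (fst c \<inter> fst d)) (snd d \<circ> cinv c))"

definition eucl_atlas :: "('e::euclidean_space, 'e) atlas" where
  "eucl_atlas = {(UNIV, id)}"

definition prod_atlas :: "('p, 'e) atlas \<Rightarrow> ('q, 'f) atlas \<Rightarrow> ('p \<times> 'q, 'e \<times> 'f) atlas" where
  "prod_atlas A B = {(fst c \<times> fst d, map_prod (snd c) (snd d)) | c d. c \<in> A \<and> d \<in> B}"

definition smooth_map :: "('p::topological_space, 'e::euclidean_space) atlas \<Rightarrow> 'p set \<Rightarrow>
    ('q::topological_space, 'f::euclidean_space) atlas \<Rightarrow> ('p \<Rightarrow> 'q) \<Rightarrow> bool" where
  "smooth_map A S B h \<longleftrightarrow> open S \<and> continuous_on S h \<and>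
     (\<forall>c\<in>A. \<forall>d\<in>B. smooth_on (snd c ` (fst c \<inter> S \<inter> h -` fst d)) (snd d \<circ> h \<circ> cinv c))"

definition diffeomorphism :: "('p::topological_space, 'e::euclidean_space) atlas \<Rightarrow> 'p set \<Rightarrow>
    ('q::topological_space, 'f::euclidean_space) atlas \<Rightarrow> 'q set \<Rightarrow> ('p \<Rightarrow> 'q) \<Rightarrow> bool" where
  "diffeomorphism A S B T h \<longleftrightarrow> bij_betw h S T \<and>
     smooth_map A S B h \<and> smooth_map B T A (inv_into S h)"

section \<open>Tangent vectors\<close>

(* A tangent vector at p is represented by its components in one chart chosen
   once and for all around p, so that every tangent space is a copy of the
   model space 'e.  The differential of a map is its derivative read in the
   chosen charts at the point and at its image.  In eucl_atlas these are the
   usual tangent vectors and the usual derivative. *)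
definition chart_at :: "('p, 'e) atlas \<Rightarrow> 'p \<Rightarrow> ('p, 'e) chart" where
  "chart_at A p = (SOME c. c \<in> A \<and> p \<in> fst c)"

definition mdiff :: "('p, 'e::euclidean_space) atlas \<Rightarrow> ('q, 'f::euclidean_space) atlas \<Rightarrow>
    ('p \<Rightarrow> 'q) \<Rightarrow> 'p \<Rightarrow> 'e \<Rightarrow> 'f" where
  "mdiff A B h p = frechet_derivative (snd (chart_at B (h p)) \<circ> h \<circ> cinv (chart_at A p))
     (at (snd (chart_at A p) p))"

definition smooth_function :: "('p::topological_space, 'e::euclidean_space) atlas \<Rightarrow> 'p set \<Rightarrow>
    ('p \<Rightarrow> real) \<Rightarrow> bool" where
  "smooth_function A S h \<longleftrightarrow> smooth_map A S eucl_atlas h"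

definition dir_deriv :: "('p, 'e::euclidean_space) atlas \<Rightarrow> ('p \<Rightarrow> 'e) \<Rightarrow> ('p \<Rightarrow> real) \<Rightarrow> 'p \<Rightarrow> real" where
  "dir_deriv A X h p = mdiff A eucl_atlas h p (X p)"

(* The components, in an arbitrary chart c, of a vector field X, as a function
   on the coordinate domain of c. *)
definition vf_rep :: "('p, 'e::euclidean_space) atlas \<Rightarrow> ('p, 'e) chart \<Rightarrow> ('p \<Rightarrow> 'e) \<Rightarrow> 'e \<Rightarrow> 'e" where
  "vf_rep A c X y = mdiff A eucl_atlas (snd c) (cinv c y) (X (cinv c y))"

definition smooth_vf :: "('p::topological_space, 'e::euclidean_space) atlas \<Rightarrow> 'p set \<Rightarrow>
    ('p \<Rightarrow> 'e) \<Rightarrow> bool" where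
  "smooth_vf A S X \<longleftrightarrow> open S \<and> (\<forall>c\<in>A. smooth_on (snd c ` (fst c \<inter> S)) (vf_rep A c X))"

(* [X,Y]^i = X^j d_j Y^i - Y^j d_j X^i in the chosen chart at the point. *)
definition lie_bracket :: "('p, 'e::euclidean_space) atlas \<Rightarrow> ('p \<Rightarrow> 'e) \<Rightarrow> ('p \<Rightarrow> 'e) \<Rightarrow> 'p \<Rightarrow> 'e" where
  "lie_bracket A X Y p = (let c = chart_at A p; y = snd c p in
     frechet_derivative (vf_rep A c Y) (at y) (X p) - frechet_derivative (vf_rep A c X) (at y) (Y p))"

section \<open>Tensor fields\<close>

definition smooth_one_form :: "('p::topological_space, 'e::euclidean_space) atlas \<Rightarrow> 'p set \<Rightarrow>
    ('p \<Rightarrow> 'e \<Rightarrow> real) \<Rightarrow> bool" where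
  "smooth_one_form A S \<eta> \<longleftrightarrow> open S \<and> (\<forall>p\<in>S. linear (\<eta> p)) \<and>
     (\<forall>U X. U \<subseteq> S \<longrightarrow> smooth_vf A U X \<longrightarrow> smooth_function A U (\<lambda>p. \<eta> p (X p)))"

definition smooth_endo_field :: "('p::topological_space, 'e::euclidean_space) atlas \<Rightarrow> 'p set \<Rightarrow>
    ('p \<Rightarrow> 'e \<Rightarrow> 'e) \<Rightarrow> bool" where
  "smooth_endo_field A S \<phi> \<longleftrightarrow> open S \<and> (\<forall>p\<in>S. linear (\<phi> p)) \<and>
     (\<forall>U X. U \<subseteq> S \<longrightarrow> smooth_vf A U X \<longrightarrow> smooth_vf A U (\<lambda>p. \<phi> p (X p)))"

definition form_index :: "('e::euclidean_space \<Rightarrow> 'e \<Rightarrow> real) \<Rightarrow> nat" where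
  "form_index b = Max {dim V | V. subspace V \<and> (\<forall>v\<in>V. v \<noteq> 0 \<longrightarrow> b v v < 0)}"

definition semi_riemannian_metric :: "('p::topological_space, 'e::euclidean_space) atlas \<Rightarrow> 'p set \<Rightarrow>
    ('p \<Rightarrow> 'e \<Rightarrow> 'e \<Rightarrow> real) \<Rightarrow> bool" where
  "semi_riemannian_metric A S g \<longleftrightarrow> open S \<and>
     (\<forall>p\<in>S. bilinear (g p) \<and> (\<forall>v w. g p v w = g p w v) \<and> (\<forall>v. v \<noteq> 0 \<longrightarrow> (\<exists>w. g p v w \<noteq> 0))) \<and>
     (\<exists>\<nu>. \<forall>p\<in>S. form_index (g p) = \<nu>) \<and>
     (\<forall>U X Y. U \<subseteq> S \<longrightarrow> smooth_vf A U X \<longrightarrow> smooth_vf A U Y \<longrightarrow>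
        smooth_function A U (\<lambda>p. g p (X p) (Y p)))"

definition ext_deriv :: "('p, 'e::euclidean_space) atlas \<Rightarrow> ('p \<Rightarrow> 'e \<Rightarrow> real) \<Rightarrow>
    ('p \<Rightarrow> 'e) \<Rightarrow> ('p \<Rightarrow> 'e) \<Rightarrow> 'p \<Rightarrow> real" where
  "ext_deriv A \<eta> X Y p = (1/2) *
     (dir_deriv A X (\<lambda>q. \<eta> q (Y q)) p - dir_deriv A Y (\<lambda>q. \<eta> q (X q)) p
      - \<eta> p (lie_bracket A X Y p))"

definition nijenhuis :: "('p, 'e::euclidean_space) atlas \<Rightarrow> ('p \<Rightarrow> 'e \<Rightarrow> 'e) \<Rightarrow>
    ('p \<Rightarrow> 'e) \<Rightarrow> ('p \<Rightarrow> 'e) \<Rightarrow> 'p \<Rightarrow> 'e" where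
  "nijenhuis A \<phi> X Y p =
     \<phi> p (\<phi> p (lie_bracket A X Y p))
     + lie_bracket A (\<lambda>q. \<phi> q (X q)) (\<lambda>q. \<phi> q (Y q)) p
     - \<phi> p (lie_bracket A (\<lambda>q. \<phi> q (X q)) Y p)
     - \<phi> p (lie_bracket A X (\<lambda>q. \<phi> q (Y q)) p)"

section \<open>Indefinite S-manifolds\<close>

(* The structure vector fields are indexed by 1, ..., s. *)
definition indefinite_S_manifold ::
  "('m::{t2_space,second_countable_topology}, 'e::euclidean_space) atlas \<Rightarrow> nat \<Rightarrow> nat \<Rightarrow>
   ('m \<Rightarrow> 'e \<Rightarrow> 'e) \<Rightarrow> (nat \<Rightarrow> 'm \<Rightarrow> 'e) \<Rightarrow> (nat \<Rightarrow> 'm \<Rightarrow> 'e \<Rightarrow> real) \<Rightarrow> (nat \<Rightarrow> real) \<Rightarrow>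
   ('m \<Rightarrow> 'e \<Rightarrow> 'e \<Rightarrow> real) \<Rightarrow> bool" where
  "indefinite_S_manifold A n s \<phi> \<xi> \<eta> \<epsilon> g \<longleftrightarrow>
     smooth_manifold A \<and> DIM('e) = 2 * n + s \<and> s \<ge> 1 \<and>
     smooth_endo_field A UNIV \<phi> \<and> (\<exists>r. \<forall>p. dim (range (\<phi> p)) = r) \<and>
     (\<forall>\<alpha>\<in>{1..s}. smooth_vf A UNIV (\<xi> \<alpha>) \<and> smooth_one_form A UNIV (\<eta> \<alpha>)) \<and>
     semi_riemannian_metric A UNIV g \<and>
     (\<forall>p v. \<phi> p (\<phi> p v) = - v + (\<Sum>\<alpha>=1..s. \<eta> \<alpha> p v *\<^sub>R \<xi> \<alpha> p)) \<and>
     (\<forall>\<alpha>\<in>{1..s}. \<forall>\<beta>\<in>{1..s}. \<forall>p. \<eta> \<alpha> p (\<xi> \<beta> p) = (if \<alpha> = \<beta> then 1 else 0)) \<and>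
     (\<forall>\<alpha>\<in>{1..s}. (\<epsilon> \<alpha> = 1 \<and> (\<forall>p. g p (\<xi> \<alpha> p) (\<xi> \<alpha> p) > 0)) \<or>
                  (\<epsilon> \<alpha> = - 1 \<and> (\<forall>p. g p (\<xi> \<alpha> p) (\<xi> \<alpha> p) < 0))) \<and>
     (\<forall>p v w. g p (\<phi> p v) (\<phi> p w) = g p v w - (\<Sum>\<alpha>=1..s. \<epsilon> \<alpha> * \<eta> \<alpha> p v * \<eta> \<alpha> p w)) \<and>
     (\<forall>U X Y. smooth_vf A U X \<longrightarrow> smooth_vf A U Y \<longrightarrow> (\<forall>p\<in>U.
        nijenhuis A \<phi> X Y p + 2 *\<^sub>R (\<Sum>\<alpha>=1..s. ext_deriv A (\<eta> \<alpha>) X Y p *\<^sub>R \<xi> \<alpha> p) = 0)) \<and>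
     (\<forall>\<alpha>\<in>{1..s}. \<forall>U X Y. smooth_vf A U X \<longrightarrow> smooth_vf A U Y \<longrightarrow> (\<forall>p\<in>U.
        ext_deriv A (\<eta> \<alpha>) X Y p = g p (X p) (\<phi> p (Y p))))"

section \<open>Submanifolds\<close>

(* A submanifold is an immersion j.  The tangent space of the submanifold is
   regarded as the subspace range (mdiff B A j x) of the ambient one at j x. *)
definition immersion :: "('p::topological_space, 'f::euclidean_space) atlas \<Rightarrow> 'p set \<Rightarrow>
    ('m::topological_space, 'e::euclidean_space) atlas \<Rightarrow> ('p \<Rightarrow> 'm) \<Rightarrow> bool" where
  "immersion B S A j \<longleftrightarrow> smooth_map B S A j \<and> (\<forall>x\<in>S. inj (mdiff B A j x))"

definition induced_metric :: "('p, 'f::euclidean_space) atlas \<Rightarrow> ('m, 'e::euclidean_space) atlas \<Rightarrow>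
    ('m \<Rightarrow> 'e \<Rightarrow> 'e \<Rightarrow> real) \<Rightarrow> ('p \<Rightarrow> 'm) \<Rightarrow> 'p \<Rightarrow> 'f \<Rightarrow> 'f \<Rightarrow> real" where
  "induced_metric B A g j x v w = g (j x) (mdiff B A j x v) (mdiff B A j x w)"

definition nondegenerate_submanifold ::
  "('p::topological_space, 'f::euclidean_space) atlas \<Rightarrow> 'p set \<Rightarrow>
   ('m::topological_space, 'e::euclidean_space) atlas \<Rightarrow> ('m \<Rightarrow> 'e \<Rightarrow> 'e \<Rightarrow> real) \<Rightarrow> ('p \<Rightarrow> 'm) \<Rightarrow> bool" where
  "nondegenerate_submanifold B S A g j \<longleftrightarrow>
     immersion B S A j \<and> semi_riemannian_metric B S (induced_metric B A g j)"

definition tangent_to :: "('p, 'f::euclidean_space) atlas \<Rightarrow> 'p set \<Rightarrow> ('m, 'e::euclidean_space) atlas \<Rightarrow>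
    ('p \<Rightarrow> 'm) \<Rightarrow> ('m \<Rightarrow> 'e) \<Rightarrow> bool" where
  "tangent_to B S A j X \<longleftrightarrow> (\<forall>x\<in>S. X (j x) \<in> range (mdiff B A j x))"

definition invariant_submanifold ::
  "('p::topological_space, 'f::euclidean_space) atlas \<Rightarrow> 'p set \<Rightarrow>
   ('m::topological_space, 'e::euclidean_space) atlas \<Rightarrow> ('m \<Rightarrow> 'e \<Rightarrow> 'e) \<Rightarrow>
   ('m \<Rightarrow> 'e \<Rightarrow> 'e \<Rightarrow> real) \<Rightarrow> ('p \<Rightarrow> 'm) \<Rightarrow> bool" where
  "invariant_submanifold B S A \<phi> g j \<longleftrightarrow> nondegenerate_submanifold B S A g j \<and>
     (\<forall>x\<in>S. \<phi> (j x) ` range (mdiff B A j x) \<subseteq> range (mdiff B A j x))"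

definition totally_real_submanifold ::
  "('p::topological_space, 'f::euclidean_space) atlas \<Rightarrow> 'p set \<Rightarrow>
   ('m::topological_space, 'e::euclidean_space) atlas \<Rightarrow> ('m \<Rightarrow> 'e \<Rightarrow> 'e) \<Rightarrow>
   ('m \<Rightarrow> 'e \<Rightarrow> 'e \<Rightarrow> real) \<Rightarrow> ('p \<Rightarrow> 'm) \<Rightarrow> bool" where
  "totally_real_submanifold B S A \<phi> g j \<longleftrightarrow> nondegenerate_submanifold B S A g j \<and>
     (\<forall>x\<in>S. \<forall>v\<in>range (mdiff B A j x). \<forall>w\<in>range (mdiff B A j x). g (j x) (\<phi> (j x) v) w = 0)"

definition warped_product_metric :: "('p, 'e1::euclidean_space) atlas \<Rightarrow> ('q, 'e2::euclidean_space) atlas \<Rightarrow>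
    ('p \<Rightarrow> 'e1 \<Rightarrow> 'e1 \<Rightarrow> real) \<Rightarrow> ('p \<Rightarrow> real) \<Rightarrow> ('q \<Rightarrow> 'e2 \<Rightarrow> 'e2 \<Rightarrow> real) \<Rightarrow>
    'p \<times> 'q \<Rightarrow> 'e1 \<times> 'e2 \<Rightarrow> 'e1 \<times> 'e2 \<Rightarrow> real" where
  "warped_product_metric A1 A2 g1 f g2 x v w =
     (let P1 = mdiff (prod_atlas A1 A2) A1 fst x; P2 = mdiff (prod_atlas A1 A2) A2 snd x in
      g1 (fst x) (P1 v) (P1 w) + (f (fst x))\<^sup>2 * g2 (snd x) (P2 v) (P2 w))"

(* The submanifold j of the ambient manifold (A, g) is N1 x_f N2, the warping
   function f being defined on the first factor. *)
definition warped_product_submanifold ::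
  "('p::{t2_space,second_countable_topology}, 'e1::euclidean_space) atlas \<Rightarrow>
   ('q::{t2_space,second_countable_topology}, 'e2::euclidean_space) atlas \<Rightarrow>
   ('p \<Rightarrow> 'e1 \<Rightarrow> 'e1 \<Rightarrow> real) \<Rightarrow> ('p \<Rightarrow> real) \<Rightarrow> ('q \<Rightarrow> 'e2 \<Rightarrow> 'e2 \<Rightarrow> real) \<Rightarrow>
   ('m::topological_space, 'e::euclidean_space) atlas \<Rightarrow> ('m \<Rightarrow> 'e \<Rightarrow> 'e \<Rightarrow> real) \<Rightarrow>
   ('p \<times> 'q \<Rightarrow> 'm) \<Rightarrow> bool" where
  "warped_product_submanifold A1 A2 g1 f g2 A g j \<longleftrightarrow>
     smooth_manifold A1 \<and> smooth_manifold A2 \<and>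
     semi_riemannian_metric A1 UNIV g1 \<and> semi_riemannian_metric A2 UNIV g2 \<and>
     smooth_function A1 UNIV f \<and> (\<forall>p. f p > 0) \<and>
     nondegenerate_submanifold (prod_atlas A1 A2) UNIV A g j \<and>
     (\<forall>x v w. induced_metric (prod_atlas A1 A2) A g j x v w = warped_product_metric A1 A2 g1 f g2 x v w)"

section \<open>CR-products\<close>

definition smooth_distribution :: "('p::topological_space, 'f::euclidean_space) atlas \<Rightarrow>
    ('p \<Rightarrow> 'f set) \<Rightarrow> bool" where
  "smooth_distribution B D \<longleftrightarrow> (\<exists>k. \<forall>x. subspace (D x) \<and> dim (D x) = k \<and>
     (\<exists>U X. x \<in> U \<and> (\<forall>i<k. smooth_vf B U (X i)) \<and> open U \<and>
        (\<forall>y\<in>U. D y = span {X i y | i. i < (k::nat)})))"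

(* The distributions D and D' (for D^perp) consist of tangent vectors of the
   submanifold itself, not of their images in the ambient tangent space. *)
definition contact_CR_submanifold ::
  "('p::{t2_space,second_countable_topology}, 'f::euclidean_space) atlas \<Rightarrow>
   ('m::topological_space, 'e::euclidean_space) atlas \<Rightarrow> nat \<Rightarrow>
   ('m \<Rightarrow> 'e \<Rightarrow> 'e) \<Rightarrow> (nat \<Rightarrow> 'm \<Rightarrow> 'e) \<Rightarrow> ('m \<Rightarrow> 'e \<Rightarrow> 'e \<Rightarrow> real) \<Rightarrow> ('p \<Rightarrow> 'm) \<Rightarrow>
   ('p \<Rightarrow> 'f set) \<Rightarrow> ('p \<Rightarrow> 'f set) \<Rightarrow> bool" where
  "contact_CR_submanifold B A s \<phi> \<xi> g j D D' \<longleftrightarrow>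
     smooth_manifold B \<and> nondegenerate_submanifold B UNIV A g j \<and>
     (\<forall>\<alpha>\<in>{1..s}. tangent_to B UNIV A j (\<xi> \<alpha>)) \<and>
     smooth_distribution B D \<and> smooth_distribution B D' \<and>
     (\<forall>x. D x \<inter> D' x = {0} \<and> {v + w | v w. v \<in> D x \<and> w \<in> D' x} = UNIV \<and>
          (\<forall>v\<in>D x. \<forall>w\<in>D' x. induced_metric B A g j x v w = 0) \<and>
          \<phi> (j x) ` (mdiff B A j x ` D x) \<subseteq> mdiff B A j x ` D x \<and>
          (\<forall>v\<in>D' x. \<forall>w. g (j x) (\<phi> (j x) (mdiff B A j x v)) (mdiff B A j x w) = 0))"

(* Around every point, j is isometric, through a diffeomorphism \<psi>, to a product
   of semi-Riemannian manifolds (S1, h1) = N^perp and (S2, h2) = N^T, which are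
   integral manifolds of D' and D.  As the condition is local, the factors are
   taken to be coordinate domains, i.e. open subsets of Euclidean spaces; the
   model space 'e1 x 'e2 of the submanifold only records the two dimensions. *)
definition CR_product ::
  "('p::{t2_space,second_countable_topology}, 'e1::euclidean_space \<times> 'e2::euclidean_space) atlas \<Rightarrow>
   ('m::topological_space, 'e::euclidean_space) atlas \<Rightarrow> nat \<Rightarrow>
   ('m \<Rightarrow> 'e \<Rightarrow> 'e) \<Rightarrow> (nat \<Rightarrow> 'm \<Rightarrow> 'e) \<Rightarrow> ('m \<Rightarrow> 'e \<Rightarrow> 'e \<Rightarrow> real) \<Rightarrow> ('p \<Rightarrow> 'm) \<Rightarrow> bool" where
  "CR_product B A s \<phi> \<xi> g j \<longleftrightarrow>
     (\<exists>D D'. contact_CR_submanifold B A s \<phi> \<xi> g j D D' \<and>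
       (\<forall>x. \<exists>(S1 :: 'e1 set) (S2 :: 'e2 set) U \<psi> h1 h2.
          open S1 \<and> open S2 \<and> open U \<and> x \<in> U \<and>
          diffeomorphism eucl_atlas (S1 \<times> S2) B U \<psi> \<and>
          semi_riemannian_metric eucl_atlas S1 h1 \<and> semi_riemannian_metric eucl_atlas S2 h2 \<and>
          (\<forall>a\<in>S1. \<forall>b\<in>S2. \<forall>v w. induced_metric eucl_atlas A g (j \<circ> \<psi>) (a, b) v w =
             h1 a (fst v) (fst w) + h2 b (snd v) (snd w)) \<and>
          (\<forall>a\<in>S1. \<forall>b\<in>S2.
             range (mdiff eucl_atlas B (\<lambda>a'. \<psi> (a', b)) a) = D' (\<psi> (a, b)) \<and>
             range (mdiff eucl_atlas B (\<lambda>b'. \<psi> (a, b')) b) = D (\<psi> (a, b))) \<and>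
          (\<forall>b\<in>S2. totally_real_submanifold eucl_atlas S1 A \<phi> g (\<lambda>a. j (\<psi> (a, b)))) \<and>
          (\<forall>a\<in>S1. invariant_submanifold eucl_atlas S2 A \<phi> g (\<lambda>b. j (\<psi> (a, b))) \<and>
             (\<forall>\<alpha>\<in>{1..s}. tangent_to eucl_atlas S2 A (\<lambda>b. j (\<psi> (a, b))) (\<xi> \<alpha>)))))"

end

theory Submission
  imports Defs
begin

text \<open>The theorem says that the warping function of $N^\perp \times_f N^T$ is locally constant: on a
coordinate box the metric is then a product metric, once the constant $f^2$ has been absorbed
into the metric of $N^T$, and the tangent spaces of the two factors are the distributions of a
contact CR-submanifold.

The engine is the equation $d\eta^\alpha = \Phi$, pulled back to the submanifold. Let $J$ be a
parametrisation of (part of) the submanifold by an open set of a Euclidean space, and for a constant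
coordinate vector $a$ let $\theta(a) = \eta^\alpha(J_* a)$. As $d$ commutes with pullbacks,
\[ \partial_b \theta(a) - \partial_a \theta(b) = 2\, g(J_* b, \phi J_* a) \]
(lemma S_manifold_pullback). This elementary identity does the work that a computation with the
Levi-Civita connection and $\tilde\nabla\xi_\alpha = -\epsilon_\alpha\phi$ would do. It is used
together with $\epsilon_\alpha\eta^\alpha = g(\cdot,\xi_\alpha)$ and the skew-symmetry of $\Phi$.

Suppose first that the $\xi_\alpha$ are tangent to $N^\perp$. Then every $\eta^\alpha$ vanishes
on $TN^T$, so the identity, restricted to a leaf $N^T$, gives $g(v, \phi w) = 0$ for $v, w$ in
$TN^T$. But $\phi^2 = -1$ on $TN^T$, so the metric of $N^T$ would vanish; as model spaces have
positive dimension this is absurd (lemma xi_not_tangent_to_perp).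

Suppose now that the $\xi_\alpha$ are tangent to $N^T$. Then $\eta^\alpha$ vanishes on
$TN^\perp$. For $v$ tangent to $N^\perp$ and $w$ tangent to $N^T$ the vector $\phi w$ is again
tangent to $N^T$, hence orthogonal to $v$, and the identity says that the derivative of
$\eta^\alpha(w)$ in the direction $v$ is zero. So the linear form $\epsilon_\alpha\eta^\alpha(w)
= f^2 g_T(w, \xi_\alpha)$ on $T_qN^T$ does not change when $p \in N^\perp$ moves in a coordinate
ball. By nondegeneracy of $g_T$ the vector $Y = f^2 \xi_\alpha$ of $T_qN^T$ does not change
either, and since $\epsilon_\alpha = g(\xi_\alpha,\xi_\alpha) = f^2 g_T(\xi_\alpha,\xi_\alpha)$,
neither does $f^2 = \epsilon_\alpha\, g_T(Y, Y)$ (lemma warping_function_locally_constant).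

Much of the text prepares the calculus. A tangent vector is given by its components in a chart
chosen separately, and without any continuity, at each point. Smoothness can therefore never be
read off from components; every argument goes through the chain rule for differentials and the
coordinate fields of one fixed chart.\<close>

section \<open>Functions of class C^k and smooth functions\<close>

lemma frechet_derivative_cong_open:
  assumes "open S" "x \<in> S" "\<And>y. y \<in> S \<Longrightarrow> f y = g y"
  shows "frechet_derivative f (at x) = frechet_derivative g (at x)"
proof -
  have "(f has_derivative D) (at x) \<longleftrightarrow> (g has_derivative D) (at x)" for D
    using has_derivative_transform_within_open[of f D x UNIV S g]
      has_derivative_transform_within_open[of g D x UNIV S f] assms by metis
  then show ?thesis by (simp add: frechet_derivative_def)
qed

lemma differentiable_cong_open:
  assumes "open S" "x \<in> S" "\<And>y. y \<in> S \<Longrightarrow> f y = g y" "f differentiable (at x)"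
  shows "g differentiable (at x)"
  using has_derivative_transform_within_open[of f _ x UNIV S g] assms
  by (metis differentiable_def)

lemma C_k_on_cong:
  assumes "open S" "\<And>x. x \<in> S \<Longrightarrow> f x = g x" "C_k_on k S f"
  shows "C_k_on k S g"
  using assms(2,3)
proof (induction k arbitrary: f g)
  case 0
  then show ?case by (auto cong: continuous_on_cong)
next
  case (Suc k)
  have "C_k_on k S (\<lambda>x. frechet_derivative g (at x) v)" for v
    using Suc.IH[of "\<lambda>x. frechet_derivative f (at x) v" "\<lambda>x. frechet_derivative g (at x) v"]
      frechet_derivative_cong_open[OF assms(1), of _ f g] Suc.prems by simp
  moreover have "g differentiable (at x)" if "x \<in> S" for x
    using differentiable_cong_open[OF assms(1) that, of f g] Suc.prems that by simp
  ultimately show ?case by simp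
qed

lemma C_k_on_subset: "C_k_on k S f \<Longrightarrow> T \<subseteq> S \<Longrightarrow> C_k_on k T f"
  by (induction k arbitrary: f) (auto intro: continuous_on_subset)

lemma C_k_on_SucD: "C_k_on (Suc k) S f \<Longrightarrow> C_k_on k S f"
proof (induction k arbitrary: f)
  case 0
  then show ?case
    by (simp add: continuous_at_imp_continuous_on differentiable_imp_continuous_within)
next
  case (Suc k)
  then show ?case by (metis C_k_on.simps(2))
qed

lemma C_k_on_localI:
  assumes "\<And>x. x \<in> S \<Longrightarrow> \<exists>U. open U \<and> x \<in> U \<and> C_k_on k U f"
  shows "C_k_on k S f"
  using assms
proof (induction k arbitrary: f)
  case 0
  have "continuous (at x within S) f" if "x \<in> S" for x
    using 0[OF that] by (auto simp: continuous_on_eq_continuous_at intro: continuous_at_imp_continuous_at_within)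
  then show ?case by (simp add: continuous_on_eq_continuous_within)
next
  case (Suc k)
  have "C_k_on k S (\<lambda>x. frechet_derivative f (at x) v)" for v
    by (rule Suc.IH) (use Suc.prems in fastforce)
  then show ?case using Suc.prems by fastforce
qed

lemma differentiable_has_frechet_derivative: "f differentiable (at x) \<Longrightarrow> (f has_derivative frechet_derivative f (at x)) (at x)"
  by (simp add: frechet_derivative_works)

lemma C_k_on_const: "C_k_on k S (\<lambda>x. c)"
  by (induction k arbitrary: c) auto

lemma C_k_on_linear: "bounded_linear L \<Longrightarrow> C_k_on k S L"
proof (cases k)
  case (Suc m)
  assume L: "bounded_linear L"
  have "frechet_derivative L (at x) = L" for x
    using frechet_derivative_at[OF bounded_linear.has_derivative[OF L has_derivative_ident]] by (simp add: fun_eq_iff)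
  then show ?thesis using L by (simp add: Suc C_k_on_const bounded_linear_imp_differentiable)
qed (simp add: linear_continuous_on)

lemma C_k_on_add:
  assumes "open S" "C_k_on k S f" "C_k_on k S g"
  shows "C_k_on k S (\<lambda>x. f x + g x)"
  using assms(2,3)
proof (induction k arbitrary: f g)
  case (Suc k)
  have "C_k_on k S (\<lambda>x. frechet_derivative (\<lambda>x. f x + g x) (at x) v)" for v
  proof (rule C_k_on_cong[OF assms(1)])
    show "C_k_on k S (\<lambda>x. frechet_derivative f (at x) v + frechet_derivative g (at x) v)"
      using Suc by simp
    show "frechet_derivative f (at x) v + frechet_derivative g (at x) v =
        frechet_derivative (\<lambda>x. f x + g x) (at x) v" if "x \<in> S" for x
    proof -
      have "f differentiable (at x)" "g differentiable (at x)" using Suc.prems that by simp_all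
      from frechet_derivative_at[OF has_derivative_add[OF this[THEN differentiable_has_frechet_derivative]]]
      show ?thesis by (rule fun_cong)
    qed
  qed
  then show ?case using Suc.prems by simp
qed (auto intro: continuous_on_add)

lemma C_k_on_scaleR:
  fixes f :: "_ \<Rightarrow> real"
  assumes "open S" "C_k_on k S f" "C_k_on k S g"
  shows "C_k_on k S (\<lambda>x. f x *\<^sub>R g x)"
  using assms(2,3)
proof (induction k arbitrary: f g)
  case (Suc k)
  have "C_k_on k S (\<lambda>x. frechet_derivative (\<lambda>x. f x *\<^sub>R g x) (at x) v)" for v
  proof (rule C_k_on_cong[OF assms(1)])
    show "C_k_on k S (\<lambda>x. f x *\<^sub>R frechet_derivative g (at x) v + frechet_derivative f (at x) v *\<^sub>R g x)"
      using Suc C_k_on_SucD[of k S f] C_k_on_SucD[of k S g] by (auto intro!: C_k_on_add assms(1) Suc.IH)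
    show "f x *\<^sub>R frechet_derivative g (at x) v + frechet_derivative f (at x) v *\<^sub>R g x =
        frechet_derivative (\<lambda>x. f x *\<^sub>R g x) (at x) v" if "x \<in> S" for x
    proof -
      have "f differentiable (at x)" "g differentiable (at x)" using Suc.prems that by simp_all
      from frechet_derivative_at[OF has_derivative_scaleR[OF this[THEN differentiable_has_frechet_derivative]]]
      show ?thesis by (rule fun_cong)
    qed
  qed
  then show ?case using Suc.prems by simp
qed (auto intro: continuous_on_scaleR)

lemma C_k_on_linear_compose:
  assumes "open S" "bounded_linear L" "C_k_on k S f"
  shows "C_k_on k S (\<lambda>x. L (f x))"
  using assms(3)
proof (induction k arbitrary: f)
  case (Suc k)
  note D = bounded_linear.has_derivative[OF assms(2) differentiable_has_frechet_derivative]
  have "C_k_on k S (\<lambda>x. frechet_derivative (\<lambda>x. L (f x)) (at x) v)" for v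
  proof (rule C_k_on_cong[OF assms(1)])
    show "C_k_on k S (\<lambda>x. L (frechet_derivative f (at x) v))"
      using Suc by simp
    show "L (frechet_derivative f (at x) v) = frechet_derivative (\<lambda>x. L (f x)) (at x) v" if "x \<in> S" for x
      using frechet_derivative_at[OF D[of f x]] Suc.prems that by (metis C_k_on.simps(2))
  qed
  moreover have "(\<lambda>x. L (f x)) differentiable (at x)" if "x \<in> S" for x
    using D[of f x] Suc.prems that by (metis C_k_on.simps(2) differentiableI)
  ultimately show ?case by simp
qed (use assms(2) in \<open>auto intro: bounded_linear.continuous_on\<close>)

lemma C_k_on_sum:
  assumes "open S" "\<And>i. i \<in> I \<Longrightarrow> C_k_on k S (f i)"
  shows "C_k_on k S (\<lambda>x. \<Sum>i\<in>I. f i x)"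
  using assms(2)
  by (induction I rule: infinite_finite_induct) (auto simp: C_k_on_const intro!: C_k_on_add assms(1))

lemma linear_basis_expansion:
  assumes "linear L" shows "L v = (\<Sum>b\<in>Basis. (v \<bullet> b) *\<^sub>R L b)"
proof -
  have "L v = L (\<Sum>b\<in>Basis. (v \<bullet> b) *\<^sub>R b)" by (simp add: euclidean_representation)
  then show ?thesis by (simp add: linear_sum[OF assms] linear_scale[OF assms] del: euclidean_representation)
qed

lemma frechet_derivative_chain:
  assumes "f differentiable (at x)" "g differentiable (at (f x))"
  shows "frechet_derivative (\<lambda>x. g (f x)) (at x) v = frechet_derivative g (at (f x)) (frechet_derivative f (at x) v)"
  using frechet_derivative_compose[OF assms] by (simp add: o_def fun_eq_iff)

text \<open>In a basis the chain rule reads $D(g \circ f)\,v = \sum_b (Df\,v)_b \, (D_b g) \circ f$. Each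
summand is a product of a scalar function and a composition of one order less, so that induction
on the order applies.\<close>

lemma C_k_on_compose:
  fixes f :: "'a::euclidean_space \<Rightarrow> 'b::euclidean_space"
  assumes S: "open S" and T: "open T" and sub: "f ` S \<subseteq> T"
    and "C_k_on k S f" "C_k_on k T g"
  shows "C_k_on k S (\<lambda>x. g (f x))"
  using assms(4,5)
proof (induction k arbitrary: g)
  case 0
  then show ?case using sub continuous_on_compose2[of T g S f] by simp
next
  case (Suc k)
  have df: "f differentiable (at x)" and dg: "g differentiable (at (f x))" if "x \<in> S" for x
    using Suc.prems sub that by auto
  have "C_k_on k S (\<lambda>x. frechet_derivative (\<lambda>x. g (f x)) (at x) v)" for v
  proof (rule C_k_on_cong[OF S])
    show "C_k_on k S (\<lambda>x. \<Sum>b\<in>Basis. (frechet_derivative f (at x) v \<bullet> b) *\<^sub>R frechet_derivative g (at (f x)) b)"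
      using Suc.prems C_k_on_SucD[of k S f]
      by (intro C_k_on_sum C_k_on_scaleR S Suc.IH C_k_on_linear_compose[OF S bounded_linear_inner_left]) auto
    show "(\<Sum>b\<in>Basis. (frechet_derivative f (at x) v \<bullet> b) *\<^sub>R frechet_derivative g (at (f x)) b) =
        frechet_derivative (\<lambda>x. g (f x)) (at x) v" if "x \<in> S" for x
      unfolding frechet_derivative_chain[OF df dg, OF that that]
      by (rule linear_basis_expansion[OF linear_frechet_derivative[OF dg[OF that]], symmetric])
  qed
  moreover have "(\<lambda>x. g (f x)) differentiable (at x)" if "x \<in> S" for x
    using differentiable_chain_at[OF df dg, OF that that] by (simp add: o_def)
  ultimately show ?case by simp
qed

lemma smooth_on_cong: "open S \<Longrightarrow> (\<And>x. x \<in> S \<Longrightarrow> f x = g x) \<Longrightarrow> smooth_on S f \<Longrightarrow> smooth_on S g"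
  unfolding smooth_on_def using C_k_on_cong by blast

lemma smooth_on_subset: "smooth_on S f \<Longrightarrow> T \<subseteq> S \<Longrightarrow> smooth_on T f"
  unfolding smooth_on_def using C_k_on_subset by blast

lemma smooth_on_localI: "(\<And>x. x \<in> S \<Longrightarrow> \<exists>U. open U \<and> x \<in> U \<and> smooth_on U f) \<Longrightarrow> smooth_on S f"
  unfolding smooth_on_def by (meson C_k_on_localI)

lemma smooth_on_const: "smooth_on S (\<lambda>x. c)"
  unfolding smooth_on_def by (simp add: C_k_on_const)

lemma smooth_on_linear: "bounded_linear L \<Longrightarrow> smooth_on S L"
  unfolding smooth_on_def by (simp add: C_k_on_linear)

lemma smooth_on_ident: "smooth_on S (\<lambda>x. x)"
  by (simp add: smooth_on_linear bounded_linear_ident)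

lemma smooth_on_add: "open S \<Longrightarrow> smooth_on S f \<Longrightarrow> smooth_on S g \<Longrightarrow> smooth_on S (\<lambda>x. f x + g x)"
  unfolding smooth_on_def by (simp add: C_k_on_add)

lemma smooth_on_scaleR:
  fixes f :: "_ \<Rightarrow> real"
  shows "open S \<Longrightarrow> smooth_on S f \<Longrightarrow> smooth_on S g \<Longrightarrow> smooth_on S (\<lambda>x. f x *\<^sub>R g x)"
  unfolding smooth_on_def by (simp add: C_k_on_scaleR)

lemma smooth_on_linear_compose:
  "open S \<Longrightarrow> bounded_linear L \<Longrightarrow> smooth_on S f \<Longrightarrow> smooth_on S (\<lambda>x. L (f x))"
  unfolding smooth_on_def by (simp add: C_k_on_linear_compose)

lemma smooth_on_sum:
  "open S \<Longrightarrow> (\<And>i. i \<in> I \<Longrightarrow> smooth_on S (f i)) \<Longrightarrow> smooth_on S (\<lambda>x. \<Sum>i\<in>I. f i x)"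
  unfolding smooth_on_def by (simp add: C_k_on_sum)

lemma smooth_on_compose:
  fixes f :: "'a::euclidean_space \<Rightarrow> 'b::euclidean_space"
  shows "open S \<Longrightarrow> open T \<Longrightarrow> f ` S \<subseteq> T \<Longrightarrow> smooth_on S f \<Longrightarrow> smooth_on T g \<Longrightarrow> smooth_on S (\<lambda>x. g (f x))"
  unfolding smooth_on_def using C_k_on_compose by blast

lemma smooth_on_Pair:
  assumes "open S" "smooth_on S f" "smooth_on S g"
  shows "smooth_on S (\<lambda>x. (f x, g x))"
proof -
  have "smooth_on S (\<lambda>x. (f x, 0) + (0, g x))"
    using assms by (intro smooth_on_add smooth_on_linear_compose[of S "\<lambda>y. (y, 0)" f]
        smooth_on_linear_compose[of S "\<lambda>y. (0, y)" g] bounded_linear_Pair bounded_linear_ident bounded_linear_zero)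
  then show ?thesis by simp
qed

lemma smooth_on_differentiable: "smooth_on S f \<Longrightarrow> x \<in> S \<Longrightarrow> f differentiable (at x)"
  unfolding smooth_on_def by (metis C_k_on.simps(2))

lemma smooth_on_continuous: "smooth_on S f \<Longrightarrow> continuous_on S f"
  unfolding smooth_on_def by (metis C_k_on.simps(1))

lemma smooth_on_derivative: "smooth_on S f \<Longrightarrow> smooth_on S (\<lambda>x. frechet_derivative f (at x) v)"
  unfolding smooth_on_def by (metis C_k_on.simps(2))

lemma smooth_on_derivative_along:
  assumes "open S" "smooth_on S f" "smooth_on S (X :: 'a::euclidean_space \<Rightarrow> 'a)"
  shows "smooth_on S (\<lambda>x. frechet_derivative f (at x) (X x))"
proof (rule smooth_on_cong[OF assms(1)])
  show "smooth_on S (\<lambda>x. \<Sum>b\<in>Basis. (X x \<bullet> b) *\<^sub>R frechet_derivative f (at x) b)"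
    by (intro smooth_on_sum smooth_on_scaleR smooth_on_derivative assms
        smooth_on_linear_compose[OF _ bounded_linear_inner_left])
  show "(\<Sum>b\<in>Basis. (X x \<bullet> b) *\<^sub>R frechet_derivative f (at x) b) = frechet_derivative f (at x) (X x)"
    if "x \<in> S" for x
    by (rule linear_basis_expansion[OF linear_frechet_derivative[OF smooth_on_differentiable[OF assms(2) that]], symmetric])
qed

section \<open>Symmetry of the second derivative\<close>

text \<open>Two applications of the mean value theorem, first in the direction $a$ and then in the direction
$b$. The left-hand side is symmetric in $a$ and $b$ while the order of the derivatives on the
right is not.\<close>

lemma second_difference_mean_value:
  fixes f :: "'a::euclidean_space \<Rightarrow> real"
  assumes f: "\<And>y. y \<in> ball x r \<Longrightarrow> f differentiable (at y)"
    and df: "\<And>y. y \<in> ball x r \<Longrightarrow> (\<lambda>y. frechet_derivative f (at y) a) differentiable (at y)"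
    and h: "h > 0" "h * (norm a + norm b) < r"
  obtains y where "norm (y - x) \<le> h * (norm a + norm b)"
    "f (x + h *\<^sub>R a + h *\<^sub>R b) - f (x + h *\<^sub>R a) - f (x + h *\<^sub>R b) + f x =
       h * h * frechet_derivative (\<lambda>y. frechet_derivative f (at y) a) (at y) b"
proof -
  have near: "norm (s *\<^sub>R a + t *\<^sub>R b) \<le> h * (norm a + norm b)" if "0 \<le> s" "s \<le> h" "0 \<le> t" "t \<le> h" for s t
    using norm_triangle_ineq[of "s *\<^sub>R a" "t *\<^sub>R b"] mult_right_mono[of s h "norm a"]
      mult_right_mono[of t h "norm b"] that by (simp add: algebra_simps)
  have inb: "x + s *\<^sub>R a + t *\<^sub>R b \<in> ball x r" if "0 \<le> s" "s \<le> h" "0 \<le> t" "t \<le> h" for s t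
    using near[OF that] h norm_minus_commute[of x "x + s *\<^sub>R a + t *\<^sub>R b"]
    by (simp add: dist_norm algebra_simps)
  let ?p = "\<lambda>s. f (x + s *\<^sub>R a + h *\<^sub>R b) - f (x + s *\<^sub>R a)"
  let ?D = "\<lambda>y. frechet_derivative f (at y)"
  have der: "((\<lambda>s. f (x + s *\<^sub>R a + t *\<^sub>R b)) has_derivative (\<lambda>u. u * ?D (x + s *\<^sub>R a + t *\<^sub>R b) a)) (at s)"
    if "0 \<le> s" "s \<le> h" "0 \<le> t" "t \<le> h" for s t
  proof -
    have d: "f differentiable (at (x + s *\<^sub>R a + t *\<^sub>R b))" using f inb[OF that] by blast
    have "((\<lambda>s. x + s *\<^sub>R a + t *\<^sub>R b) has_derivative (\<lambda>u. u *\<^sub>R a)) (at s)"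
      by (auto intro!: derivative_eq_intros)
    from has_derivative_compose[OF this differentiable_has_frechet_derivative[OF d]]
    show ?thesis by (simp add: linear_scale[OF linear_frechet_derivative[OF d]])
  qed
  have "\<exists>s. 0 < s \<and> s < h \<and> ?p h - ?p 0 = (h - 0) * (?D (x + s *\<^sub>R a + h *\<^sub>R b) a - ?D (x + s *\<^sub>R a) a)"
  proof (rule MVT2[OF h(1)])
    show "(?p has_real_derivative (?D (x + s *\<^sub>R a + h *\<^sub>R b) a - ?D (x + s *\<^sub>R a) a)) (at s)"
      if "0 \<le> s" "s \<le> h" for s
    proof -
      have "(?p has_derivative (\<lambda>u. u * ?D (x + s *\<^sub>R a + h *\<^sub>R b) a - u * ?D (x + s *\<^sub>R a) a)) (at s)"
        using has_derivative_diff[OF der[of s h] der[of s 0]] that h(1) by simp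
      moreover have "(\<lambda>u. u * A - u * B) = (*) (A - B)" for A B :: real
        by (simp add: fun_eq_iff algebra_simps)
      ultimately show ?thesis by (simp only: has_field_derivative_def)
    qed
  qed
  then obtain s where s: "0 < s" "s < h" "?p h - ?p 0 = h * (?D (x + s *\<^sub>R a + h *\<^sub>R b) a - ?D (x + s *\<^sub>R a) a)"
    by auto
  let ?q = "\<lambda>t. ?D (x + s *\<^sub>R a + t *\<^sub>R b) a"
  let ?E = "\<lambda>t. frechet_derivative (\<lambda>y. ?D y a) (at (x + s *\<^sub>R a + t *\<^sub>R b)) b"
  have "\<exists>t. 0 < t \<and> t < h \<and> ?q h - ?q 0 = (h - 0) * ?E t"
  proof (rule MVT2[OF h(1)])
    fix t assume t: "0 \<le> t" "t \<le> h"
    have d: "(\<lambda>y. ?D y a) differentiable (at (x + s *\<^sub>R a + t *\<^sub>R b))" using df inb[of s t] s t by simp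
    have "((\<lambda>t. x + s *\<^sub>R a + t *\<^sub>R b) has_derivative (\<lambda>u. u *\<^sub>R b)) (at t)"
      by (auto intro!: derivative_eq_intros)
    from has_derivative_compose[OF this differentiable_has_frechet_derivative[OF d]]
    have "(?q has_derivative (\<lambda>u. u * ?E t)) (at t)"
      by (simp add: linear_scale[OF linear_frechet_derivative[OF d]])
    moreover have "(\<lambda>u. u * A) = (*) A" for A :: real
      by (simp add: fun_eq_iff)
    ultimately show "(?q has_real_derivative ?E t) (at t)" by (simp only: has_field_derivative_def)
  qed
  then obtain t where t: "0 < t" "t < h" "?q h - ?q 0 = h * ?E t" by auto
  show ?thesis
  proof (rule that)
    show "norm (x + s *\<^sub>R a + t *\<^sub>R b - x) \<le> h * (norm a + norm b)"
      using near[of s t] s t by (simp add: algebra_simps)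
    show "f (x + h *\<^sub>R a + h *\<^sub>R b) - f (x + h *\<^sub>R a) - f (x + h *\<^sub>R b) + f x = h * h * ?E t"
      using s(3) t(3) by (simp add: algebra_simps)
  qed
qed

text \<open>The symmetric second difference is $h^2 \partial_b\partial_a f$ at one nearby point and $h^2
\partial_a\partial_b f$ at another. Continuity of both second derivatives makes them agree in
the limit.\<close>

lemma second_derivative_symmetric_real:
  fixes f :: "'a::euclidean_space \<Rightarrow> real"
  assumes S: "open S" "x \<in> S" and f: "C_k_on 2 S f"
  shows "frechet_derivative (\<lambda>y. frechet_derivative f (at y) a) (at x) b =
         frechet_derivative (\<lambda>y. frechet_derivative f (at y) b) (at x) a"
proof -
  let ?G = "\<lambda>a b y. frechet_derivative (\<lambda>y. frechet_derivative f (at y) a) (at y) b"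
  have f0: "f differentiable (at y)" and f1: "(\<lambda>y. frechet_derivative f (at y) v) differentiable (at y)"
    if "y \<in> S" for y v
    using f that by (auto simp: numeral_2_eq_2)
  have cont: "continuous (at x) (?G u v)" for u v
    using f S by (auto simp: numeral_2_eq_2 continuous_on_eq_continuous_at)
  obtain r where r: "r > 0" "ball x r \<subseteq> S" using S open_contains_ball by blast
  have "\<bar>?G a b x - ?G b a x\<bar> < e + e" if "e > 0" for e
  proof -
    obtain d1 where d1: "d1 > 0" "\<And>y. dist y x < d1 \<Longrightarrow> dist (?G a b y) (?G a b x) < e"
      using cont[of a b] \<open>e > 0\<close> unfolding continuous_at_eps_delta by blast
    obtain d2 where d2: "d2 > 0" "\<And>y. dist y x < d2 \<Longrightarrow> dist (?G b a y) (?G b a x) < e"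
      using cont[of b a] \<open>e > 0\<close> unfolding continuous_at_eps_delta by blast
    define m where "m = Min {r, d1, d2}"
    have m: "m > 0" "m \<le> r" "m \<le> d1" "m \<le> d2" using r d1 d2 by (auto simp: m_def)
    define h where "h = m / (norm a + norm b + 1)"
    have n0: "norm a + norm b + 1 > 0" by (smt (verit) norm_ge_zero)
    have h: "h > 0" using m n0 by (simp add: h_def)
    have hm: "h * (norm a + norm b) < m"
      using m n0 by (simp add: h_def field_simps)
    have hm': "h * (norm b + norm a) < m" using hm by (simp add: add.commute)
    obtain y where y: "norm (y - x) \<le> h * (norm a + norm b)"
      "f (x + h *\<^sub>R a + h *\<^sub>R b) - f (x + h *\<^sub>R a) - f (x + h *\<^sub>R b) + f x = h * h * ?G a b y"
      by (rule second_difference_mean_value[of x r f a h b]) (use r f0 f1 h hm m in auto)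
    obtain z where z: "norm (z - x) \<le> h * (norm b + norm a)"
      "f (x + h *\<^sub>R b + h *\<^sub>R a) - f (x + h *\<^sub>R b) - f (x + h *\<^sub>R a) + f x = h * h * ?G b a z"
      by (rule second_difference_mean_value[of x r f b h a]) (use r f0 f1 h hm' m in auto)
    have "h * h * ?G a b y = h * h * ?G b a z" using y(2) z(2) by (simp add: algebra_simps)
    then have "?G a b y = ?G b a z" using h by simp
    moreover have "\<bar>?G a b y - ?G a b x\<bar> < e" using d1(2)[of y] y(1) hm m by (simp add: dist_norm)
    moreover have "\<bar>?G b a z - ?G b a x\<bar> < e" using d2(2)[of z] z(1) hm' m by (simp add: dist_norm)
    ultimately show ?thesis by linarith
  qed
  from this[of "\<bar>?G a b x - ?G b a x\<bar> / 2"] show ?thesis by fastforce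
qed

lemma second_derivative_symmetric:
  fixes f :: "'a::euclidean_space \<Rightarrow> 'b::euclidean_space"
  assumes S: "open S" "x \<in> S" and f: "smooth_on S f"
  shows "frechet_derivative (\<lambda>y. frechet_derivative f (at y) a) (at x) b =
         frechet_derivative (\<lambda>y. frechet_derivative f (at y) b) (at x) a"
proof (rule euclidean_eqI)
  fix k :: 'b
  have inner: "frechet_derivative (\<lambda>y. h y \<bullet> k) (at y) v = frechet_derivative h (at y) v \<bullet> k"
    if "smooth_on S h" "y \<in> S" for h :: "'a \<Rightarrow> 'b" and y v
    using frechet_derivative_at[OF bounded_linear.has_derivative[OF bounded_linear_inner_left differentiable_has_frechet_derivative[OF smooth_on_differentiable[OF that]]], symmetric]
    by metis
  have second: "frechet_derivative (\<lambda>y. frechet_derivative (\<lambda>y. f y \<bullet> k) (at y) u) (at x) v =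
      frechet_derivative (\<lambda>y. frechet_derivative f (at y) u) (at x) v \<bullet> k" for u v
    using frechet_derivative_cong_open[OF S, of "\<lambda>y. frechet_derivative (\<lambda>y. f y \<bullet> k) (at y) u"
        "\<lambda>y. frechet_derivative f (at y) u \<bullet> k"] inner[OF f] inner[OF smooth_on_derivative[OF f] S(2)]
    by simp
  have "C_k_on 2 S (\<lambda>y. f y \<bullet> k)"
    using smooth_on_linear_compose[OF S(1) bounded_linear_inner_left f] by (simp add: smooth_on_def)
  from second_derivative_symmetric_real[OF S this, of a b]
  show "frechet_derivative (\<lambda>y. frechet_derivative f (at y) a) (at x) b \<bullet> k =
     frechet_derivative (\<lambda>y. frechet_derivative f (at y) b) (at x) a \<bullet> k"
    by (simp add: second)
qed

section \<open>Charts, smooth maps and differentials\<close>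

lemma cinv_into: "y \<in> snd c ` fst c \<Longrightarrow> cinv c y \<in> fst c"
  by (simp add: cinv_def inv_into_into)

lemma chart_cinv: "y \<in> snd c ` fst c \<Longrightarrow> snd c (cinv c y) = y"
  by (simp add: cinv_def f_inv_into_f)

lemma cinv_chart: "is_chart c \<Longrightarrow> p \<in> fst c \<Longrightarrow> cinv c (snd c p) = p"
  by (simp add: is_chart_def homeomorphism_def)

lemma open_chart_domain: "is_chart c \<Longrightarrow> open (fst c)"
  by (simp add: is_chart_def)

lemma open_chart_image:
  assumes c: "is_chart c" and U: "open U"
  shows "open (snd c ` (fst c \<inter> U))"
proof -
  have "snd c ` (fst c \<inter> U) = cinv c -` U \<inter> snd c ` fst c"
    using cinv_chart[OF c] by force
  moreover have "open (cinv c -` U \<inter> snd c ` fst c)"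
    using c U by (auto simp: is_chart_def homeomorphism_def continuous_on_open_vimage)
  ultimately show ?thesis by simp
qed

lemma smooth_manifold_chart: "smooth_manifold A \<Longrightarrow> c \<in> A \<Longrightarrow> is_chart c"
  by (simp add: smooth_manifold_def)

lemma smooth_manifold_transition:
  "smooth_manifold A \<Longrightarrow> c \<in> A \<Longrightarrow> d \<in> A \<Longrightarrow> smooth_on (snd c ` (fst c \<inter> fst d)) (\<lambda>y. snd d (cinv c y))"
  by (simp add: smooth_manifold_def o_def)

lemma chart_at_props:
  assumes "smooth_manifold A"
  shows "chart_at A p \<in> A" "p \<in> fst (chart_at A p)" "is_chart (chart_at A p)"
proof -
  have "p \<in> (\<Union>c\<in>A. fst c)" using assms by (simp add: smooth_manifold_def)
  then have "\<exists>c. c \<in> A \<and> p \<in> fst c" by blast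
  from someI_ex[OF this] show "chart_at A p \<in> A" "p \<in> fst (chart_at A p)" by (simp_all add: chart_at_def)
  then show "is_chart (chart_at A p)" using assms smooth_manifold_chart by blast
qed

lemma open_restricted_preimage: "open S \<Longrightarrow> continuous_on S h \<Longrightarrow> open V \<Longrightarrow> open (S \<inter> h -` V)"
  by (simp add: continuous_on_open_vimage Int_commute)

lemma smooth_map_open: "smooth_map A S B h \<Longrightarrow> open S"
  and smooth_map_continuous: "smooth_map A S B h \<Longrightarrow> continuous_on S h"
  by (simp_all add: smooth_map_def)

lemma smooth_map_representative:
  assumes "smooth_manifold A" "smooth_manifold B" "smooth_map A S B h" "c \<in> A" "d \<in> B"
  shows "open (snd c ` (fst c \<inter> (S \<inter> h -` fst d)))"
    "smooth_on (snd c ` (fst c \<inter> (S \<inter> h -` fst d))) (\<lambda>y. snd d (h (cinv c y)))"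
proof -
  show "open (snd c ` (fst c \<inter> (S \<inter> h -` fst d)))"
    using assms by (intro open_chart_image open_restricted_preimage)
      (auto simp: smooth_map_def smooth_manifold_def is_chart_def)
  show "smooth_on (snd c ` (fst c \<inter> (S \<inter> h -` fst d))) (\<lambda>y. snd d (h (cinv c y)))"
    using assms by (simp add: smooth_map_def o_def Int_assoc)
qed

text \<open>Smoothness may be tested near each point in a single pair of charts, because any other pair
differs from it by smooth transition maps.\<close>

lemma smooth_map_localI:
  assumes A: "smooth_manifold A" and B: "smooth_manifold B" and S: "open S" and h: "continuous_on S h"
    and loc: "\<And>p. p \<in> S \<Longrightarrow> \<exists>c\<in>A. \<exists>d\<in>B. \<exists>U. open U \<and> p \<in> U \<and> U \<subseteq> S \<inter> fst c \<and> h ` U \<subseteq> fst d \<and>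
        smooth_on (snd c ` U) (\<lambda>y. snd d (h (cinv c y)))"
  shows "smooth_map A S B h"
  unfolding smooth_map_def
proof (intro conjI S h ballI)
  fix c' d' assume c': "c' \<in> A" and d': "d' \<in> B"
  show "smooth_on (snd c' ` (fst c' \<inter> S \<inter> h -` fst d')) (snd d' \<circ> h \<circ> cinv c')"
  proof (rule smooth_on_localI)
    fix x assume "x \<in> snd c' ` (fst c' \<inter> S \<inter> h -` fst d')"
    then obtain p where p: "p \<in> fst c'" "p \<in> S" "h p \<in> fst d'" "x = snd c' p" by auto
    obtain c d U where c: "c \<in> A" and d: "d \<in> B" and U: "open U" "p \<in> U" "U \<subseteq> S" "U \<subseteq> fst c" "h ` U \<subseteq> fst d"
      and sm: "smooth_on (snd c ` U) (\<lambda>y. snd d (h (cinv c y)))"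
      using loc[OF p(2)] by blast
    note ch = smooth_manifold_chart[OF A c] smooth_manifold_chart[OF A c']
      smooth_manifold_chart[OF B d] smooth_manifold_chart[OF B d']
    define W where "W = U \<inter> h -` fst d'"
    have W: "open W"
      unfolding W_def by (intro open_restricted_preimage U continuous_on_subset[OF h] open_chart_domain ch)
    define V where "V = snd c' ` (fst c' \<inter> W)"
    have V: "open V" unfolding V_def by (rule open_chart_image[OF ch(2) W])
    have "open (snd c ` (fst c \<inter> W))" by (rule open_chart_image[OF ch(1) W])
    moreover have "fst c \<inter> W = W" using U by (auto simp: W_def)
    ultimately have cW: "open (snd c ` W)" by simp
    have od: "open (snd d ` (fst d \<inter> fst d'))" by (intro open_chart_image ch open_chart_domain)
    have 1: "smooth_on V (\<lambda>y. snd c (cinv c' y))"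
      using smooth_manifold_transition[OF A c' c] by (rule smooth_on_subset) (use U in \<open>auto simp: V_def W_def\<close>)
    have 2: "smooth_on (snd c ` W) (\<lambda>y. snd d (h (cinv c y)))"
      using sm by (rule smooth_on_subset) (auto simp: W_def)
    have 3: "smooth_on V (\<lambda>y. snd d (h (cinv c (snd c (cinv c' y)))))"
      by (rule smooth_on_compose[OF V cW _ 1 2]) (auto simp: V_def cinv_chart[OF ch(2)])
    have 4: "smooth_on V (\<lambda>y. snd d' (cinv d (snd d (h (cinv c (snd c (cinv c' y)))))))"
      by (rule smooth_on_compose[OF V od _ 3 smooth_manifold_transition[OF B d d']])
        (use U in \<open>auto simp: V_def W_def cinv_chart[OF ch(2)] cinv_chart[OF ch(1)] subset_iff\<close>)
    have "smooth_on V (snd d' \<circ> h \<circ> cinv c')"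
    proof (rule smooth_on_cong[OF V _ 4])
      fix y assume "y \<in> V"
      then obtain r where r: "r \<in> fst c'" "r \<in> U" "h r \<in> fst d'" "y = snd c' r" by (auto simp: V_def W_def)
      then have "r \<in> fst c" "h r \<in> fst d" using U by auto
      then show "snd d' (cinv d (snd d (h (cinv c (snd c (cinv c' y)))))) = (snd d' \<circ> h \<circ> cinv c') y"
        using r by (simp add: cinv_chart ch)
    qed
    moreover have "x \<in> V" using p U by (auto simp: V_def W_def)
    ultimately show "\<exists>U. open U \<and> x \<in> U \<and> smooth_on U (snd d' \<circ> h \<circ> cinv c')" using V by blast
  qed
qed

lemma smooth_map_subset:
  assumes "smooth_map A S B h" "open T" "T \<subseteq> S"
  shows "smooth_map A T B h"
  unfolding smooth_map_def
proof (intro conjI ballI)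
  show "open T" "continuous_on T h"
    using assms by (auto simp: smooth_map_def intro: continuous_on_subset)
  fix c d assume "c \<in> A" "d \<in> B"
  then have "smooth_on (snd c ` (fst c \<inter> S \<inter> h -` fst d)) (snd d \<circ> h \<circ> cinv c)"
    using assms(1) by (simp add: smooth_map_def)
  then show "smooth_on (snd c ` (fst c \<inter> T \<inter> h -` fst d)) (snd d \<circ> h \<circ> cinv c)"
    by (rule smooth_on_subset) (use assms(3) in auto)
qed

lemma smooth_map_cong:
  assumes A: "smooth_manifold A" and B: "smooth_manifold B" and h: "smooth_map A S B h"
    and eq: "\<And>p. p \<in> S \<Longrightarrow> h p = h' p"
  shows "smooth_map A S B h'"
  unfolding smooth_map_def
proof (intro conjI ballI)
  show "open S" "continuous_on S h'"
    using h eq by (auto simp: smooth_map_def cong: continuous_on_cong)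
  fix c d assume c: "c \<in> A" and d: "d \<in> B"
  have set: "fst c \<inter> S \<inter> h' -` fst d = fst c \<inter> (S \<inter> h -` fst d)" using eq by auto
  show "smooth_on (snd c ` (fst c \<inter> S \<inter> h' -` fst d)) (snd d \<circ> h' \<circ> cinv c)"
    unfolding set
    by (rule smooth_on_cong[OF smooth_map_representative(1)[OF A B h c d] _ smooth_map_representative(2)[OF A B h c d]])
      (auto simp: cinv_chart[OF smooth_manifold_chart[OF A c]] eq)
qed

lemma smooth_map_compose:
  assumes A: "smooth_manifold A" and B: "smooth_manifold B" and C: "smooth_manifold C"
    and f: "smooth_map A S B f" and g: "smooth_map B T C g" and R: "open R" "R \<subseteq> S" "f ` R \<subseteq> T"
  shows "smooth_map A R C (\<lambda>x. g (f x))"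
proof (rule smooth_map_localI[OF A C R(1)])
  show "continuous_on R (\<lambda>x. g (f x))"
    by (rule continuous_on_compose2[OF smooth_map_continuous[OF g] continuous_on_subset[OF smooth_map_continuous[OF f] R(2)] R(3)])
  fix p assume p: "p \<in> R"
  let ?c = "chart_at A p" and ?d = "chart_at B (f p)" and ?e = "chart_at C (g (f p))"
  note ch = chart_at_props[OF A, of p] chart_at_props[OF B, of "f p"] chart_at_props[OF C, of "g (f p)"]
  define W where "W = T \<inter> g -` fst ?e"
  have W: "open W"
    unfolding W_def using g ch by (intro open_restricted_preimage open_chart_domain) (auto simp: smooth_map_def)
  define U where "U = fst ?c \<inter> (R \<inter> f -` (fst ?d \<inter> W))"
  have oR: "open (R \<inter> f -` (fst ?d \<inter> W))"
    by (rule open_restricted_preimage[OF R(1) continuous_on_subset[OF smooth_map_continuous[OF f] R(2)]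
          open_Int[OF open_chart_domain[OF ch(6)] W]])
  have U: "open U" unfolding U_def by (rule open_Int[OF open_chart_domain[OF ch(3)] oR])
  have cU: "open (snd ?c ` U)" unfolding U_def by (rule open_chart_image[OF ch(3) oR])
  have 1: "smooth_on (snd ?c ` U) (\<lambda>y. snd ?d (f (cinv ?c y)))"
    by (rule smooth_on_subset[OF smooth_map_representative(2)[OF A B f ch(1) ch(4)]]) (use R in \<open>auto simp: U_def\<close>)
  have 2: "smooth_on (snd ?c ` U) (\<lambda>y. snd ?e (g (cinv ?d (snd ?d (f (cinv ?c y))))))"
    by (rule smooth_on_compose[OF cU smooth_map_representative(1)[OF B C g ch(4) ch(7)] _ 1
          smooth_map_representative(2)[OF B C g ch(4) ch(7)]])
      (auto simp: U_def W_def cinv_chart[OF ch(3)])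
  have 3: "smooth_on (snd ?c ` U) (\<lambda>y. snd ?e (g (f (cinv ?c y))))"
    by (rule smooth_on_cong[OF cU _ 2]) (auto simp: U_def cinv_chart ch)
  have "p \<in> U" "U \<subseteq> R \<inter> fst ?c" "(\<lambda>x. g (f x)) ` U \<subseteq> fst ?e"
    using p R ch by (auto simp: U_def W_def)
  with 3 U ch show "\<exists>c\<in>A. \<exists>d\<in>C. \<exists>U. open U \<and> p \<in> U \<and> U \<subseteq> R \<inter> fst c \<and> (\<lambda>x. g (f x)) ` U \<subseteq> fst d \<and>
     smooth_on (snd c ` U) (\<lambda>y. snd d (g (f (cinv c y))))"
    by blast
qed

lemma cinv_eucl[simp]: "cinv (UNIV, id) = id" "cinv (UNIV, \<lambda>x. x) = id"
  by (simp_all add: cinv_def id_def)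

lemma chart_at_eucl[simp]: "chart_at eucl_atlas x = (UNIV, id)"
  unfolding chart_at_def eucl_atlas_def by (rule some_equality) auto

lemma smooth_manifold_eucl: "smooth_manifold eucl_atlas"
  by (simp add: smooth_manifold_def eucl_atlas_def is_chart_def homeomorphism_def
      continuous_on_id[unfolded id_def] id_def[symmetric] smooth_on_ident[unfolded id_def[symmetric]])

lemma smooth_map_eucl_iff: "smooth_map eucl_atlas S eucl_atlas f \<longleftrightarrow> open S \<and> smooth_on S f"
  using smooth_on_continuous by (auto simp: smooth_map_def eucl_atlas_def)

lemma mdiff_eucl: "mdiff eucl_atlas eucl_atlas f = (\<lambda>x. frechet_derivative f (at x))"
  by (simp add: mdiff_def fun_eq_iff)

lemma smooth_function_iff:
  "smooth_function A S h \<longleftrightarrow> open S \<and> continuous_on S h \<and> (\<forall>c\<in>A. smooth_on (snd c ` (fst c \<inter> S)) (h \<circ> cinv c))"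
  by (simp add: smooth_function_def smooth_map_def eucl_atlas_def)

lemma smooth_map_chart:
  assumes A: "smooth_manifold A" and c: "c \<in> A"
  shows "smooth_map A (fst c) eucl_atlas (snd c)"
  using smooth_manifold_chart[OF A c] smooth_manifold_transition[OF A _ c]
  by (auto simp: smooth_map_def eucl_atlas_def o_def is_chart_def homeomorphism_def)

lemma smooth_map_cinv:
  assumes A: "smooth_manifold A" and c: "c \<in> A"
  shows "smooth_map eucl_atlas (snd c ` fst c) A (cinv c)"
proof -
  note ch = smooth_manifold_chart[OF A c]
  have "snd c ` fst c \<inter> cinv c -` fst d = snd c ` (fst c \<inter> fst d)" for d :: "('a, 'b) chart"
    using cinv_chart[OF ch] by auto
  then show ?thesis
    using ch smooth_manifold_transition[OF A c]
    by (simp add: smooth_map_def eucl_atlas_def o_def is_chart_def homeomorphism_def)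
qed

lemma smooth_map_const: "open S \<Longrightarrow> smooth_map A S B (\<lambda>_. q)"
  by (auto simp: smooth_map_def o_def smooth_on_const)

lemma smooth_map_ident: "smooth_manifold A \<Longrightarrow> smooth_map A UNIV A (\<lambda>x. x)"
  by (auto simp: smooth_map_def o_def vimage_def smooth_manifold_transition)

lemma mdiff_representative_differentiable:
  assumes A: "smooth_manifold A" and B: "smooth_manifold B" and f: "smooth_map A S B f" and p: "p \<in> S"
  shows "(\<lambda>y. snd (chart_at B (f p)) (f (cinv (chart_at A p) y))) differentiable (at (snd (chart_at A p) p))"
  by (rule smooth_on_differentiable[OF smooth_map_representative(2)[OF A B f]])
    (use chart_at_props[OF A, of p] chart_at_props[OF B, of "f p"] p in auto)

lemma mdiff_linear:
  assumes "smooth_manifold A" "smooth_manifold B" "smooth_map A S B f" "p \<in> S"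
  shows "linear (mdiff A B f p)"
  using linear_frechet_derivative[OF mdiff_representative_differentiable[OF assms]]
  by (simp add: mdiff_def o_def)

lemma mdiff_cong:
  assumes A: "smooth_manifold A" and S: "open S" "p \<in> S" and eq: "\<And>x. x \<in> S \<Longrightarrow> f x = g x"
  shows "mdiff A B f p = mdiff A B g p"
  unfolding mdiff_def eq[OF S(2)]
proof (rule frechet_derivative_cong_open)
  let ?c = "chart_at A p"
  note ch = chart_at_props[OF A, of p]
  show "open (snd ?c ` (fst ?c \<inter> S))" by (rule open_chart_image[OF ch(3) S(1)])
  show "snd ?c p \<in> snd ?c ` (fst ?c \<inter> S)" using ch S by auto
  show "(snd (chart_at B (g p)) \<circ> f \<circ> cinv ?c) y = (snd (chart_at B (g p)) \<circ> g \<circ> cinv ?c) y"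
    if "y \<in> snd ?c ` (fst ?c \<inter> S)" for y
    using that eq cinv_chart[OF ch(3)] by auto
qed

text \<open>The representative of the composition in the charts chosen at the two end points factors through
the chart chosen at the intermediate point, wherever all three are defined.\<close>

lemma mdiff_compose:
  assumes A: "smooth_manifold A" and B: "smooth_manifold B" and C: "smooth_manifold C"
    and f: "smooth_map A S B f" and g: "smooth_map B T C g" and p: "p \<in> S" "f p \<in> T"
  shows "mdiff A C (\<lambda>x. g (f x)) p v = mdiff B C g (f p) (mdiff A B f p v)"
proof -
  let ?c = "chart_at A p" and ?d = "chart_at B (f p)" and ?e = "chart_at C (g (f p))"
  note ch = chart_at_props[OF A, of p] chart_at_props[OF B, of "f p"]
  let ?u = "\<lambda>y. snd ?d (f (cinv ?c y))" and ?v = "\<lambda>y. snd ?e (g (cinv ?d y))"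
  have up: "?u (snd ?c p) = snd ?d (f p)" using ch by (simp add: cinv_chart)
  have "frechet_derivative (\<lambda>y. snd ?e (g (f (cinv ?c y)))) (at (snd ?c p)) =
      frechet_derivative (\<lambda>y. ?v (?u y)) (at (snd ?c p))"
    by (rule frechet_derivative_cong_open[OF smooth_map_representative(1)[OF A B f ch(1) ch(4)]])
      (use ch p in \<open>auto simp: cinv_chart\<close>)
  moreover have "frechet_derivative (\<lambda>y. ?v (?u y)) (at (snd ?c p)) v =
      frechet_derivative ?v (at (snd ?d (f p))) (frechet_derivative ?u (at (snd ?c p)) v)"
    using frechet_derivative_chain[OF mdiff_representative_differentiable[OF A B f p(1)], of ?v v]
      mdiff_representative_differentiable[OF B C g p(2)] by (simp only: up)
  ultimately show ?thesis by (simp add: mdiff_def o_def)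
qed

lemma mdiff_ident:
  assumes A: "smooth_manifold A"
  shows "mdiff A A (\<lambda>x. x) p v = v"
proof -
  let ?c = "chart_at A p"
  note ch = chart_at_props[OF A, of p]
  have "frechet_derivative (\<lambda>y. snd ?c (cinv ?c y)) (at (snd ?c p)) = frechet_derivative (\<lambda>y. y) (at (snd ?c p))"
    by (rule frechet_derivative_cong_open[of "snd ?c ` fst ?c"])
      (use ch in \<open>auto simp: cinv_chart is_chart_def\<close>)
  then show ?thesis by (simp add: mdiff_def o_def)
qed

lemma mdiff_const: "mdiff A B (\<lambda>_. q) p v = 0"
  by (simp add: mdiff_def o_def)

lemma mdiff_chart_cinv:
  assumes A: "smooth_manifold A" and c: "c \<in> A" and y: "y \<in> snd c ` fst c"
  shows "mdiff A eucl_atlas (snd c) (cinv c y) (mdiff eucl_atlas A (cinv c) y v) = v"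
proof -
  have "mdiff A eucl_atlas (snd c) (cinv c y) (mdiff eucl_atlas A (cinv c) y v) =
      mdiff eucl_atlas eucl_atlas (\<lambda>y. snd c (cinv c y)) y v"
    by (rule mdiff_compose[symmetric, OF smooth_manifold_eucl A smooth_manifold_eucl smooth_map_cinv[OF A c]
          smooth_map_chart[OF A c] y cinv_into[OF y]])
  also have "\<dots> = mdiff eucl_atlas eucl_atlas (\<lambda>y. y) y v"
    using mdiff_cong[OF smooth_manifold_eucl smooth_map_open[OF smooth_map_cinv[OF A c]] y]
      chart_cinv by metis
  finally show ?thesis by (simp add: mdiff_ident[OF smooth_manifold_eucl])
qed

lemma mdiff_cinv_chart:
  assumes A: "smooth_manifold A" and c: "c \<in> A" and p: "p \<in> fst c"
  shows "mdiff eucl_atlas A (cinv c) (snd c p) (mdiff A eucl_atlas (snd c) p v) = v"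
proof -
  have "mdiff eucl_atlas A (cinv c) (snd c p) (mdiff A eucl_atlas (snd c) p v) =
      mdiff A A (\<lambda>y. cinv c (snd c y)) p v"
    by (rule mdiff_compose[symmetric, OF A smooth_manifold_eucl A smooth_map_chart[OF A c] smooth_map_cinv[OF A c] p])
      (use p in auto)
  also have "\<dots> = mdiff A A (\<lambda>y. y) p v"
    using mdiff_cong[OF A smooth_map_open[OF smooth_map_chart[OF A c]] p]
      cinv_chart[OF smooth_manifold_chart[OF A c]] by metis
  finally show ?thesis by (simp add: mdiff_ident[OF A])
qed

lemma mdiff_cinv_bij:
  assumes A: "smooth_manifold A" and c: "c \<in> A" and y: "y \<in> snd c ` fst c"
  shows "linear (mdiff eucl_atlas A (cinv c) y)" "bij (mdiff eucl_atlas A (cinv c) y)"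
proof -
  show L: "linear (mdiff eucl_atlas A (cinv c) y)"
    by (rule mdiff_linear[OF smooth_manifold_eucl A smooth_map_cinv[OF A c] y])
  have "inj (mdiff eucl_atlas A (cinv c) y)"
    by (metis injI mdiff_chart_cinv[OF A c y])
  moreover have "surj (mdiff eucl_atlas A (cinv c) y)"
    using mdiff_cinv_chart[OF A c cinv_into[OF y]] chart_cinv[OF y] by (metis surjI)
  ultimately show "bij (mdiff eucl_atlas A (cinv c) y)" by (simp add: bij_def)
qed

section \<open>Product manifolds\<close>

lemma prod_atlasE:
  assumes "e \<in> prod_atlas A B"
  obtains c d where "c \<in> A" "d \<in> B" "e = (fst c \<times> fst d, map_prod (snd c) (snd d))"
  using assms by (auto simp: prod_atlas_def)

lemma prod_atlasI: "c \<in> A \<Longrightarrow> d \<in> B \<Longrightarrow> (fst c \<times> fst d, map_prod (snd c) (snd d)) \<in> prod_atlas A B"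
  unfolding prod_atlas_def by blast

lemma cinv_prod:
  assumes c: "is_chart c" and d: "is_chart d" and y: "a \<in> snd c ` fst c" "b \<in> snd d ` fst d"
  shows "cinv (fst c \<times> fst d, map_prod (snd c) (snd d)) (a, b) = (cinv c a, cinv d b)"
proof -
  have inj: "inj_on (map_prod (snd c) (snd d)) (fst c \<times> fst d)"
    using cinv_chart[OF c] cinv_chart[OF d] by (intro map_prod_inj_on inj_on_inverseI[where g = "cinv c"]
        inj_on_inverseI[where g = "cinv d"]) auto
  have "inv_into (fst c \<times> fst d) (map_prod (snd c) (snd d)) (map_prod (snd c) (snd d) (cinv c a, cinv d b)) = (cinv c a, cinv d b)"
    by (rule inv_into_f_f[OF inj]) (simp add: cinv_into y)
  then show ?thesis by (simp add: cinv_def[of "(_, _)"] chart_cinv y)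
qed

lemma map_prod_image: "map_prod f g ` (S \<times> T) = f ` S \<times> g ` T"
  by force

lemma is_chart_prod:
  assumes c: "is_chart c" and d: "is_chart d"
  shows "is_chart (fst c \<times> fst d, map_prod (snd c) (snd d))"
proof -
  let ?e = "(fst c \<times> fst d, map_prod (snd c) (snd d))"
  let ?T = "snd c ` fst c \<times> snd d ` fst d"
  have cd: "continuous_on (fst c) (snd c)" "continuous_on (fst d) (snd d)"
    "continuous_on (snd c ` fst c) (cinv c)" "continuous_on (snd d ` fst d) (cinv d)"
    "open (fst c)" "open (fst d)" "open (snd c ` fst c)" "open (snd d ` fst d)"
    using c d by (auto simp: is_chart_def homeomorphism_def)
  have 1: "continuous_on (fst c \<times> fst d) (map_prod (snd c) (snd d))"
    unfolding map_prod_def case_prod_unfold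
    by (intro continuous_on_Pair continuous_on_compose2[OF cd(1)] continuous_on_compose2[OF cd(2)]
        continuous_on_fst continuous_on_snd continuous_on_id) auto
  have "continuous_on ?T (\<lambda>y. (cinv c (fst y), cinv d (snd y)))"
    by (intro continuous_on_Pair continuous_on_compose2[OF cd(3)] continuous_on_compose2[OF cd(4)]
        continuous_on_fst continuous_on_snd continuous_on_id) auto
  then have 2: "continuous_on ?T (cinv ?e)"
    by (subst continuous_on_cong[OF refl]) (auto simp: cinv_prod c d)
  have 3: "cinv ?e ` ?T = fst c \<times> fst d"
  proof (rule set_eqI)
    fix x :: "'a \<times> 'c"
    show "x \<in> cinv ?e ` ?T \<longleftrightarrow> x \<in> fst c \<times> fst d"
    proof
      assume "x \<in> cinv ?e ` ?T"
      then show "x \<in> fst c \<times> fst d" by (auto simp: cinv_prod c d cinv_chart)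
    next
      assume x: "x \<in> fst c \<times> fst d"
      then have "x = cinv ?e (snd c (fst x), snd d (snd x))" by (auto simp: cinv_prod c d cinv_chart)
      then show "x \<in> cinv ?e ` ?T" by (rule image_eqI) (use x in auto)
    qed
  qed
  have 4: "\<forall>x\<in>fst c \<times> fst d. cinv ?e (map_prod (snd c) (snd d) x) = x"
    by (auto simp: cinv_prod c d cinv_chart)
  have 5: "\<forall>y\<in>?T. map_prod (snd c) (snd d) (cinv ?e y) = y"
    by (auto simp: cinv_prod c d cinv_chart)
  show ?thesis
    unfolding is_chart_def homeomorphism_def fst_conv snd_conv map_prod_image
    using 1 2 3 4 5 cd by (simp add: open_Times map_prod_image)
qed

lemma smooth_manifold_prod:
  assumes A: "smooth_manifold A" and B: "smooth_manifold B"
  shows "smooth_manifold (prod_atlas A B)"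
  unfolding smooth_manifold_def
proof (intro conjI ballI)
  show "is_chart e" if "e \<in> prod_atlas A B" for e
    using that by (metis prod_atlasE is_chart_prod smooth_manifold_chart A B)
  show "(\<Union>e\<in>prod_atlas A B. fst e) = UNIV"
  proof -
    have "x \<in> (\<Union>e\<in>prod_atlas A B. fst e)" for x
    proof (rule UN_I)
      show "(fst (chart_at A (fst x)) \<times> fst (chart_at B (snd x)), map_prod (snd (chart_at A (fst x))) (snd (chart_at B (snd x)))) \<in> prod_atlas A B"
        by (intro prod_atlasI chart_at_props A B)
      show "x \<in> fst (fst (chart_at A (fst x)) \<times> fst (chart_at B (snd x)), map_prod (snd (chart_at A (fst x))) (snd (chart_at B (snd x))))"
        using chart_at_props[OF A] chart_at_props[OF B] by (cases x) auto
    qed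
    then show ?thesis by blast
  qed
  fix e e' assume "e \<in> prod_atlas A B" "e' \<in> prod_atlas A B"
  then obtain c d c' d' where cd: "c \<in> A" "d \<in> B" "e = (fst c \<times> fst d, map_prod (snd c) (snd d))"
    and cd': "c' \<in> A" "d' \<in> B" "e' = (fst c' \<times> fst d', map_prod (snd c') (snd d'))"
    by (elim prod_atlasE)
  note ch = smooth_manifold_chart[OF A cd(1)] smooth_manifold_chart[OF B cd(2)]
    smooth_manifold_chart[OF A cd'(1)] smooth_manifold_chart[OF B cd'(2)]
  let ?P = "snd c ` (fst c \<inter> fst c')" and ?Q = "snd d ` (fst d \<inter> fst d')"
  have set: "snd e ` (fst e \<inter> fst e') = ?P \<times> ?Q"
    unfolding cd cd' fst_conv snd_conv Times_Int_Times map_prod_image by simp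
  have P: "open ?P" and Q: "open ?Q" by (intro open_chart_image open_chart_domain ch)+
  have PQ: "open (?P \<times> ?Q)" by (rule open_Times[OF P Q])
  have "smooth_on (?P \<times> ?Q) (\<lambda>y. (snd c' (cinv c (fst y)), snd d' (cinv d (snd y))))"
    by (intro smooth_on_Pair PQ smooth_on_compose[OF PQ P _ smooth_on_linear[OF bounded_linear_fst] smooth_manifold_transition[OF A cd(1) cd'(1)]]
        smooth_on_compose[OF PQ Q _ smooth_on_linear[OF bounded_linear_snd] smooth_manifold_transition[OF B cd(2) cd'(2)]]) auto
  then show "smooth_on (snd e ` (fst e \<inter> fst e')) (snd e' \<circ> cinv e)"
    unfolding set by (rule smooth_on_cong[OF PQ, rotated]) (auto simp: cd cd' cinv_prod ch)
qed

lemma smooth_map_Pair: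
  assumes A: "smooth_manifold A" and B: "smooth_manifold B" and C: "smooth_manifold C"
    and f: "smooth_map A S B f" and g: "smooth_map A S C g"
  shows "smooth_map A S (prod_atlas B C) (\<lambda>x. (f x, g x))"
  unfolding smooth_map_def
proof (intro conjI ballI)
  show "open S" "continuous_on S (\<lambda>x. (f x, g x))"
    using f g by (auto simp: smooth_map_def intro: continuous_on_Pair)
  fix c e assume c: "c \<in> A" and "e \<in> prod_atlas B C"
  then obtain d d' where d: "d \<in> B" "d' \<in> C" "e = (fst d \<times> fst d', map_prod (snd d) (snd d'))"
    by (elim prod_atlasE)
  let ?O = "snd c ` (fst c \<inter> S \<inter> (\<lambda>x. (f x, g x)) -` fst e)"
  have set: "?O = snd c ` (fst c \<inter> ((S \<inter> f -` fst d) \<inter> (S \<inter> g -` fst d')))" by (auto simp: d)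
  have "open ?O" unfolding set
    using f g smooth_manifold_chart[OF A c] open_chart_domain[OF smooth_manifold_chart[OF B d(1)]]
      open_chart_domain[OF smooth_manifold_chart[OF C d(2)]]
    by (intro open_chart_image open_Int open_restricted_preimage) (auto simp: smooth_map_def)
  then have "smooth_on ?O (\<lambda>y. (snd d (f (cinv c y)), snd d' (g (cinv c y))))"
    by (rule smooth_on_Pair) (rule smooth_on_subset[OF smooth_map_representative(2)[OF A B f c d(1)]]
        smooth_on_subset[OF smooth_map_representative(2)[OF A C g c d(2)]]; auto simp: d)+
  then show "smooth_on ?O (snd e \<circ> (\<lambda>x. (f x, g x)) \<circ> cinv c)" by (simp add: d o_def)
qed

lemma smooth_map_fst:
  assumes A: "smooth_manifold A" and B: "smooth_manifold B"
  shows "smooth_map (prod_atlas A B) UNIV A fst"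
  unfolding smooth_map_def
proof (intro conjI ballI)
  fix e c' assume "e \<in> prod_atlas A B" and c': "c' \<in> A"
  then obtain c d where cd: "c \<in> A" "d \<in> B" "e = (fst c \<times> fst d, map_prod (snd c) (snd d))" by (elim prod_atlasE)
  note ch = smooth_manifold_chart[OF A cd(1)] smooth_manifold_chart[OF B cd(2)] smooth_manifold_chart[OF A c']
  let ?P = "snd c ` (fst c \<inter> fst c')" and ?Q = "snd d ` fst d"
  have "fst e \<inter> UNIV \<inter> fst -` fst c' = (fst c \<inter> fst c') \<times> fst d" by (auto simp: cd)
  then have set: "snd e ` (fst e \<inter> UNIV \<inter> fst -` fst c') = ?P \<times> ?Q"
    by (simp only: cd snd_conv map_prod_image)
  have P: "open ?P" and Q: "open ?Q" by (intro open_chart_image open_chart_domain ch | use ch in \<open>simp add: is_chart_def\<close>)+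
  have PQ: "open (?P \<times> ?Q)" by (rule open_Times[OF P Q])
  have "smooth_on (?P \<times> ?Q) (\<lambda>y. snd c' (cinv c (fst y)))"
    by (intro smooth_on_compose[OF PQ P _ smooth_on_linear[OF bounded_linear_fst] smooth_manifold_transition[OF A cd(1) c']]) auto
  then show "smooth_on (snd e ` (fst e \<inter> UNIV \<inter> fst -` fst c')) (snd c' \<circ> fst \<circ> cinv e)"
    unfolding set by (rule smooth_on_cong[OF PQ, rotated]) (auto simp: cd cinv_prod ch)
qed (auto intro: continuous_on_fst continuous_on_id)

lemma smooth_map_snd:
  assumes A: "smooth_manifold A" and B: "smooth_manifold B"
  shows "smooth_map (prod_atlas A B) UNIV B snd"
  unfolding smooth_map_def
proof (intro conjI ballI)
  fix e d' assume "e \<in> prod_atlas A B" and d': "d' \<in> B"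
  then obtain c d where cd: "c \<in> A" "d \<in> B" "e = (fst c \<times> fst d, map_prod (snd c) (snd d))" by (elim prod_atlasE)
  note ch = smooth_manifold_chart[OF A cd(1)] smooth_manifold_chart[OF B cd(2)] smooth_manifold_chart[OF B d']
  let ?P = "snd c ` fst c" and ?Q = "snd d ` (fst d \<inter> fst d')"
  have "fst e \<inter> UNIV \<inter> snd -` fst d' = fst c \<times> (fst d \<inter> fst d')" by (auto simp: cd)
  then have set: "snd e ` (fst e \<inter> UNIV \<inter> snd -` fst d') = ?P \<times> ?Q"
    by (simp only: cd snd_conv map_prod_image)
  have P: "open ?P" and Q: "open ?Q" by (intro open_chart_image open_chart_domain ch | use ch in \<open>simp add: is_chart_def\<close>)+
  have PQ: "open (?P \<times> ?Q)" by (rule open_Times[OF P Q])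
  have "smooth_on (?P \<times> ?Q) (\<lambda>y. snd d' (cinv d (snd y)))"
    by (intro smooth_on_compose[OF PQ Q _ smooth_on_linear[OF bounded_linear_snd] smooth_manifold_transition[OF B cd(2) d']]) auto
  then show "smooth_on (snd e ` (fst e \<inter> UNIV \<inter> snd -` fst d')) (snd d' \<circ> snd \<circ> cinv e)"
    unfolding set by (rule smooth_on_cong[OF PQ, rotated]) (auto simp: cd cinv_prod ch)
qed (auto intro: continuous_on_snd continuous_on_id)

text \<open>The chart chosen at a point of the product is a product of two charts, but these need not be the
charts chosen at the two components of the point. The differentials of the projections are
therefore the projections of the model space only up to the isomorphisms $P$ and $Q$ that change
the charts.\<close>

lemma mdiff_projections:
  assumes A: "smooth_manifold A" and B: "smooth_manifold B"
  obtains P Q where "linear P" "bij P" "linear Q" "bij Q"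
    "\<And>v. mdiff (prod_atlas A B) A fst x v = P (fst v)" "\<And>v. mdiff (prod_atlas A B) B snd x v = Q (snd v)"
proof -
  note chx = chart_at_props[OF smooth_manifold_prod[OF A B], of x]
  obtain c d where cd: "c \<in> A" "d \<in> B" and e: "chart_at (prod_atlas A B) x = (fst c \<times> fst d, map_prod (snd c) (snd d))"
    using chx(1) by (elim prod_atlasE)
  have x: "fst x \<in> fst c" "snd x \<in> fst d" using chx(2) unfolding e by (cases x; simp)+
  let ?e = "(fst c \<times> fst d, map_prod (snd c) (snd d))"
  note ch = smooth_manifold_chart[OF A cd(1)] smooth_manifold_chart[OF B cd(2)]
  let ?a = "snd c (fst x)" and ?b = "snd d (snd x)"
  have a: "?a \<in> snd c ` fst c" and b: "?b \<in> snd d ` fst d" using x by auto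
  have O: "open (snd c ` fst c \<times> snd d ` fst d)" using ch by (intro open_Times) (auto simp: is_chart_def)
  have in_O: "map_prod (snd c) (snd d) x \<in> snd c ` fst c \<times> snd d ` fst d" using x by (cases x) auto
  let ?P = "mdiff eucl_atlas A (cinv c) ?a" and ?Q = "mdiff eucl_atlas B (cinv d) ?b"
  have dif: "(\<lambda>a. snd (chart_at A (fst x)) (cinv c a)) differentiable (at ?a)"
    using mdiff_representative_differentiable[OF smooth_manifold_eucl A smooth_map_cinv[OF A cd(1)] a]
    by (simp add: cinv_chart ch x)
  have dif': "(\<lambda>a. snd (chart_at B (snd x)) (cinv d a)) differentiable (at ?b)"
    using mdiff_representative_differentiable[OF smooth_manifold_eucl B smooth_map_cinv[OF B cd(2)] b]
    by (simp add: cinv_chart ch x)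
  have fd: "fst differentiable (at z)" "frechet_derivative fst (at z) = fst"
    "snd differentiable (at z)" "frechet_derivative snd (at z) = snd" for z :: "'b \<times> 'd"
    using frechet_derivative_at[OF bounded_linear.has_derivative[OF bounded_linear_fst has_derivative_ident, of "at z"]]
      frechet_derivative_at[OF bounded_linear.has_derivative[OF bounded_linear_snd has_derivative_ident, of "at z"]]
      bounded_linear_imp_differentiable[OF bounded_linear_fst] bounded_linear_imp_differentiable[OF bounded_linear_snd]
    by (simp_all add: fun_eq_iff)
  have "frechet_derivative (\<lambda>y. snd (chart_at A (fst x)) (fst (cinv ?e y))) (at (map_prod (snd c) (snd d) x)) =
      frechet_derivative (\<lambda>y. snd (chart_at A (fst x)) (cinv c (fst y))) (at (map_prod (snd c) (snd d) x))"
    by (rule frechet_derivative_cong_open[OF O in_O]) (auto simp: cinv_prod ch)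
  then have 1: "mdiff (prod_atlas A B) A fst x v = ?P (fst v)" for v
    using frechet_derivative_chain[OF fd(1)[of "map_prod (snd c) (snd d) x"], of "\<lambda>a. snd (chart_at A (fst x)) (cinv c a)" v] dif
    by (simp add: mdiff_def e fd o_def cinv_chart ch x)
  have "frechet_derivative (\<lambda>y. snd (chart_at B (snd x)) (snd (cinv ?e y))) (at (map_prod (snd c) (snd d) x)) =
      frechet_derivative (\<lambda>y. snd (chart_at B (snd x)) (cinv d (snd y))) (at (map_prod (snd c) (snd d) x))"
    by (rule frechet_derivative_cong_open[OF O in_O]) (auto simp: cinv_prod ch)
  then have 2: "mdiff (prod_atlas A B) B snd x v = ?Q (snd v)" for v
    using frechet_derivative_chain[OF fd(3)[of "map_prod (snd c) (snd d) x"], of "\<lambda>a. snd (chart_at B (snd x)) (cinv d a)" v] dif'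
    by (simp add: mdiff_def e fd o_def cinv_chart ch x)
  show ?thesis
    by (rule that[OF mdiff_cinv_bij[OF A cd(1) a] mdiff_cinv_bij[OF B cd(2) b] 1 2])
qed

section \<open>Coordinate vector fields\<close>

definition push_field :: "('p, 'e::euclidean_space) atlas \<Rightarrow> ('p, 'e) chart \<Rightarrow> ('e \<Rightarrow> 'e) \<Rightarrow> 'p \<Rightarrow> 'e" where
  "push_field A c X p = mdiff eucl_atlas A (cinv c) (snd c p) (X (snd c p))"

abbreviation coord_field :: "('p, 'e::euclidean_space) atlas \<Rightarrow> ('p, 'e) chart \<Rightarrow> 'e \<Rightarrow> 'p \<Rightarrow> 'e" where
  "coord_field A c v \<equiv> push_field A c (\<lambda>_. v)"

lemma cinv_image:
  assumes "is_chart c" "V \<subseteq> snd c ` fst c"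
  shows "cinv c ` V = fst c \<inter> snd c -` V"
proof (rule set_eqI)
  fix p show "p \<in> cinv c ` V \<longleftrightarrow> p \<in> fst c \<inter> snd c -` V"
    using assms cinv_into[of _ c] chart_cinv[of _ c] cinv_chart[OF assms(1), of p]
    by (auto simp: subset_iff) (metis image_eqI)
qed

lemma open_cinv_image:
  assumes "is_chart c" "open V" "V \<subseteq> snd c ` fst c"
  shows "open (cinv c ` V)"
  unfolding cinv_image[OF assms(1,3)]
  using assms by (intro open_restricted_preimage) (auto simp: is_chart_def homeomorphism_def)

lemma cinv_image_chart_image: "is_chart c \<Longrightarrow> cinv c ` snd c ` fst c = fst c"
  by (auto simp: cinv_image)

lemma vf_rep_push_field:
  assumes A: "smooth_manifold A" and c: "c \<in> A" and d: "d \<in> A" and p: "p \<in> fst c" "p \<in> fst d"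
  shows "vf_rep A d (push_field A c X) (snd d p) =
    frechet_derivative (\<lambda>z. snd d (cinv c z)) (at (snd c p)) (X (snd c p))"
proof -
  note ch = smooth_manifold_chart[OF A c] smooth_manifold_chart[OF A d]
  have "vf_rep A d (push_field A c X) (snd d p) =
      mdiff A eucl_atlas (snd d) (cinv c (snd c p)) (mdiff eucl_atlas A (cinv c) (snd c p) (X (snd c p)))"
    by (simp add: vf_rep_def push_field_def cinv_chart ch p)
  also have "\<dots> = mdiff eucl_atlas eucl_atlas (\<lambda>z. snd d (cinv c z)) (snd c p) (X (snd c p))"
    by (rule mdiff_compose[symmetric, OF smooth_manifold_eucl A smooth_manifold_eucl smooth_map_cinv[OF A c] smooth_map_chart[OF A d]])
      (use p in \<open>auto simp: cinv_chart ch\<close>)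
  finally show ?thesis by (simp add: mdiff_eucl)
qed

text \<open>In any chart, the components of the pushed field are the derivative of a transition map applied
to the given components.\<close>

lemma smooth_vf_push_field:
  assumes A: "smooth_manifold A" and c: "c \<in> A" and V: "open V" "V \<subseteq> snd c ` fst c" and X: "smooth_on V X"
  shows "smooth_vf A (cinv c ` V) (push_field A c X)"
  unfolding smooth_vf_def
proof (intro conjI ballI)
  note chc = smooth_manifold_chart[OF A c]
  show oV: "open (cinv c ` V)" by (rule open_cinv_image[OF chc V])
  fix d assume d: "d \<in> A"
  note chd = smooth_manifold_chart[OF A d]
  define Q where "Q = snd d ` (fst d \<inter> cinv c ` V)"
  define W where "W = V \<inter> snd c ` (fst c \<inter> fst d)"
  have Q: "open Q" unfolding Q_def by (rule open_chart_image[OF chd oV])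
  have W: "open W" unfolding W_def by (intro open_Int V open_chart_image chc open_chart_domain chd)
  have t: "smooth_on Q (\<lambda>y. snd c (cinv d y))"
    by (rule smooth_on_subset[OF smooth_manifold_transition[OF A d c]]) (use V in \<open>auto simp: Q_def cinv_image[OF chc]\<close>)
  have "smooth_on W (\<lambda>z. frechet_derivative (\<lambda>z. snd d (cinv c z)) (at z) (X z))"
    by (rule smooth_on_derivative_along[OF W smooth_on_subset[OF smooth_manifold_transition[OF A c d]] smooth_on_subset[OF X]])
      (auto simp: W_def)
  moreover have "(\<lambda>y. snd c (cinv d y)) ` Q \<subseteq> W"
    using V by (auto simp: Q_def W_def cinv_image[OF chc] cinv_chart chd)
  ultimately
  have "smooth_on Q (\<lambda>y. frechet_derivative (\<lambda>z. snd d (cinv c z)) (at (snd c (cinv d y))) (X (snd c (cinv d y))))"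
    using smooth_on_compose[OF Q W _ t] by blast
  then show "smooth_on (snd d ` (fst d \<inter> cinv c ` V)) (vf_rep A d (push_field A c X))"
    unfolding Q_def[symmetric]
    by (rule smooth_on_cong[OF Q, rotated]) (use V in \<open>auto simp: Q_def cinv_image[OF chc] cinv_chart chd vf_rep_push_field[OF A c d]\<close>)
qed

lemma smooth_vf_coord_field:
  assumes A: "smooth_manifold A" and c: "c \<in> A"
  shows "smooth_vf A (fst c) (coord_field A c v)"
  using smooth_vf_push_field[OF A c _ order_refl smooth_on_const] smooth_manifold_chart[OF A c]
  by (metis cinv_image_chart_image is_chart_def)

lemma smooth_vf_eucl_iff: "smooth_vf eucl_atlas U X \<longleftrightarrow> open U \<and> smooth_on U X"
proof -
  have "vf_rep eucl_atlas (UNIV, id) X = X"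
    by (simp add: vf_rep_def fun_eq_iff mdiff_eucl)
  then show ?thesis by (simp add: smooth_vf_def eucl_atlas_def)
qed

text \<open>Coordinate fields extend every tangent vector to a vector field, so a tensorial identity need
only be checked on them.\<close>

lemma coord_field_at:
  assumes A: "smooth_manifold A"
  shows "coord_field A (chart_at A p) v p = v"
proof -
  note ch = chart_at_props[OF A, of p]
  have "frechet_derivative (\<lambda>y. snd (chart_at A p) (cinv (chart_at A p) y)) (at (snd (chart_at A p) p)) =
      frechet_derivative (\<lambda>y. y) (at (snd (chart_at A p) p))"
    by (rule frechet_derivative_cong_open[of "snd (chart_at A p) ` fst (chart_at A p)"])
      (use ch in \<open>auto simp: cinv_chart is_chart_def\<close>)
  then show ?thesis by (simp add: push_field_def mdiff_def cinv_chart ch o_def)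
qed

text \<open>The components of both fields are constant in the chart that defines the bracket at this point.\<close>

lemma lie_bracket_coord_fields:
  assumes A: "smooth_manifold A"
  shows "lie_bracket A (coord_field A (chart_at A p) v) (coord_field A (chart_at A p) w) p = 0"
proof -
  let ?c = "chart_at A p"
  note ch = chart_at_props[OF A, of p]
  have "frechet_derivative (vf_rep A ?c (coord_field A ?c v)) (at (snd ?c p)) = frechet_derivative (\<lambda>_. v) (at (snd ?c p))" for v
    by (rule frechet_derivative_cong_open[of "snd ?c ` fst ?c"])
      (use ch in \<open>auto simp: is_chart_def vf_rep_def push_field_def cinv_into chart_cinv mdiff_chart_cinv[OF A ch(1)]\<close>)
  then show ?thesis by (simp add: lie_bracket_def Let_def)
qed

section \<open>The exterior derivative and pullbacks\<close>

lemma one_form_coord_smooth: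
  assumes A: "smooth_manifold A" and c: "c \<in> A" and \<eta>: "smooth_one_form A UNIV \<eta>"
  shows "smooth_on (snd c ` fst c) (\<lambda>y. \<eta> (cinv c y) (mdiff eucl_atlas A (cinv c) y w))"
proof -
  have "smooth_function A (fst c) (\<lambda>q. \<eta> q (coord_field A c w q))"
    using \<eta> smooth_vf_coord_field[OF A c] by (simp add: smooth_one_form_def)
  then have "smooth_on (snd c ` fst c) ((\<lambda>q. \<eta> q (coord_field A c w q)) \<circ> cinv c)"
    using c by (auto simp: smooth_function_iff)
  then show ?thesis
    by (rule smooth_on_cong[rotated 2]) (use smooth_manifold_chart[OF A c] in \<open>auto simp: push_field_def cinv_chart is_chart_def\<close>)
qed

lemma ext_deriv_coord_fields:
  assumes A: "smooth_manifold A" and \<eta>: "linear (\<eta> p)"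
  defines "c \<equiv> chart_at A p"
  defines "F \<equiv> \<lambda>y w. \<eta> (cinv c y) (mdiff eucl_atlas A (cinv c) y w)"
  shows "ext_deriv A \<eta> (coord_field A c v) (coord_field A c w) p =
     1/2 * (frechet_derivative (\<lambda>y. F y w) (at (snd c p)) v - frechet_derivative (\<lambda>y. F y v) (at (snd c p)) w)"
proof -
  note ch = chart_at_props[OF A, of p, folded c_def]
  have "dir_deriv A (coord_field A c v) (\<lambda>q. \<eta> q (coord_field A c w q)) p = frechet_derivative (\<lambda>y. F y w) (at (snd c p)) v"
    for v w
  proof -
    have "frechet_derivative (\<lambda>y. \<eta> (cinv c y) (coord_field A c w (cinv c y))) (at (snd c p)) =
        frechet_derivative (\<lambda>y. F y w) (at (snd c p))"
      by (rule frechet_derivative_cong_open[of "snd c ` fst c"])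
        (use ch in \<open>auto simp: is_chart_def F_def push_field_def cinv_chart\<close>)
    then show ?thesis
      using coord_field_at[OF A, of p v] by (simp add: dir_deriv_def mdiff_def o_def c_def)
  qed
  then show ?thesis
    using lie_bracket_coord_fields[OF A, of p v w] linear_0[OF \<eta>] by (simp add: ext_deriv_def c_def)
qed

text \<open>Pulling back commutes with the exterior derivative. In the chart $c$, with $u = c \circ J$ and
$F(y)(w)$ the value of $\eta$ on the coordinate vector $w$ at $y$, one has $\theta_a =
F(u)(Du\,a)$. Its derivative along $b$ is the sum of $F(u)(D^2u(a,b))$, which is symmetric in
$a$ and $b$ and cancels, and of the derivative of $F$ in the direction $Du\,b$, whose skew part
is $2\,d\eta$.\<close>

lemma pullback_ext_deriv:
  fixes J :: "'x::euclidean_space \<Rightarrow> 'm::{t2_space,second_countable_topology}"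
    and A :: "('m, 'e::euclidean_space) atlas"
  assumes A: "smooth_manifold A" and \<eta>: "smooth_one_form A UNIV \<eta>"
    and J: "smooth_map eucl_atlas S A J" and z: "z \<in> S"
  defines "c \<equiv> chart_at A (J z)"
  defines "\<theta> \<equiv> \<lambda>a z. \<eta> (J z) (mdiff eucl_atlas A J z a)"
  shows "\<theta> a differentiable (at z)"
    and "frechet_derivative (\<theta> a) (at z) b - frechet_derivative (\<theta> b) (at z) a =
      2 * ext_deriv A \<eta> (coord_field A c (mdiff eucl_atlas A J z b)) (coord_field A c (mdiff eucl_atlas A J z a)) (J z)"
proof -
  note ch = chart_at_props[OF A, of "J z", folded c_def]
  define u where "u = (\<lambda>z. snd c (J z))"
  define Q where "Q = S \<inter> J -` fst c"
  define F where "F = (\<lambda>y w. \<eta> (cinv c y) (mdiff eucl_atlas A (cinv c) y w))"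
  have lin: "linear (\<eta> p)" for p using \<eta> by (simp add: smooth_one_form_def)
  have eu: "(UNIV, id) \<in> eucl_atlas" by (simp add: eucl_atlas_def)
  have Q: "open Q" and u: "smooth_on Q u"
    using smooth_map_representative[OF smooth_manifold_eucl A J eu ch(1)] by (simp_all add: Q_def u_def)
  have zQ: "z \<in> Q" using z ch by (simp add: Q_def)
  have cQ: "open (snd c ` fst c)" using ch by (simp add: is_chart_def)
  have F: "smooth_on (snd c ` fst c) (\<lambda>y. F y w)" for w
    unfolding F_def by (rule one_form_coord_smooth[OF A ch(1) \<eta>])
  have Flin: "linear (F y)" if "y \<in> snd c ` fst c" for y
    unfolding F_def using linear_compose[OF mdiff_cinv_bij(1)[OF A ch(1) that] lin] by (simp add: o_def)
  have uQ: "u y \<in> snd c ` fst c" if "y \<in> Q" for y using that by (simp add: u_def Q_def)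
  have smu: "smooth_map eucl_atlas Q eucl_atlas u" using Q u by (simp add: smooth_map_eucl_iff)
  have push: "mdiff eucl_atlas A J y a = mdiff eucl_atlas A (cinv c) (u y) (frechet_derivative u (at y) a)"
    if y: "y \<in> Q" for y a
  proof -
    have "mdiff eucl_atlas A J y a = mdiff eucl_atlas A (\<lambda>x. cinv c (u x)) y a"
      by (rule fun_cong[OF mdiff_cong[OF smooth_manifold_eucl Q y]]) (simp add: u_def Q_def cinv_chart ch)
    also have "\<dots> = mdiff eucl_atlas A (cinv c) (u y) (mdiff eucl_atlas eucl_atlas u y a)"
      by (rule mdiff_compose[OF smooth_manifold_eucl smooth_manifold_eucl A smu smooth_map_cinv[OF A ch(1)] y uQ[OF y]])
    finally show ?thesis by (simp add: mdiff_eucl)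
  qed
  have pushz: "mdiff eucl_atlas A J z a = frechet_derivative u (at z) a" for a
    by (simp add: mdiff_def c_def[symmetric] u_def[abs_def] o_def)
  have \<theta>F: "\<theta> a y = (\<Sum>i\<in>Basis. (frechet_derivative u (at y) a \<bullet> i) *\<^sub>R F (u y) i)" if y: "y \<in> Q" for y a
  proof -
    have "\<theta> a y = F (u y) (frechet_derivative u (at y) a)"
      using y unfolding \<theta>_def F_def by (simp add: push[OF y]) (simp add: u_def Q_def cinv_chart ch)
    then show ?thesis using linear_basis_expansion[OF Flin[OF uQ[OF y]]] by metis
  qed
  let ?D = "\<lambda>f y. frechet_derivative f (at y)"
  have Fu: "smooth_on Q (\<lambda>y. F (u y) i)" for i
    by (rule smooth_on_compose[OF Q cQ _ u F]) (use uQ in auto)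
  have "smooth_on Q (\<lambda>y. \<Sum>i\<in>Basis. (?D u y a \<bullet> i) *\<^sub>R F (u y) i)" for a
    by (intro smooth_on_sum smooth_on_scaleR Fu Q smooth_on_linear_compose[OF Q bounded_linear_inner_left] smooth_on_derivative u)
  note sm\<theta> = smooth_on_cong[OF Q \<theta>F[symmetric] this]
  show "\<theta> a differentiable (at z)" by (rule smooth_on_differentiable[OF sm\<theta> zQ])
  \<comment> \<open>The product rule, with the terms collected by means of the linearity of $F(y)$.\<close>
  have D: "?D (\<theta> a) z b = F (u z) (?D (\<lambda>y. ?D u y a) z b) + ?D (\<lambda>y. F y (?D u z a)) (u z) (?D u z b)" for a b
  proof -
    have d1: "((\<lambda>y. ?D u y a \<bullet> i) has_derivative (\<lambda>b. ?D (\<lambda>y. ?D u y a) z b \<bullet> i)) (at z)" for i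
      by (rule bounded_linear.has_derivative[OF bounded_linear_inner_left
            differentiable_has_frechet_derivative[OF smooth_on_differentiable[OF smooth_on_derivative[OF u] zQ]]])
    have d2: "((\<lambda>y. F (u y) i) has_derivative (\<lambda>b. ?D (\<lambda>y. F y i) (u z) (?D u z b))) (at z)" for i
      by (rule has_derivative_compose[OF differentiable_has_frechet_derivative[OF smooth_on_differentiable[OF u zQ]]
            differentiable_has_frechet_derivative[OF smooth_on_differentiable[OF F uQ[OF zQ]]]])
    have "((\<lambda>y. \<Sum>i\<in>Basis. (?D u y a \<bullet> i) *\<^sub>R F (u y) i) has_derivative
        (\<lambda>b. \<Sum>i\<in>Basis. (?D u z a \<bullet> i) *\<^sub>R ?D (\<lambda>y. F y i) (u z) (?D u z b) +
           (?D (\<lambda>y. ?D u y a) z b \<bullet> i) *\<^sub>R F (u z) i)) (at z)"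
      by (intro has_derivative_sum has_derivative_scaleR d1 d2)
    note der = fun_cong[OF frechet_derivative_at[OF this], of b]
    have eqD: "?D (\<theta> a) z = ?D (\<lambda>y. \<Sum>i\<in>Basis. (?D u y a \<bullet> i) *\<^sub>R F (u y) i) z"
      by (rule frechet_derivative_cong_open[OF Q zQ \<theta>F])
    have 1: "?D (\<theta> a) z b = (\<Sum>i\<in>Basis. (?D u z a \<bullet> i) *\<^sub>R ?D (\<lambda>y. F y i) (u z) (?D u z b)) +
        (\<Sum>i\<in>Basis. (?D (\<lambda>y. ?D u y a) z b \<bullet> i) *\<^sub>R F (u z) i)"
      unfolding eqD by (simp only: der[symmetric] sum.distrib)
    have 2: "?D (\<lambda>y. F y w) (u z) v = (\<Sum>i\<in>Basis. (w \<bullet> i) *\<^sub>R ?D (\<lambda>y. F y i) (u z) v)" for w v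
    proof -
      have "((\<lambda>y. \<Sum>i\<in>Basis. (w \<bullet> i) *\<^sub>R F y i) has_derivative (\<lambda>v. \<Sum>i\<in>Basis. (w \<bullet> i) *\<^sub>R ?D (\<lambda>y. F y i) (u z) v)) (at (u z))"
        by (intro has_derivative_sum has_derivative_scaleR_right differentiable_has_frechet_derivative smooth_on_differentiable[OF F uQ[OF zQ]])
      note der = fun_cong[OF frechet_derivative_at[OF this], of v]
      have eqD: "?D (\<lambda>y. F y w) (u z) = ?D (\<lambda>y. \<Sum>i\<in>Basis. (w \<bullet> i) *\<^sub>R F y i) (u z)"
        by (rule frechet_derivative_cong_open[OF cQ uQ[OF zQ]]) (rule linear_basis_expansion[OF Flin])
      show ?thesis unfolding eqD by (rule der[symmetric])
    qed
    show ?thesis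
      unfolding 1 2[symmetric] linear_basis_expansion[OF Flin[OF uQ[OF zQ]], symmetric] by simp
  qed
  have "?D (\<theta> a) z b - ?D (\<theta> b) z a =
      ?D (\<lambda>y. F y (?D u z a)) (u z) (?D u z b) - ?D (\<lambda>y. F y (?D u z b)) (u z) (?D u z a)"
    unfolding D second_derivative_symmetric[OF Q zQ u, of a b] by simp
  also have "\<dots> = 2 * ext_deriv A \<eta> (coord_field A c (?D u z b)) (coord_field A c (?D u z a)) (J z)"
    using ext_deriv_coord_fields[where \<eta> = \<eta>, OF A lin, of "J z" "?D u z b" "?D u z a", folded c_def]
    by (simp add: F_def u_def)
  finally show "?D (\<theta> a) z b - ?D (\<theta> b) z a =
      2 * ext_deriv A \<eta> (coord_field A c (mdiff eucl_atlas A J z b)) (coord_field A c (mdiff eucl_atlas A J z a)) (J z)"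
    by (simp only: pushz)
qed

section \<open>Algebra of an S-structure\<close>

lemma S_manifoldD:
  assumes "indefinite_S_manifold A n s \<phi> \<xi> \<eta> \<epsilon> g"
  shows "smooth_manifold A" "s \<ge> 1" "linear (\<phi> p)" "bilinear (g p)" "g p v w = g p w v"
    "\<phi> p (\<phi> p v) = - v + (\<Sum>\<alpha>=1..s. \<eta> \<alpha> p v *\<^sub>R \<xi> \<alpha> p)"
    "g p (\<phi> p v) (\<phi> p w) = g p v w - (\<Sum>\<alpha>=1..s. \<epsilon> \<alpha> * \<eta> \<alpha> p v * \<eta> \<alpha> p w)"
  using assms by (simp_all add: indefinite_S_manifold_def smooth_endo_field_def semi_riemannian_metric_def)

lemma S_manifold_etaD:
  assumes "indefinite_S_manifold A n s \<phi> \<xi> \<eta> \<epsilon> g" and "\<alpha> \<in> {1..s}"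
  shows "smooth_one_form A UNIV (\<eta> \<alpha>)" "linear (\<eta> \<alpha> p)"
    "\<beta> \<in> {1..s} \<Longrightarrow> \<eta> \<alpha> p (\<xi> \<beta> p) = (if \<alpha> = \<beta> then 1 else 0)"
    "smooth_vf A U X \<Longrightarrow> smooth_vf A U Y \<Longrightarrow> q \<in> U \<Longrightarrow> ext_deriv A (\<eta> \<alpha>) X Y q = g q (X q) (\<phi> q (Y q))"
  using assms by (auto simp: indefinite_S_manifold_def smooth_one_form_def)

lemma S_manifold_epsilon:
  assumes "indefinite_S_manifold A n s \<phi> \<xi> \<eta> \<epsilon> g" and "\<alpha> \<in> {1..s}"
  shows "\<epsilon> \<alpha> * \<epsilon> \<alpha> = 1"
proof -
  have "\<forall>\<alpha>\<in>{1..s}. (\<epsilon> \<alpha> = 1 \<and> (\<forall>p. g p (\<xi> \<alpha> p) (\<xi> \<alpha> p) > 0)) \<or>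
                  (\<epsilon> \<alpha> = - 1 \<and> (\<forall>p. g p (\<xi> \<alpha> p) (\<xi> \<alpha> p) < 0))"
    using assms(1) unfolding indefinite_S_manifold_def by (elim conjE) assumption
  then have "\<epsilon> \<alpha> = 1 \<or> \<epsilon> \<alpha> = - 1" using assms(2) by blast
  then show ?thesis by auto
qed

lemma S_manifold_d_eta_coord:
  assumes S: "indefinite_S_manifold A n s \<phi> \<xi> \<eta> \<epsilon> g" and \<alpha>: "\<alpha> \<in> {1..s}"
  shows "ext_deriv A (\<eta> \<alpha>) (coord_field A (chart_at A p) v) (coord_field A (chart_at A p) w) p = g p v (\<phi> p w)"
proof -
  note A = S_manifoldD(1)[OF S]
  show ?thesis
    using S_manifold_etaD(4)[OF S \<alpha> smooth_vf_coord_field[OF A chart_at_props(1)[OF A]]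
        smooth_vf_coord_field[OF A chart_at_props(1)[OF A]] chart_at_props(2)[OF A]]
    by (simp only: coord_field_at[OF A])
qed

text \<open>The form $\Phi$ equals $d\eta^\alpha$, and exterior derivatives are skew-symmetric.\<close>

lemma S_manifold_phi_skew:
  assumes S: "indefinite_S_manifold A n s \<phi> \<xi> \<eta> \<epsilon> g"
  shows "g p v (\<phi> p w) = - g p w (\<phi> p v)"
proof -
  note A = S_manifoldD(1)[OF S]
  have 1: "1 \<in> {1..s}" using S_manifoldD(2)[OF S] by simp
  let ?c = "chart_at A p"
  have "ext_deriv A (\<eta> 1) (coord_field A ?c v) (coord_field A ?c w) p = - ext_deriv A (\<eta> 1) (coord_field A ?c w) (coord_field A ?c v) p"
    unfolding ext_deriv_coord_fields[where \<eta> = "\<eta> 1", OF A S_manifold_etaD(2)[OF S 1]] by (simp add: algebra_simps)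
  then show ?thesis by (simp only: S_manifold_d_eta_coord[OF S 1])
qed

text \<open>Compute $g(\phi\xi_\alpha, \phi v)$ in two ways. Skew-symmetry turns it into $-g(v,
\phi^2\xi_\alpha) = 0$, and compatibility of the metric turns it into $g(\xi_\alpha, v) -
\epsilon_\alpha\eta^\alpha(v)$.\<close>

lemma S_manifold_metric_xi:
  assumes S: "indefinite_S_manifold A n s \<phi> \<xi> \<eta> \<epsilon> g" and \<alpha>: "\<alpha> \<in> {1..s}"
  shows "g p v (\<xi> \<alpha> p) = \<epsilon> \<alpha> * \<eta> \<alpha> p v"
proof -
  note bil = S_manifoldD(4)[OF S, of p]
  have "g p (\<phi> p (\<xi> \<alpha> p)) (\<phi> p v) = - g p v (\<phi> p (\<phi> p (\<xi> \<alpha> p)))"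
    by (rule S_manifold_phi_skew[OF S])
  moreover have "(\<Sum>\<beta>=1..s. \<eta> \<beta> p (\<xi> \<alpha> p) *\<^sub>R \<xi> \<beta> p) = \<xi> \<alpha> p"
  proof -
    have "(\<Sum>\<beta>=1..s. \<eta> \<beta> p (\<xi> \<alpha> p) *\<^sub>R \<xi> \<beta> p) = (\<Sum>\<beta>=1..s. if \<beta> = \<alpha> then \<xi> \<beta> p else 0)"
      by (rule sum.cong) (use S_manifold_etaD(3)[OF S _ \<alpha>] in auto)
    then show ?thesis using \<alpha> by simp
  qed
  moreover have "(\<Sum>\<beta>=1..s. \<epsilon> \<beta> * \<eta> \<beta> p (\<xi> \<alpha> p) * \<eta> \<beta> p v) = \<epsilon> \<alpha> * \<eta> \<alpha> p v"
  proof -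
    have "(\<Sum>\<beta>=1..s. \<epsilon> \<beta> * \<eta> \<beta> p (\<xi> \<alpha> p) * \<eta> \<beta> p v) = (\<Sum>\<beta>=1..s. if \<beta> = \<alpha> then \<epsilon> \<beta> * \<eta> \<beta> p v else 0)"
      by (rule sum.cong) (use S_manifold_etaD(3)[OF S _ \<alpha>] in auto)
    then show ?thesis using \<alpha> by simp
  qed
  ultimately have "g p (\<xi> \<alpha> p) v = \<epsilon> \<alpha> * \<eta> \<alpha> p v"
    by (simp add: S_manifoldD(6)[OF S] S_manifoldD(7)[OF S] bilinear_rzero[OF bil])
  then show ?thesis by (simp add: S_manifoldD(5)[OF S, of p v])
qed

lemma S_manifold_pullback:
  assumes S: "indefinite_S_manifold A n s \<phi> \<xi> \<eta> \<epsilon> g" and \<alpha>: "\<alpha> \<in> {1..s}"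
    and J: "smooth_map eucl_atlas V A J" and z: "z \<in> V"
  shows "frechet_derivative (\<lambda>z. \<eta> \<alpha> (J z) (mdiff eucl_atlas A J z a)) (at z) b -
         frechet_derivative (\<lambda>z. \<eta> \<alpha> (J z) (mdiff eucl_atlas A J z b)) (at z) a =
         2 * g (J z) (mdiff eucl_atlas A J z b) (\<phi> (J z) (mdiff eucl_atlas A J z a))"
  unfolding pullback_ext_deriv(2)[OF S_manifoldD(1)[OF S] S_manifold_etaD(1)[OF S \<alpha>] J z]
  by (simp only: S_manifold_d_eta_coord[OF S \<alpha>])

lemma mdiff_cinv_eq_0_iff:
  assumes "smooth_manifold A" "c \<in> A" "y \<in> snd c ` fst c"
  shows "mdiff eucl_atlas A (cinv c) y u = 0 \<longleftrightarrow> u = 0"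
  using mdiff_cinv_bij[OF assms] linear_injective_0 linear_0 by (auto simp: bij_def)

section \<open>Submanifolds in coordinates\<close>

text \<open>A linear isomorphism matches the negative definite subspaces of the two forms and preserves
their dimensions.\<close>

lemma form_index_linear_bij:
  fixes L :: "'a::euclidean_space \<Rightarrow> 'a"
  assumes L: "linear L" "bij L"
  shows "form_index (\<lambda>v w. b (L v) (L w)) = form_index b"
proof -
  have inj: "inj L" and surj: "surj L" using L(2) by (simp_all add: bij_def)
  have dimL: "dim (L ` V) = dim V" for V
    by (rule dim_image_eq[OF L(1)]) (use inj in \<open>auto simp: inj_on_def\<close>)
  have "{dim V | V. subspace V \<and> (\<forall>v\<in>V. v \<noteq> 0 \<longrightarrow> b (L v) (L v) < 0)} =
      {dim V | V. subspace V \<and> (\<forall>v\<in>V. v \<noteq> 0 \<longrightarrow> b v v < 0)}" (is "?A = ?B")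
  proof (intro set_eqI iffI)
    fix k assume "k \<in> ?A"
    then obtain V where V: "k = dim V" "subspace V" "\<forall>v\<in>V. v \<noteq> 0 \<longrightarrow> b (L v) (L v) < 0" by blast
    have "k = dim (L ` V)" "subspace (L ` V)" "\<forall>v\<in>L ` V. v \<noteq> 0 \<longrightarrow> b v v < 0"
      using V dimL linear_subspace_image[OF L(1)] linear_0[OF L(1)] by auto
    then show "k \<in> ?B" by blast
  next
    fix k assume "k \<in> ?B"
    then obtain V where V: "k = dim V" "subspace V" "\<forall>v\<in>V. v \<noteq> 0 \<longrightarrow> b v v < 0" by blast
    have "k = dim (L -` V)" using dimL[of "L -` V"] surj_image_vimage_eq[OF surj] V(1) by metis
    moreover have "subspace (L -` V)" by (rule linear_subspace_vimage[OF L(1) V(2)])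
    moreover have "\<forall>v\<in>L -` V. v \<noteq> 0 \<longrightarrow> b (L v) (L v) < 0"
      using V(3) inj linear_0[OF L(1)] by (metis injD vimageE)
    ultimately show "k \<in> ?A" by blast
  qed
  then show ?thesis by (simp add: form_index_def)
qed

lemma
  assumes B: "smooth_manifold B" and A: "smooth_manifold A" and c: "c \<in> B" and j: "smooth_map B UNIV A j"
    and a: "a \<in> snd c ` fst c"
  shows mdiff_in_chart: "mdiff eucl_atlas A (\<lambda>a. j (cinv c a)) a v = mdiff B A j (cinv c a) (mdiff eucl_atlas B (cinv c) a v)"
    and range_mdiff_in_chart: "range (mdiff eucl_atlas A (\<lambda>a. j (cinv c a)) a) = range (mdiff B A j (cinv c a))"
proof -
  show eq: "mdiff eucl_atlas A (\<lambda>a. j (cinv c a)) a v = mdiff B A j (cinv c a) (mdiff eucl_atlas B (cinv c) a v)" for v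
    by (rule mdiff_compose[OF smooth_manifold_eucl B A smooth_map_cinv[OF B c] j a]) simp
  have "surj (mdiff eucl_atlas B (cinv c) a)" using mdiff_cinv_bij[OF B c a] by (simp add: bij_def)
  then show "range (mdiff eucl_atlas A (\<lambda>a. j (cinv c a)) a) = range (mdiff B A j (cinv c a))"
    unfolding eq[abs_def] by (metis image_image)
qed

text \<open>The factors of a CR-product are open sets of Euclidean spaces, so a given submanifold has to be
read in a chart. Vector fields on the coordinate domain are pushed to the manifold to inherit
the smoothness of the metric.\<close>

lemma nondegenerate_submanifold_in_chart:
  assumes B: "smooth_manifold B" and A: "smooth_manifold A" and j: "nondegenerate_submanifold B UNIV A g j"
    and c: "c \<in> B" and S: "open S" "S \<subseteq> snd c ` fst c"
  shows "nondegenerate_submanifold eucl_atlas S A g (\<lambda>a. j (cinv c a))"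
proof -
  have smj: "smooth_map B UNIV A j" and injj: "inj (mdiff B A j x)" for x
    using j by (auto simp: nondegenerate_submanifold_def immersion_def)
  have gB: "semi_riemannian_metric B UNIV (induced_metric B A g j)"
    using j by (simp add: nondegenerate_submanifold_def)
  let ?J = "\<lambda>a. j (cinv c a)" and ?L = "\<lambda>a. mdiff eucl_atlas B (cinv c) a"
  let ?h = "induced_metric B A g j"
  have L: "linear (?L a)" "bij (?L a)" "inj (?L a)" "surj (?L a)" if "a \<in> S" for a
    using mdiff_cinv_bij[OF B c, of a] S(2) that by (auto simp: bij_def)
  have ind: "induced_metric eucl_atlas A g ?J a = (\<lambda>v w. ?h (cinv c a) (?L a v) (?L a w))" if "a \<in> S" for a
    using mdiff_in_chart[OF B A c smj, of a] S(2) that by (auto simp: induced_metric_def fun_eq_iff)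
  have sm: "smooth_map eucl_atlas S A ?J"
    by (rule smooth_map_compose[OF smooth_manifold_eucl B A smooth_map_cinv[OF B c] smj S]) simp
  have "inj (mdiff eucl_atlas A ?J a)" if "a \<in> S" for a
    using mdiff_in_chart[OF B A c smj, of a] S(2) that injj L(3)[OF that]
    by (auto simp: inj_def)
  moreover have "semi_riemannian_metric eucl_atlas S (induced_metric eucl_atlas A g ?J)"
    unfolding semi_riemannian_metric_def
  proof (intro conjI ballI allI impI)
    show "open S" by (rule S)
    fix a assume a: "a \<in> S"
    have bil: "bilinear (?h (cinv c a))" and sym: "?h (cinv c a) v w = ?h (cinv c a) w v"
      and nd: "v \<noteq> 0 \<Longrightarrow> \<exists>w. ?h (cinv c a) v w \<noteq> 0" for v w
      using gB unfolding semi_riemannian_metric_def by blast+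
    show "bilinear (induced_metric eucl_atlas A g ?J a)"
      unfolding bilinear_def ind[OF a]
    proof (intro conjI allI)
      show "linear (\<lambda>y. ?h (cinv c a) (?L a x) (?L a y))" for x
        using linear_compose[OF L(1)[OF a], of "?h (cinv c a) (?L a x)"] bil by (simp add: bilinear_def o_def)
      show "linear (\<lambda>x. ?h (cinv c a) (?L a x) (?L a y))" for y
        using linear_compose[OF L(1)[OF a], of "\<lambda>x. ?h (cinv c a) x (?L a y)"] bil by (simp add: bilinear_def o_def)
    qed
    show "induced_metric eucl_atlas A g ?J a v w = induced_metric eucl_atlas A g ?J a w v" for v w
      by (simp only: ind[OF a] sym)
    fix v :: 'b assume "v \<noteq> 0"
    then have "?L a v \<noteq> 0" using L(1,3)[OF a] by (metis injD linear_0)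
    from nd[OF this] obtain w where "?h (cinv c a) (?L a v) w \<noteq> 0" by blast
    then show "\<exists>w. induced_metric eucl_atlas A g ?J a v w \<noteq> 0"
      unfolding ind[OF a] using L(4)[OF a] by (metis surjD)
  next
    obtain \<nu> where "\<forall>p. form_index (?h p) = \<nu>" using gB by (auto simp: semi_riemannian_metric_def)
    then show "\<exists>\<nu>. \<forall>a\<in>S. form_index (induced_metric eucl_atlas A g ?J a) = \<nu>"
      using form_index_linear_bij[OF L(1,2)] by (simp add: ind)
  next
    fix U X Y assume U: "U \<subseteq> S" and X: "smooth_vf eucl_atlas U X" and Y: "smooth_vf eucl_atlas U Y"
    have XU: "open U" "smooth_on U X" "smooth_on U Y" using X Y by (auto simp: smooth_vf_eucl_iff)
    have Uc: "U \<subseteq> snd c ` fst c" using U S by blast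
    note chc = smooth_manifold_chart[OF B c]
    have "smooth_function B (cinv c ` U) (\<lambda>p. ?h p (push_field B c X p) (push_field B c Y p))"
      using gB smooth_vf_push_field[OF B c XU(1) Uc] XU by (simp add: semi_riemannian_metric_def)
    then have "smooth_on (snd c ` (fst c \<inter> cinv c ` U)) ((\<lambda>p. ?h p (push_field B c X p) (push_field B c Y p)) \<circ> cinv c)"
      using c by (simp add: smooth_function_iff)
    moreover have "snd c ` (fst c \<inter> cinv c ` U) = U"
      unfolding cinv_image[OF chc Uc] using Uc by auto
    ultimately have "smooth_on U ((\<lambda>p. ?h p (push_field B c X p) (push_field B c Y p)) \<circ> cinv c)" by simp
    then have "smooth_on U (\<lambda>a. induced_metric eucl_atlas A g ?J a (X a) (Y a))"
    proof (rule smooth_on_cong[OF XU(1), rotated])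
      fix a assume a: "a \<in> U"
      have "snd c (cinv c a) = a" by (rule chart_cinv[OF subsetD[OF Uc a]])
      moreover have "a \<in> S" by (rule subsetD[OF U a])
      ultimately show "((\<lambda>p. ?h p (push_field B c X p) (push_field B c Y p)) \<circ> cinv c) a =
          induced_metric eucl_atlas A g ?J a (X a) (Y a)"
        by (simp add: ind push_field_def)
    qed
    then show "smooth_function eucl_atlas U (\<lambda>a. induced_metric eucl_atlas A g ?J a (X a) (Y a))"
      using XU by (simp add: smooth_function_def smooth_map_eucl_iff)
  qed
  ultimately show ?thesis using sm by (simp add: nondegenerate_submanifold_def immersion_def)
qed

text \<open>The coordinate fields of the vectors of a basis of $W$ form a local frame.\<close>

lemma smooth_distribution_in_charts:
  assumes B: "smooth_manifold B" and W: "subspace W"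
    and loc: "\<And>x. \<exists>c\<in>B. x \<in> fst c \<and> (\<forall>y\<in>fst c. D y = mdiff eucl_atlas B (cinv c) (snd c y) ` W)"
  shows "smooth_distribution B D"
  unfolding smooth_distribution_def
proof (intro exI allI)
  fix x
  obtain c where c: "c \<in> B" "x \<in> fst c" and D: "\<And>y. y \<in> fst c \<Longrightarrow> D y = mdiff eucl_atlas B (cinv c) (snd c y) ` W"
    using loc[of x] by blast
  have L: "linear (mdiff eucl_atlas B (cinv c) (snd c y))" "inj (mdiff eucl_atlas B (cinv c) (snd c y))" if "y \<in> fst c" for y
    using mdiff_cinv_bij[OF B c(1), of "snd c y"] that by (auto simp: bij_def)
  obtain b where b: "b \<subseteq> W" "independent b" "W \<subseteq> span b" "card b = dim W"
    using basis_exists by blast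
  have spanb: "span b = W" using b W by (meson span_minimal subset_antisym)
  have finb: "finite b" using b(2) independent_imp_finite by blast
  obtain h where h: "bij_betw h {0..<dim W} b" using ex_bij_betw_nat_finite[OF finb] b(4) by metis
  have sp: "D y = span {coord_field B c (h i) y | i. i < dim W}" if y: "y \<in> fst c" for y
  proof -
    have "{coord_field B c (h i) y | i. i < dim W} = mdiff eucl_atlas B (cinv c) (snd c y) ` (h ` {0..<dim W})"
      by (auto simp: push_field_def)
    also have "h ` {0..<dim W} = b" using h by (simp add: bij_betw_def)
    finally show ?thesis using D[OF y] spanb linear_span_image[OF L(1)[OF y], of b] by simp
  qed
  show "subspace (D x) \<and> dim (D x) = dim W \<and>
     (\<exists>U X. x \<in> U \<and> (\<forall>i<dim W. smooth_vf B U (X i)) \<and> open U \<and> (\<forall>y\<in>U. D y = span {X i y | i. i < dim W}))"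
  proof (intro conjI exI)
    show "subspace (D x)" using D[OF c(2)] linear_subspace_image[OF L(1)[OF c(2)] W] by simp
    show "dim (D x) = dim W"
      using D[OF c(2)] dim_image_eq[OF L(1)[OF c(2)], of W] L(2)[OF c(2)] by (simp add: inj_on_subset)
    show "x \<in> fst c" by (rule c)
    show "\<forall>i<dim W. smooth_vf B (fst c) (coord_field B c (h i))" using smooth_vf_coord_field[OF B c(1)] by blast
    show "open (fst c)" using smooth_manifold_chart[OF B c(1)] open_chart_domain by blast
    show "\<forall>y\<in>fst c. D y = span {coord_field B c (h i) y | i. i < dim W}" using sp by blast
  qed
qed

section \<open>Tangent spaces of a product\<close>

lemma mdiff_eucl_fst: "mdiff eucl_atlas eucl_atlas fst z v = fst v"
  and mdiff_eucl_snd: "mdiff eucl_atlas eucl_atlas snd z v = snd v"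
  for z :: "'a::euclidean_space \<times> 'b::euclidean_space"
  using fun_cong[OF frechet_derivative_at[OF bounded_linear.has_derivative[OF bounded_linear_fst has_derivative_ident, of "at z"]], of v]
    fun_cong[OF frechet_derivative_at[OF bounded_linear.has_derivative[OF bounded_linear_snd has_derivative_ident, of "at z"]], of v]
  by (simp_all add: mdiff_eucl)

text \<open>The vertical space is tangent to the second factor (the fibre of the first projection), and the
horizontal space to the first factor. Taking kernels of differentials avoids naming the chart
chosen at the point.\<close>

abbreviation vertical_space :: "('p, 'a::euclidean_space) atlas \<Rightarrow> ('q, 'b::euclidean_space) atlas \<Rightarrow> 'p \<times> 'q \<Rightarrow> ('a \<times> 'b) set" where
  "vertical_space A1 A2 x \<equiv> {v. mdiff (prod_atlas A1 A2) A1 fst x v = 0}"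

abbreviation horizontal_space :: "('p, 'a::euclidean_space) atlas \<Rightarrow> ('q, 'b::euclidean_space) atlas \<Rightarrow> 'p \<times> 'q \<Rightarrow> ('a \<times> 'b) set" where
  "horizontal_space A1 A2 x \<equiv> {v. mdiff (prod_atlas A1 A2) A2 snd x v = 0}"

lemma factor_spaces_eq:
  assumes "smooth_manifold A1" "smooth_manifold A2"
  shows "vertical_space A1 A2 x = {v. fst v = 0}" "horizontal_space A1 A2 x = {v. snd v = 0}"
proof -
  obtain P Q where P: "linear P" "bij P" "linear Q" "bij Q"
    "\<And>v. mdiff (prod_atlas A1 A2) A1 fst x v = P (fst v)" "\<And>v. mdiff (prod_atlas A1 A2) A2 snd x v = Q (snd v)"
    using mdiff_projections[OF assms] by metis
  have "P v = 0 \<longleftrightarrow> v = 0" "Q w = 0 \<longleftrightarrow> w = 0" for v w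
    using P(1-4) by (metis bij_def injD linear_0)+
  then show "vertical_space A1 A2 x = {v. fst v = 0}" "horizontal_space A1 A2 x = {v. snd v = 0}"
    by (simp_all add: P)
qed

lemma prod_tangent_eqI:
  assumes A1: "smooth_manifold A1" and A2: "smooth_manifold A2"
    and "mdiff (prod_atlas A1 A2) A1 fst x u = mdiff (prod_atlas A1 A2) A1 fst x v"
    and "mdiff (prod_atlas A1 A2) A2 snd x u = mdiff (prod_atlas A1 A2) A2 snd x v"
  shows "u = v"
proof -
  have "u - v \<in> vertical_space A1 A2 x" "u - v \<in> horizontal_space A1 A2 x"
    using assms linear_diff[OF mdiff_linear[OF smooth_manifold_prod[OF A1 A2] A1 smooth_map_fst[OF A1 A2]], of x u v]
      linear_diff[OF mdiff_linear[OF smooth_manifold_prod[OF A1 A2] A2 smooth_map_snd[OF A1 A2]], of x u v]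
    by simp_all
  then show ?thesis unfolding factor_spaces_eq[OF A1 A2] by (simp add: prod_eq_iff)
qed

lemma smooth_map_slices:
  assumes A1: "smooth_manifold A1" and A2: "smooth_manifold A2"
  shows "smooth_map A1 UNIV (prod_atlas A1 A2) (\<lambda>p. (p, q))" "smooth_map A2 UNIV (prod_atlas A1 A2) (\<lambda>q. (p, q))"
  by (intro smooth_map_Pair A1 A2 smooth_map_ident smooth_map_const open_UNIV)+

lemma mdiff_slices:
  assumes A1: "smooth_manifold A1" and A2: "smooth_manifold A2"
  shows "mdiff (prod_atlas A1 A2) A1 fst (p, q) (mdiff A1 (prod_atlas A1 A2) (\<lambda>p. (p, q)) p v) = v"
    "mdiff (prod_atlas A1 A2) A2 snd (p, q) (mdiff A1 (prod_atlas A1 A2) (\<lambda>p. (p, q)) p v) = 0"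
    "mdiff (prod_atlas A1 A2) A1 fst (p, q) (mdiff A2 (prod_atlas A1 A2) (\<lambda>q. (p, q)) q w) = 0"
    "mdiff (prod_atlas A1 A2) A2 snd (p, q) (mdiff A2 (prod_atlas A1 A2) (\<lambda>q. (p, q)) q w) = w"
proof -
  note P = smooth_manifold_prod[OF A1 A2] and sl = smooth_map_slices[OF A1 A2]
    and f = smooth_map_fst[OF A1 A2] and s = smooth_map_snd[OF A1 A2]
  show "mdiff (prod_atlas A1 A2) A1 fst (p, q) (mdiff A1 (prod_atlas A1 A2) (\<lambda>p. (p, q)) p v) = v"
    using mdiff_compose[OF A1 P A1 sl(1) f, of p q v] mdiff_ident[OF A1] by simp
  show "mdiff (prod_atlas A1 A2) A2 snd (p, q) (mdiff A1 (prod_atlas A1 A2) (\<lambda>p. (p, q)) p v) = 0"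
    using mdiff_compose[OF A1 P A2 sl(1) s, of p q v] by (simp add: mdiff_const)
  show "mdiff (prod_atlas A1 A2) A1 fst (p, q) (mdiff A2 (prod_atlas A1 A2) (\<lambda>q. (p, q)) q w) = 0"
    using mdiff_compose[OF A2 P A1 sl(2) f, of q p w] by (simp add: mdiff_const)
  show "mdiff (prod_atlas A1 A2) A2 snd (p, q) (mdiff A2 (prod_atlas A1 A2) (\<lambda>q. (p, q)) q w) = w"
    using mdiff_compose[OF A2 P A2 sl(2) s, of q p w] mdiff_ident[OF A2] by simp
qed

lemma range_mdiff_slices:
  assumes A1: "smooth_manifold A1" and A2: "smooth_manifold A2"
  shows "range (mdiff A1 (prod_atlas A1 A2) (\<lambda>p. (p, q)) p) = horizontal_space A1 A2 (p, q)"
    "range (mdiff A2 (prod_atlas A1 A2) (\<lambda>q. (p, q)) q) = vertical_space A1 A2 (p, q)"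
proof -
  have 1: "mdiff A1 (prod_atlas A1 A2) (\<lambda>p. (p, q)) p (mdiff (prod_atlas A1 A2) A1 fst (p, q) v) = v"
    if "v \<in> horizontal_space A1 A2 (p, q)" for v
    by (rule prod_tangent_eqI[OF A1 A2, of "(p, q)"]) (use that in \<open>simp_all add: mdiff_slices[OF A1 A2]\<close>)
  have 2: "mdiff A2 (prod_atlas A1 A2) (\<lambda>q. (p, q)) q (mdiff (prod_atlas A1 A2) A2 snd (p, q) v) = v"
    if "v \<in> vertical_space A1 A2 (p, q)" for v
    by (rule prod_tangent_eqI[OF A1 A2, of "(p, q)"]) (use that in \<open>simp_all add: mdiff_slices[OF A1 A2]\<close>)
  show "range (mdiff A1 (prod_atlas A1 A2) (\<lambda>p. (p, q)) p) = horizontal_space A1 A2 (p, q)"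
  proof (intro set_eqI iffI)
    fix v assume "v \<in> horizontal_space A1 A2 (p, q)"
    from 1[OF this] show "v \<in> range (mdiff A1 (prod_atlas A1 A2) (\<lambda>p. (p, q)) p)" by (metis rangeI)
  qed (auto simp: mdiff_slices[OF A1 A2])
  show "range (mdiff A2 (prod_atlas A1 A2) (\<lambda>q. (p, q)) q) = vertical_space A1 A2 (p, q)"
  proof (intro set_eqI iffI)
    fix v assume "v \<in> vertical_space A1 A2 (p, q)"
    from 2[OF this] show "v \<in> range (mdiff A2 (prod_atlas A1 A2) (\<lambda>q. (p, q)) q)" by (metis rangeI)
  qed (auto simp: mdiff_slices[OF A1 A2])
qed

text \<open>The parametrisation of a coordinate box in which the Riemannian product structure is exhibited.\<close>

definition prod_param :: "('p, 'a) chart \<Rightarrow> ('q, 'b) chart \<Rightarrow> 'a \<times> 'b \<Rightarrow> 'p \<times> 'q" where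
  "prod_param c d z = (cinv c (fst z), cinv d (snd z))"

lemma prod_eucl_atlas: "prod_atlas eucl_atlas eucl_atlas = eucl_atlas"
  by (auto simp: prod_atlas_def eucl_atlas_def map_prod.id)

lemma smooth_map_prod_param:
  assumes A1: "smooth_manifold A1" and A2: "smooth_manifold A2" and c: "c \<in> A1" and d: "d \<in> A2"
  shows "smooth_map eucl_atlas (snd c ` fst c \<times> snd d ` fst d) (prod_atlas A1 A2) (prod_param c d)"
proof -
  let ?T = "snd c ` fst c \<times> snd d ` fst d"
  have T: "open ?T"
    using smooth_map_open[OF smooth_map_cinv[OF A1 c]] smooth_map_open[OF smooth_map_cinv[OF A2 d]] by (rule open_Times)
  have f: "smooth_map eucl_atlas ?T eucl_atlas fst" and s: "smooth_map eucl_atlas ?T eucl_atlas snd"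
    using T by (simp_all add: smooth_map_eucl_iff smooth_on_linear bounded_linear_fst bounded_linear_snd)
  have "smooth_map eucl_atlas ?T (prod_atlas A1 A2) (\<lambda>z. (cinv c (fst z), cinv d (snd z)))"
    by (rule smooth_map_Pair[OF smooth_manifold_eucl A1 A2
          smooth_map_compose[OF smooth_manifold_eucl smooth_manifold_eucl A1 f smooth_map_cinv[OF A1 c] T]
          smooth_map_compose[OF smooth_manifold_eucl smooth_manifold_eucl A2 s smooth_map_cinv[OF A2 d] T]]) auto
  then show ?thesis by (simp add: prod_param_def[abs_def])
qed

lemma mdiff_prod_param:
  assumes A1: "smooth_manifold A1" and A2: "smooth_manifold A2" and c: "c \<in> A1" and d: "d \<in> A2"
    and z: "z \<in> snd c ` fst c \<times> snd d ` fst d"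
  shows "mdiff (prod_atlas A1 A2) A1 fst (prod_param c d z) (mdiff eucl_atlas (prod_atlas A1 A2) (prod_param c d) z v) =
      mdiff eucl_atlas A1 (cinv c) (fst z) (fst v)"
    "mdiff (prod_atlas A1 A2) A2 snd (prod_param c d z) (mdiff eucl_atlas (prod_atlas A1 A2) (prod_param c d) z v) =
      mdiff eucl_atlas A2 (cinv d) (snd z) (snd v)"
proof -
  note P = smooth_manifold_prod[OF A1 A2] and E = smooth_manifold_eucl
  have f: "smooth_map eucl_atlas UNIV eucl_atlas fst" and s: "smooth_map eucl_atlas UNIV eucl_atlas snd"
    by (simp_all add: smooth_map_eucl_iff smooth_on_linear bounded_linear_fst bounded_linear_snd)
  have z1: "fst z \<in> snd c ` fst c" and z2: "snd z \<in> snd d ` fst d" using z by auto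
  show "mdiff (prod_atlas A1 A2) A1 fst (prod_param c d z) (mdiff eucl_atlas (prod_atlas A1 A2) (prod_param c d) z v) =
      mdiff eucl_atlas A1 (cinv c) (fst z) (fst v)"
    using mdiff_compose[OF E P A1 smooth_map_prod_param[OF A1 A2 c d] smooth_map_fst[OF A1 A2] z, of v]
      mdiff_compose[OF E E A1 f smooth_map_cinv[OF A1 c] UNIV_I z1, of v]
    by (simp add: prod_param_def mdiff_eucl_fst)
  show "mdiff (prod_atlas A1 A2) A2 snd (prod_param c d z) (mdiff eucl_atlas (prod_atlas A1 A2) (prod_param c d) z v) =
      mdiff eucl_atlas A2 (cinv d) (snd z) (snd v)"
    using mdiff_compose[OF E P A2 smooth_map_prod_param[OF A1 A2 c d] smooth_map_snd[OF A1 A2] z, of v]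
      mdiff_compose[OF E E A2 s smooth_map_cinv[OF A2 d] UNIV_I z2, of v]
    by (simp add: prod_param_def mdiff_eucl_snd)
qed

text \<open>In a product chart both spaces have constant coordinates: they are the images of $\{0\} \times
V_2$ and $V_1 \times \{0\}$.\<close>

lemma factor_spaces_smooth:
  assumes A1: "smooth_manifold A1" and A2: "smooth_manifold A2"
  shows "smooth_distribution (prod_atlas A1 A2) (vertical_space A1 A2)"
    "smooth_distribution (prod_atlas A1 A2) (horizontal_space A1 A2)"
proof -
  note P = smooth_manifold_prod[OF A1 A2]
  have "\<exists>e\<in>prod_atlas A1 A2. x \<in> fst e \<and> (\<forall>y\<in>fst e.
      vertical_space A1 A2 y = mdiff eucl_atlas (prod_atlas A1 A2) (cinv e) (snd e y) ` {v. fst v = 0}) \<and> (\<forall>y\<in>fst e.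
      horizontal_space A1 A2 y = mdiff eucl_atlas (prod_atlas A1 A2) (cinv e) (snd e y) ` {v. snd v = 0})" for x
  proof -
    let ?e = "chart_at (prod_atlas A1 A2) x"
    note ch = chart_at_props[OF P, of x]
    obtain c d where cd: "c \<in> A1" "d \<in> A2" and e: "?e = (fst c \<times> fst d, map_prod (snd c) (snd d))"
      using ch(1) by (elim prod_atlasE)
    note chc = smooth_manifold_chart[OF A1 cd(1)] and chd = smooth_manifold_chart[OF A2 cd(2)]
    let ?T = "snd c ` fst c \<times> snd d ` fst d"
    have T: "open ?T" using chc chd by (intro open_Times) (auto simp: is_chart_def)
    have both: "vertical_space A1 A2 y = mdiff eucl_atlas (prod_atlas A1 A2) (cinv ?e) (snd ?e y) ` {v. fst v = 0}"
      "horizontal_space A1 A2 y = mdiff eucl_atlas (prod_atlas A1 A2) (cinv ?e) (snd ?e y) ` {v. snd v = 0}"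
      if ye: "y \<in> fst ?e" for y
    proof -
      have y: "fst y \<in> fst c" "snd y \<in> fst d" using ye by (auto simp: e)
      define z where "z = snd ?e y"
      have z: "z \<in> ?T" using y by (cases y) (auto simp: z_def e)
      have zy: "prod_param c d z = y" using y by (cases y) (simp add: z_def e prod_param_def cinv_chart chc chd)
      let ?L = "mdiff eucl_atlas (prod_atlas A1 A2) (cinv ?e) z"
      have "?L = mdiff eucl_atlas (prod_atlas A1 A2) (prod_param c d) z"
        by (rule mdiff_cong[OF smooth_manifold_eucl T z]) (auto simp: e prod_param_def cinv_prod chc chd)
      note L = mdiff_prod_param[OF A1 A2 cd z, folded this, unfolded zy]
      have "z \<in> snd ?e ` fst ?e" using ye by (simp add: z_def)
      from mdiff_cinv_bij(2)[OF P ch(1) this] have surj: "surj ?L" by (simp add: bij_def)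
      have inj1: "mdiff eucl_atlas A1 (cinv c) (fst z) u = 0 \<longleftrightarrow> u = 0" for u
        by (rule mdiff_cinv_eq_0_iff[OF A1 cd(1)]) (use z in auto)
      have inj2: "mdiff eucl_atlas A2 (cinv d) (snd z) u = 0 \<longleftrightarrow> u = 0" for u
        by (rule mdiff_cinv_eq_0_iff[OF A2 cd(2)]) (use z in auto)
      have 1: "?L v \<in> vertical_space A1 A2 y \<longleftrightarrow> fst v = 0" for v using L(1) inj1 by simp
      have 2: "?L v \<in> horizontal_space A1 A2 y \<longleftrightarrow> snd v = 0" for v using L(2) inj2 by simp
      have im: "M = ?L ` {v. R v}" if "\<And>v. ?L v \<in> M \<longleftrightarrow> R v" for M R
      proof (intro set_eqI iffI)
        fix u assume "u \<in> M"
        moreover obtain v where "u = ?L v" using surj by (metis surjD)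
        ultimately show "u \<in> ?L ` {v. R v}" using that by blast
      qed (use that in auto)
      show "vertical_space A1 A2 y = mdiff eucl_atlas (prod_atlas A1 A2) (cinv ?e) (snd ?e y) ` {v. fst v = 0}"
        using im[OF 1] by (simp only: z_def)
      show "horizontal_space A1 A2 y = mdiff eucl_atlas (prod_atlas A1 A2) (cinv ?e) (snd ?e y) ` {v. snd v = 0}"
        using im[OF 2] by (simp only: z_def)
    qed
    show ?thesis
      by (rule bexI[OF _ ch(1)]) (intro conjI ballI ch(2) both)
  qed
  note loc = this
  have sub: "subspace {v :: 'b \<times> 'd. fst v = 0}" "subspace {v :: 'b \<times> 'd. snd v = 0}"
    by (auto simp: subspace_def)
  show "smooth_distribution (prod_atlas A1 A2) (vertical_space A1 A2)"
    by (rule smooth_distribution_in_charts[OF P sub(1)], rule bexE[OF loc], elim conjE, rule bexI, rule conjI, assumption+)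
  show "smooth_distribution (prod_atlas A1 A2) (horizontal_space A1 A2)"
    by (rule smooth_distribution_in_charts[OF P sub(2)], rule bexE[OF loc], elim conjE, rule bexI, rule conjI, assumption+)
qed

section \<open>Warped products of a totally real and an invariant factor\<close>

locale warped_product_CR =
  fixes A :: "('m::{t2_space,second_countable_topology}, 'e::euclidean_space) atlas"
    and n s :: nat
    and \<phi> :: "'m \<Rightarrow> 'e \<Rightarrow> 'e"
    and \<xi> :: "nat \<Rightarrow> 'm \<Rightarrow> 'e"
    and \<eta> :: "nat \<Rightarrow> 'm \<Rightarrow> 'e \<Rightarrow> real"
    and \<epsilon> :: "nat \<Rightarrow> real"
    and g :: "'m \<Rightarrow> 'e \<Rightarrow> 'e \<Rightarrow> real"
    and Aperp :: "('p::{t2_space,second_countable_topology}, 'e1::euclidean_space) atlas"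
    and AT :: "('q::{t2_space,second_countable_topology}, 'e2::euclidean_space) atlas"
    and gperp :: "'p \<Rightarrow> 'e1 \<Rightarrow> 'e1 \<Rightarrow> real"
    and gT :: "'q \<Rightarrow> 'e2 \<Rightarrow> 'e2 \<Rightarrow> real"
    and f :: "'p \<Rightarrow> real"
    and j :: "'p \<times> 'q \<Rightarrow> 'm"
  assumes S: "indefinite_S_manifold A n s \<phi> \<xi> \<eta> \<epsilon> g"
    and warped: "warped_product_submanifold Aperp AT gperp f gT A g j"
    and totally_real: "totally_real_submanifold Aperp UNIV A \<phi> g (\<lambda>p. j (p, q))"
    and invariant: "invariant_submanifold AT UNIV A \<phi> g (\<lambda>q. j (p, q))"
begin

abbreviation B where "B \<equiv> prod_atlas Aperp AT"

abbreviation D where "D \<equiv> vertical_space Aperp AT"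
abbreviation Dperp where "Dperp \<equiv> horizontal_space Aperp AT"

abbreviation dj where "dj \<equiv> mdiff B A j"

lemmas mA = S_manifoldD(1)[OF S]

lemma mperp: "smooth_manifold Aperp" and mT: "smooth_manifold AT"
  and nondeg: "nondegenerate_submanifold B UNIV A g j"
  and f_pos: "f p > 0"
  and gperp_bilinear: "bilinear (gperp p)" and gT_bilinear: "bilinear (gT q)"
  using warped by (simp_all add: warped_product_submanifold_def semi_riemannian_metric_def)

lemma gT_nondegenerate: "(\<And>w. gT q w v = gT q w v') \<Longrightarrow> v = v'"
proof (rule ccontr)
  assume eq: "\<And>w. gT q w v = gT q w v'" and "v \<noteq> v'"
  have "semi_riemannian_metric AT UNIV gT" using warped by (simp add: warped_product_submanifold_def)
  then have nd: "\<And>v. v \<noteq> 0 \<Longrightarrow> \<exists>w. gT q v w \<noteq> 0" and sym: "\<And>v w. gT q v w = gT q w v"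
    unfolding semi_riemannian_metric_def by blast+
  obtain w where "gT q (v - v') w \<noteq> 0" using nd[of "v - v'"] \<open>v \<noteq> v'\<close> by auto
  then show False using eq[of w] bilinear_rsub[OF gT_bilinear, of q w v v'] sym[of "v - v'" w] by simp
qed

lemmas mB = smooth_manifold_prod[OF mperp mT]

lemma j_smooth: "smooth_map B UNIV A j"
  using nondeg by (simp add: nondegenerate_submanifold_def immersion_def)

lemma dj_linear: "linear (dj x)"
  by (rule mdiff_linear[OF mB mA j_smooth]) simp

lemma metric_dj:
  "g (j x) (dj x v) (dj x w) =
     gperp (fst x) (mdiff B Aperp fst x v) (mdiff B Aperp fst x w) +
     (f (fst x))\<^sup>2 * gT (snd x) (mdiff B AT snd x v) (mdiff B AT snd x w)"
proof -
  have "induced_metric B A g j x v w = warped_product_metric Aperp AT gperp f gT x v w"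
    using warped unfolding warped_product_submanifold_def by blast
  then show ?thesis by (simp add: induced_metric_def warped_product_metric_def Let_def)
qed

lemma D_orthogonal: "v \<in> D x \<Longrightarrow> w \<in> Dperp x \<Longrightarrow> g (j x) (dj x w) (dj x v) = 0"
  by (simp add: metric_dj bilinear_rzero[OF gperp_bilinear] bilinear_lzero[OF gT_bilinear])

lemma slice_smooth: "smooth_map Aperp UNIV A (\<lambda>p. j (p, q))" "smooth_map AT UNIV A (\<lambda>q. j (p, q))"
  using totally_real[of q] invariant[of p]
  by (simp_all add: totally_real_submanifold_def invariant_submanifold_def nondegenerate_submanifold_def immersion_def)

lemma slice_mdiff:
  "mdiff Aperp A (\<lambda>p. j (p, q)) p v = dj (p, q) (mdiff Aperp B (\<lambda>p. (p, q)) p v)"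
  "mdiff AT A (\<lambda>q. j (p, q)) q w = dj (p, q) (mdiff AT B (\<lambda>q. (p, q)) q w)"
  using mdiff_compose[OF mperp mB mA smooth_map_slices(1)[OF mperp mT] j_smooth, of p q v]
    mdiff_compose[OF mT mB mA smooth_map_slices(2)[OF mperp mT] j_smooth, of q p w] by simp_all

lemma slice_range:
  "range (mdiff Aperp A (\<lambda>p. j (p, q)) p) = dj (p, q) ` Dperp (p, q)"
  "range (mdiff AT A (\<lambda>q. j (p, q)) q) = dj (p, q) ` D (p, q)"
proof -
  show "range (mdiff Aperp A (\<lambda>p. j (p, q)) p) = dj (p, q) ` Dperp (p, q)"
    unfolding range_mdiff_slices(1)[OF mperp mT, symmetric] slice_mdiff(1)[abs_def] by (simp add: image_image)
  show "range (mdiff AT A (\<lambda>q. j (p, q)) q) = dj (p, q) ` D (p, q)"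
    unfolding range_mdiff_slices(2)[OF mperp mT, symmetric] slice_mdiff(2)[abs_def] by (simp add: image_image)
qed

lemma slice_metric:
  "g (j (p, q)) (mdiff Aperp A (\<lambda>p. j (p, q)) p v) (mdiff Aperp A (\<lambda>p. j (p, q)) p v') = gperp p v v'"
  "g (j (p, q)) (mdiff AT A (\<lambda>q. j (p, q)) q w) (mdiff AT A (\<lambda>q. j (p, q)) q w') = (f p)\<^sup>2 * gT q w w'"
  by (simp_all add: slice_mdiff metric_dj mdiff_slices[OF mperp mT]
      bilinear_rzero[OF gperp_bilinear] bilinear_rzero[OF gT_bilinear])

lemma slice_orthogonal:
  "g (j (p, q)) (mdiff Aperp A (\<lambda>p. j (p, q)) p v) (mdiff AT A (\<lambda>q. j (p, q)) q w) = 0"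
  by (simp add: slice_mdiff metric_dj mdiff_slices[OF mperp mT]
      bilinear_rzero[OF gperp_bilinear] bilinear_lzero[OF gT_bilinear])

lemma phi_D: "v \<in> D x \<Longrightarrow> \<phi> (j x) (dj x v) \<in> dj x ` D x"
proof -
  assume "v \<in> D x"
  obtain p q where x: "x = (p, q)" by (cases x)
  have "\<phi> (j (p, q)) ` range (mdiff AT A (\<lambda>q. j (p, q)) q) \<subseteq> range (mdiff AT A (\<lambda>q. j (p, q)) q)"
    using invariant[of p] by (simp add: invariant_submanifold_def)
  then have "\<phi> (j x) ` (dj x ` D x) \<subseteq> dj x ` D x" by (simp only: slice_range x)
  from this \<open>v \<in> D x\<close> show ?thesis by blast
qed

lemma phi_Dperp: "v \<in> Dperp x \<Longrightarrow> w \<in> Dperp x \<Longrightarrow> g (j x) (\<phi> (j x) (dj x v)) (dj x w) = 0"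
proof -
  assume vw: "v \<in> Dperp x" "w \<in> Dperp x"
  obtain p q where x: "x = (p, q)" by (cases x)
  have "\<forall>v\<in>range (mdiff Aperp A (\<lambda>p. j (p, q)) p). \<forall>w\<in>range (mdiff Aperp A (\<lambda>p. j (p, q)) p).
      g (j (p, q)) (\<phi> (j (p, q)) v) w = 0"
    using totally_real[of q] by (simp add: totally_real_submanifold_def)
  then have "\<forall>v\<in>dj x ` Dperp x. \<forall>w\<in>dj x ` Dperp x. g (j x) (\<phi> (j x) v) w = 0"
    by (simp only: slice_range x)
  then show ?thesis using vw by blast
qed

lemma eta_eq_metric_xi:
  assumes "\<alpha> \<in> {1..s}"
  shows "\<eta> \<alpha> m v = \<epsilon> \<alpha> * g m v (\<xi> \<alpha> m)"
  using S_manifold_metric_xi[OF S assms, of m v] S_manifold_epsilon[OF S assms]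
  by (metis mult.assoc mult.left_neutral)

text \<open>All $\eta^\alpha$ would vanish along a leaf $N^T$, so $\Phi = d\eta^\alpha$ would vanish on it.
As $\phi$ squares to $-1$ on $TN^T$, the metric of the leaf would be zero.\<close>

lemma xi_not_tangent_to_perp:
  assumes tan: "\<And>\<alpha> q. \<alpha> \<in> {1..s} \<Longrightarrow> tangent_to Aperp UNIV A (\<lambda>p. j (p, q)) (\<xi> \<alpha>)"
  shows False
proof -
  \<comment> \<open>Any leaf leads to the contradiction; types are inhabited.\<close>
  obtain p :: 'p and q :: 'q where True by blast
  define d where "d = chart_at AT q"
  note ch = chart_at_props[OF mT, of q, folded d_def]
  let ?V = "snd d ` fst d" and ?J = "\<lambda>b. j (p, cinv d b)" and ?\<iota> = "\<lambda>q. j (p, q)"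
  have J: "smooth_map eucl_atlas ?V A ?J"
    by (rule smooth_map_compose[OF smooth_manifold_eucl mT mA smooth_map_cinv[OF mT ch(1)] slice_smooth(2)
          smooth_map_open[OF smooth_map_cinv[OF mT ch(1)]] order_refl]) simp
  have eta0: "\<eta> \<alpha> (j (p, q)) (mdiff AT A ?\<iota> q w) = 0" if \<alpha>: "\<alpha> \<in> {1..s}" for \<alpha> q w
  proof -
    obtain u where "\<xi> \<alpha> (j (p, q)) = mdiff Aperp A (\<lambda>p. j (p, q)) p u"
      using tan[OF \<alpha>, of q] by (auto simp: tangent_to_def)
    then show ?thesis
      using slice_orthogonal[of p q u w] by (simp add: eta_eq_metric_xi[OF \<alpha>] S_manifoldD(5)[OF S, of _ "mdiff AT A ?\<iota> q w"])
  qed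
  obtain \<alpha> where \<alpha>: "\<alpha> \<in> {1..s}" using S_manifoldD(2)[OF S] by fastforce
  define z where "z = snd d q"
  have z: "z \<in> ?V" and zq: "cinv d z = q" using ch by (auto simp: z_def cinv_chart)
  have mJ: "mdiff eucl_atlas A ?J b w = mdiff AT A ?\<iota> (cinv d b) (mdiff eucl_atlas AT (cinv d) b w)" if "b \<in> ?V" for b w
    by (rule mdiff_in_chart[OF mT mA ch(1) slice_smooth(2) that])
  \<comment> \<open>The whole left-hand side of the pullback identity vanishes.\<close>
  have zero: "frechet_derivative (\<lambda>b. \<eta> \<alpha> (?J b) (mdiff eucl_atlas A ?J b w)) (at z) = (\<lambda>_. 0)" for w
  proof -
    have "frechet_derivative (\<lambda>b. \<eta> \<alpha> (?J b) (mdiff eucl_atlas A ?J b w)) (at z) = frechet_derivative (\<lambda>_. 0) (at z)"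
      by (rule frechet_derivative_cong_open[OF smooth_map_open[OF J] z]) (simp add: mJ eta0[OF \<alpha>])
    then show ?thesis by simp
  qed
  have gphi: "g (j (p, q)) v (\<phi> (j (p, q)) w) = 0"
    if "v \<in> range (mdiff AT A ?\<iota> q)" "w \<in> range (mdiff AT A ?\<iota> q)" for v w
  proof -
    have "range (mdiff AT A ?\<iota> q) = range (mdiff eucl_atlas A ?J z)"
      using range_mdiff_in_chart[OF mT mA ch(1) slice_smooth(2) z, of p] by (simp add: zq)
    then obtain a b where "v = mdiff eucl_atlas A ?J z a" "w = mdiff eucl_atlas A ?J z b" using \<open>v \<in> _\<close> \<open>w \<in> _\<close> by auto
    then show ?thesis
      using S_manifold_pullback[OF S \<alpha> J z, of b a] by (simp add: zero zq)
  qed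
  \<comment> \<open>This uses that the model space of the second factor has positive dimension.\<close>
  obtain v :: 'e2 where "v \<noteq> 0" using nonempty_Basis nonzero_Basis by blast
  moreover have "semi_riemannian_metric AT UNIV (induced_metric AT A g ?\<iota>)"
    using invariant[of p] by (simp add: invariant_submanifold_def nondegenerate_submanifold_def)
  ultimately obtain w where w: "induced_metric AT A g ?\<iota> q v w \<noteq> 0"
    unfolding semi_riemannian_metric_def by blast
  let ?w = "mdiff AT A ?\<iota> q w"
  have "\<phi> (j (p, q)) ` range (mdiff AT A ?\<iota> q) \<subseteq> range (mdiff AT A ?\<iota> q)"
    using invariant[of p] by (simp add: invariant_submanifold_def)
  then have "\<phi> (j (p, q)) ?w \<in> range (mdiff AT A ?\<iota> q)" by blast
  then have "g (j (p, q)) (mdiff AT A ?\<iota> q v) (\<phi> (j (p, q)) (\<phi> (j (p, q)) ?w)) = 0" by (intro gphi) auto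
  moreover have "\<phi> (j (p, q)) (\<phi> (j (p, q)) ?w) = - ?w"
    using S_manifoldD(6)[OF S, of "j (p, q)" ?w] eta0 by simp
  ultimately have "g (j (p, q)) (mdiff AT A ?\<iota> q v) ?w = 0"
    using bilinear_rneg[OF S_manifoldD(4)[OF S]] by simp
  then show False using w by (simp add: induced_metric_def)
qed

context
  assumes tan: "\<alpha> \<in> {1..s} \<Longrightarrow> tangent_to AT UNIV A (\<lambda>q. j (p, q)) (\<xi> \<alpha>)"
begin

text \<open>If $v$ is horizontal and $w$ vertical, then $\phi w$ is vertical, hence orthogonal to $v$, and
$\eta^\alpha$ vanishes on $v$. The pulled back equation $d\eta^\alpha = \Phi$ then leaves only
the derivative of $\eta^\alpha(w)$ along $v$, which is therefore zero. A ball is taken because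
zero derivative implies constancy only on connected sets.\<close>

lemma eta_vertical_locally_constant:
  assumes \<alpha>: "\<alpha> \<in> {1..s}" and c: "c \<in> Aperp" and ball: "ball a0 r \<subseteq> snd c ` fst c" "a \<in> ball a0 r"
  shows "\<eta> \<alpha> (j (cinv c a, q)) (mdiff AT A (\<lambda>q. j (cinv c a, q)) q w) =
         \<eta> \<alpha> (j (cinv c a0, q)) (mdiff AT A (\<lambda>q. j (cinv c a0, q)) q w)"
proof -
  define d where "d = chart_at AT q"
  note ch = chart_at_props[OF mT, of q, folded d_def]
  let ?T = "snd c ` fst c \<times> snd d ` fst d" and ?J = "\<lambda>z. j (prod_param c d z)"
  let ?dJ = "mdiff eucl_atlas A ?J"
  note pp = smooth_map_prod_param[OF mperp mT c ch(1)]
  have J: "smooth_map eucl_atlas ?T A ?J"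
    by (rule smooth_map_compose[OF smooth_manifold_eucl mB mA pp j_smooth smooth_map_open[OF pp] order_refl]) simp
  have dJ: "?dJ z v = dj (prod_param c d z) (mdiff eucl_atlas B (prod_param c d) z v)" if "z \<in> ?T" for z v
    by (rule mdiff_compose[OF smooth_manifold_eucl mB mA pp j_smooth that]) simp
  have vert: "mdiff eucl_atlas B (prod_param c d) z (0, w) \<in> D (prod_param c d z)"
    and hor: "mdiff eucl_atlas B (prod_param c d) z (v, 0) \<in> Dperp (prod_param c d z)" if "z \<in> ?T" for z v w
    using that mdiff_prod_param[OF mperp mT c ch(1) that] mdiff_cinv_eq_0_iff[OF mperp c, of "fst z"]
      mdiff_cinv_eq_0_iff[OF mT ch(1), of "snd z"] by auto
  have eta_hor: "\<eta> \<alpha> (?J z) (?dJ z (v, 0)) = 0" if z: "z \<in> ?T" for z v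
  proof -
    let ?x = "prod_param c d z"
    have "\<xi> \<alpha> (j ?x) \<in> range (mdiff AT A (\<lambda>q. j (fst ?x, q)) (snd ?x))"
      using tan[OF \<alpha>, of "fst ?x"] by (simp add: tangent_to_def) (metis prod.collapse)
    then obtain u where u: "u \<in> D ?x" "\<xi> \<alpha> (j ?x) = dj ?x u" unfolding slice_range(2) by auto
    have "g (j ?x) (?dJ z (v, 0)) (\<xi> \<alpha> (j ?x)) = 0"
      unfolding u(2) dJ[OF z] by (rule D_orthogonal[OF u(1) hor[OF z]])
    then show ?thesis by (simp add: eta_eq_metric_xi[OF \<alpha>])
  qed
  let ?\<theta> = "\<lambda>w z. \<eta> \<alpha> (?J z) (?dJ z w)"
  have diff: "?\<theta> w differentiable (at z)" if "z \<in> ?T" for z w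
    by (rule pullback_ext_deriv(1)[OF mA S_manifold_etaD(1)[OF S \<alpha>] J that])
  have D0: "frechet_derivative (?\<theta> (0, w)) (at z) (v, 0) = 0" if z: "z \<in> ?T" for z v w
  proof -
    have "frechet_derivative (?\<theta> (v, 0)) (at z) = frechet_derivative (\<lambda>_. 0) (at z)"
      by (rule frechet_derivative_cong_open[OF smooth_map_open[OF J] z]) (rule eta_hor)
    moreover have "g (?J z) (?dJ z (v, 0)) (\<phi> (?J z) (?dJ z (0, w))) = 0"
    proof -
      obtain u where "u \<in> D (prod_param c d z)" "\<phi> (?J z) (?dJ z (0, w)) = dj (prod_param c d z) u"
        using phi_D[OF vert[OF z, of w]] unfolding dJ[OF z] by auto
      then show ?thesis using D_orthogonal[OF _ hor[OF z]] by (simp add: dJ[OF z])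
    qed
    ultimately show ?thesis
      using S_manifold_pullback[OF S \<alpha> J z, of "(0, w)" "(v, 0)"] by simp
  qed
  define b where "b = snd d q"
  have b: "b \<in> snd d ` fst d" and bq: "cinv d b = q" using ch by (auto simp: b_def cinv_chart)
  have inT: "(a, b) \<in> ?T" if "a \<in> ball a0 r" for a using that ball(1) b by blast
  have a0: "a0 \<in> ball a0 r" using ball(2) by (smt (verit) centre_in_ball dist_not_less_zero mem_ball)
  have const: "?\<theta> (0, w) (a, b) = ?\<theta> (0, w) (a0, b)" for w
  proof (rule has_derivative_zero_unique[where f = "\<lambda>a. ?\<theta> (0, w) (a, b)"])
    show "convex (ball a0 r)" by (rule convex_ball)
    show "a \<in> ball a0 r" "a0 \<in> ball a0 r" by (fact ball(2) a0)+
    fix a assume a: "a \<in> ball a0 r"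
    have "((\<lambda>a. (a, b)) has_derivative (\<lambda>v. (v, 0))) (at a within ball a0 r)"
      by (auto intro!: derivative_eq_intros)
    from has_derivative_compose[OF this differentiable_has_frechet_derivative[OF diff[OF inT[OF a], of "(0, w)"]]]
    show "((\<lambda>a. ?\<theta> (0, w) (a, b)) has_derivative (\<lambda>v. 0)) (at a within ball a0 r)"
      by (simp only: D0[OF inT[OF a]])
  qed
  have slice: "?\<theta> (0, w) (a, b) = \<eta> \<alpha> (j (cinv c a, q)) (mdiff AT A (\<lambda>q. j (cinv c a, q)) q (mdiff eucl_atlas AT (cinv d) b w))"
    if a: "a \<in> ball a0 r" for a w
  proof -
    have x: "prod_param c d (a, b) = (cinv c a, q)" by (simp add: prod_param_def bq)
    have "mdiff eucl_atlas B (prod_param c d) (a, b) (0, w) =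
        mdiff AT B (\<lambda>q. (cinv c a, q)) q (mdiff eucl_atlas AT (cinv d) b w)"
      by (rule prod_tangent_eqI[OF mperp mT, of "(cinv c a, q)"])
        (use mdiff_prod_param[OF mperp mT c ch(1) inT[OF a], of "(0, w)"] mdiff_slices[OF mperp mT, where p = "cinv c a"]
          mdiff_cinv_eq_0_iff[OF mperp c, of a] ball(1) a in \<open>auto simp: x\<close>)
    then show ?thesis by (simp add: dJ[OF inT[OF a]] x slice_mdiff)
  qed
  have "surj (mdiff eucl_atlas AT (cinv d) b)" using mdiff_cinv_bij(2)[OF mT ch(1) b] by (simp add: bij_def)
  then obtain w' where w': "w = mdiff eucl_atlas AT (cinv d) b w'" by (rule surjE)
  then show ?thesis using const[of w'] slice[OF ball(2), of w'] slice[OF a0, of w'] by (simp only: w')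
qed

text \<open>Write $\xi_\alpha = X(p)$ as a vector of $T_qN^T$, for a fixed $q$. The form $w \mapsto f^2
g_T(w, X)$ is $\epsilon_\alpha\eta^\alpha(w)$, hence locally independent of $p$. So is the
vector $Y = f^2 X$, and $f^2 = \epsilon_\alpha\, g_T(Y, Y)$ follows from $\epsilon_\alpha = f^2
g_T(X, X)$.\<close>

lemma warping_function_locally_constant:
  assumes c: "c \<in> Aperp" and ball: "ball a0 r \<subseteq> snd c ` fst c" "a \<in> ball a0 r"
  shows "f (cinv c a) = f (cinv c a0)"
proof -
  \<comment> \<open>The value of $f$ is the same on the whole fibre, so one point of it suffices.\<close>
  obtain q :: 'q where True by blast
  obtain \<alpha> where \<alpha>: "\<alpha> \<in> {1..s}" using S_manifoldD(2)[OF S] by fastforce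
  let ?p = "cinv c a" and ?p' = "cinv c a0"
  let ?d = "\<lambda>p. mdiff AT A (\<lambda>q. j (p, q)) q"
  have "\<exists>u. \<xi> \<alpha> (j (p, q)) = ?d p u" for p
    using tan[OF \<alpha>, of p] by (auto simp: tangent_to_def)
  then have "\<forall>p. \<exists>u. \<xi> \<alpha> (j (p, q)) = ?d p u" by (rule allI)
  from choice[OF this] obtain X where X: "\<And>p. \<xi> \<alpha> (j (p, q)) = ?d p (X p)" by (elim exE) simp
  have eta: "\<epsilon> \<alpha> * \<eta> \<alpha> (j (p, q)) (?d p w) = (f p)\<^sup>2 * gT q w (X p)" for p w
    using S_manifold_metric_xi[OF S \<alpha>, of "j (p, q)" "?d p w"] by (simp add: X slice_metric)
  have eta_eq: "\<eta> \<alpha> (j (?p, q)) (?d ?p w) = \<eta> \<alpha> (j (?p', q)) (?d ?p' w)" for w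
    by (rule eta_vertical_locally_constant[OF \<alpha> c ball])
  have Y: "(f ?p)\<^sup>2 *\<^sub>R X ?p = (f ?p')\<^sup>2 *\<^sub>R X ?p'"
    by (rule gT_nondegenerate[of q])
      (use eta[of ?p] eta[of ?p'] eta_eq in \<open>simp add: bilinear_rmul[OF gT_bilinear]\<close>)
  have "(f p)\<^sup>2 = \<epsilon> \<alpha> * gT q ((f p)\<^sup>2 *\<^sub>R X p) ((f p)\<^sup>2 *\<^sub>R X p)" for p
  proof -
    have "\<eta> \<alpha> (j (p, q)) (?d p (X p)) = 1" using S_manifold_etaD(3)[OF S \<alpha> \<alpha>] by (simp add: X[symmetric])
    with eta[of p "X p"] have e: "\<epsilon> \<alpha> = (f p)\<^sup>2 * gT q (X p) (X p)" by simp
    have "\<epsilon> \<alpha> * gT q ((f p)\<^sup>2 *\<^sub>R X p) ((f p)\<^sup>2 *\<^sub>R X p) = \<epsilon> \<alpha> * ((f p)\<^sup>2 * ((f p)\<^sup>2 * gT q (X p) (X p)))"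
      by (simp add: bilinear_rmul[OF gT_bilinear] bilinear_lmul[OF gT_bilinear])
    also have "\<dots> = \<epsilon> \<alpha> * ((f p)\<^sup>2 * \<epsilon> \<alpha>)" by (simp only: e[symmetric])
    also have "\<dots> = (f p)\<^sup>2" using S_manifold_epsilon[OF S \<alpha>] by (simp add: algebra_simps)
    finally show ?thesis by simp
  qed
  from this[of ?p] this[of ?p'] have "(f ?p)\<^sup>2 = (f ?p')\<^sup>2" by (simp only: Y)
  then show ?thesis using f_pos[of ?p] f_pos[of ?p'] by (simp add: power2_eq_iff_nonneg less_imp_le)
qed

text \<open>That $\phi$ sends $D^\perp$ to normal vectors combines two facts: orthogonality to $D^\perp$ is
total reality, and orthogonality to $D$ follows from skew-symmetry and $\phi D \subseteq D$.\<close>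

lemma contact_CR: "contact_CR_submanifold B A s \<phi> \<xi> g j D Dperp"
  unfolding contact_CR_submanifold_def
proof (intro conjI ballI allI)
  show "smooth_manifold B" by (rule mB)
  show "nondegenerate_submanifold B UNIV A g j" by (rule nondeg)
  show "tangent_to B UNIV A j (\<xi> \<alpha>)" if \<alpha>: "\<alpha> \<in> {1..s}" for \<alpha>
    unfolding tangent_to_def
  proof
    fix x
    have "\<xi> \<alpha> (j x) \<in> range (mdiff AT A (\<lambda>q. j (fst x, q)) (snd x))"
      using tan[OF \<alpha>, of "fst x"] by (simp add: tangent_to_def) (metis prod.collapse)
    then show "\<xi> \<alpha> (j x) \<in> range (dj x)" unfolding slice_range(2) by auto
  qed
  show "smooth_distribution B D" "smooth_distribution B Dperp"
    by (rule factor_spaces_smooth[OF mperp mT])+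
  fix x
  show "D x \<inter> Dperp x = {0}"
    unfolding factor_spaces_eq[OF mperp mT] by (auto simp: prod_eq_iff)
  show split: "{v + w |v w. v \<in> D x \<and> w \<in> Dperp x} = UNIV"
  proof -
    have "u = (0, snd u) + (fst u, 0)" for u :: "'e1 \<times> 'e2" by simp
    then show ?thesis unfolding factor_spaces_eq[OF mperp mT] by fastforce
  qed
  show "induced_metric B A g j x v w = 0" if "v \<in> D x" "w \<in> Dperp x" for v w
    using D_orthogonal[OF that] S_manifoldD(5)[OF S, of "j x" "dj x v"] by (simp add: induced_metric_def)
  show "\<phi> (j x) ` dj x ` D x \<subseteq> dj x ` D x" using phi_D by blast
  fix v w assume v: "v \<in> Dperp x"
  obtain w1 w2 where w: "w = w1 + w2" "w1 \<in> D x" "w2 \<in> Dperp x" using split by blast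
  obtain u where u: "u \<in> D x" "\<phi> (j x) (dj x w1) = dj x u" using phi_D[OF w(2)] by auto
  have "g (j x) (\<phi> (j x) (dj x v)) (dj x w1) = - g (j x) (dj x v) (\<phi> (j x) (dj x w1))"
    using S_manifold_phi_skew[OF S, of "j x" "dj x w1" "dj x v"] S_manifoldD(5)[OF S, of "j x"] by metis
  also have "\<dots> = 0" unfolding u(2) using D_orthogonal[OF u(1) v] by simp
  finally show "g (j x) (\<phi> (j x) (dj x v)) (dj x w) = 0"
    using phi_Dperp[OF v w(3)] by (simp add: w(1) linear_add[OF dj_linear] bilinear_radd[OF S_manifoldD(4)[OF S]])
qed

text \<open>The box is a ball in $N^\perp$, on which $f$ is constant, times a coordinate domain of $N^T$.
The metrics of the factors are those induced on the two leaves through the given point; on the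
second leaf this is $f^2 g_T$.\<close>

lemma local_product:
  "\<exists>(S1 :: 'e1 set) (S2 :: 'e2 set) U \<psi> h1 h2.
          open S1 \<and> open S2 \<and> open U \<and> x \<in> U \<and>
          diffeomorphism eucl_atlas (S1 \<times> S2) B U \<psi> \<and>
          semi_riemannian_metric eucl_atlas S1 h1 \<and> semi_riemannian_metric eucl_atlas S2 h2 \<and>
          (\<forall>a\<in>S1. \<forall>b\<in>S2. \<forall>v w. induced_metric eucl_atlas A g (j \<circ> \<psi>) (a, b) v w =
             h1 a (fst v) (fst w) + h2 b (snd v) (snd w)) \<and>
          (\<forall>a\<in>S1. \<forall>b\<in>S2.
             range (mdiff eucl_atlas B (\<lambda>a'. \<psi> (a', b)) a) = Dperp (\<psi> (a, b)) \<and>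
             range (mdiff eucl_atlas B (\<lambda>b'. \<psi> (a, b')) b) = D (\<psi> (a, b))) \<and>
          (\<forall>b\<in>S2. totally_real_submanifold eucl_atlas S1 A \<phi> g (\<lambda>a. j (\<psi> (a, b)))) \<and>
          (\<forall>a\<in>S1. invariant_submanifold eucl_atlas S2 A \<phi> g (\<lambda>b. j (\<psi> (a, b))) \<and>
             (\<forall>\<alpha>\<in>{1..s}. tangent_to eucl_atlas S2 A (\<lambda>b. j (\<psi> (a, b))) (\<xi> \<alpha>)))"
proof -
  obtain p0 q0 where x: "x = (p0, q0)" by (cases x)
  define c d where "c = chart_at Aperp p0" and "d = chart_at AT q0"
  note c = chart_at_props[OF mperp, of p0, folded c_def] and d = chart_at_props[OF mT, of q0, folded d_def]
  define a0 where "a0 = snd c p0"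
  have a0: "a0 \<in> snd c ` fst c" "cinv c a0 = p0" using c by (auto simp: a0_def cinv_chart)
  obtain r where r: "r > 0" "ball a0 r \<subseteq> snd c ` fst c"
    using c(3) a0(1) open_contains_ball unfolding is_chart_def by blast
  let ?S1 = "ball a0 r" and ?S2 = "snd d ` fst d" and ?\<psi> = "prod_param c d"
  have S1: "open ?S1" by simp
  have S2: "open ?S2" using d by (simp add: is_chart_def)
  let ?T = "snd c ` fst c \<times> ?S2"
  define U where "U = cinv c ` ?S1 \<times> fst d"
  have U: "open U" unfolding U_def by (intro open_Times open_cinv_image c S1 r open_chart_domain d)
  have f_const: "f (cinv c a) = f p0" if "a \<in> ?S1" for a
    using warping_function_locally_constant[OF c(1) r(2) that] by (simp add: a0)
  let ?h1 = "induced_metric eucl_atlas A g (\<lambda>a. j (cinv c a, q0))"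
  let ?h2 = "induced_metric eucl_atlas A g (\<lambda>b. j (p0, cinv d b))"
  note sl = slice_smooth
  have ndperp: "nondegenerate_submanifold Aperp UNIV A g (\<lambda>p. j (p, q))" for q
    using totally_real[of q] by (simp add: totally_real_submanifold_def)
  have ndT: "nondegenerate_submanifold AT UNIV A g (\<lambda>q. j (p, q))" for p
    using invariant[of p] by (simp add: invariant_submanifold_def)
  note nd1 = nondegenerate_submanifold_in_chart[OF mperp mA ndperp c(1) S1 r(2)]
  note nd2 = nondegenerate_submanifold_in_chart[OF mT mA ndT d(1) S2 order_refl]
  note rg1 = range_mdiff_in_chart[OF mperp mA c(1) slice_smooth(1)]
  note rg2 = range_mdiff_in_chart[OF mT mA d(1) slice_smooth(2)]
  have TS: "(a, b) \<in> ?T" if "a \<in> ?S1" "b \<in> ?S2" for a b using that r by auto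
  show ?thesis
  proof (intro exI[of _ ?S1] exI[of _ ?S2] exI[of _ U] exI[of _ ?\<psi>] exI[of _ ?h1] exI[of _ ?h2] conjI ballI allI)
    show "open ?S1" "open ?S2" "open U" by (fact S1 S2 U)+
    show "x \<in> U" using r a0 d by (auto simp: U_def x intro!: image_eqI[of _ _ a0])
    show "diffeomorphism eucl_atlas (?S1 \<times> ?S2) B U ?\<psi>"
    proof -
      have inv: "?\<psi> (snd c (fst y), snd d (snd y)) = y" "(snd c (fst y), snd d (snd y)) \<in> ?S1 \<times> ?S2" if "y \<in> U" for y
        using that r(2) by (auto simp: U_def prod_param_def cinv_chart c d chart_cinv subset_iff)
      have inv': "(snd c (fst (?\<psi> z)), snd d (snd (?\<psi> z))) = z" "?\<psi> z \<in> U" if "z \<in> ?S1 \<times> ?S2" for z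
        using that r(2) by (auto simp: U_def prod_param_def chart_cinv cinv_into subset_iff)
      have bij: "bij_betw ?\<psi> (?S1 \<times> ?S2) U"
        by (rule bij_betw_byWitness[where f' = "\<lambda>y. (snd c (fst y), snd d (snd y))"]) (use inv inv' in auto)
      have sm: "smooth_map eucl_atlas (?S1 \<times> ?S2) B ?\<psi>"
        by (rule smooth_map_subset[OF smooth_map_prod_param[OF mperp mT c(1) d(1)]])
          (use r in \<open>auto intro: open_Times S1 S2\<close>)
      have sub: "fst ` U \<subseteq> fst c" "snd ` U \<subseteq> fst d"
        using r(2) by (auto simp: U_def cinv_into subset_iff)
      have "smooth_map B U (prod_atlas eucl_atlas eucl_atlas) (\<lambda>y. (snd c (fst y), snd d (snd y)))"
        by (rule smooth_map_Pair[OF mB smooth_manifold_eucl smooth_manifold_eucl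
              smooth_map_compose[OF mB mperp smooth_manifold_eucl smooth_map_fst[OF mperp mT] smooth_map_chart[OF mperp c(1)] U subset_UNIV sub(1)]
              smooth_map_compose[OF mB mT smooth_manifold_eucl smooth_map_snd[OF mperp mT] smooth_map_chart[OF mT d(1)] U subset_UNIV sub(2)]])
      then have "smooth_map B U eucl_atlas (\<lambda>y. (snd c (fst y), snd d (snd y)))" by (simp only: prod_eucl_atlas)
      then have "smooth_map B U eucl_atlas (inv_into (?S1 \<times> ?S2) ?\<psi>)"
      proof (rule smooth_map_cong[OF mB smooth_manifold_eucl])
        fix y assume "y \<in> U"
        then show "(snd c (fst y), snd d (snd y)) = inv_into (?S1 \<times> ?S2) ?\<psi> y"
          using inv[of y] bij by (metis bij_betw_def inv_into_f_f)
      qed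
      then show ?thesis using bij sm by (simp add: diffeomorphism_def)
    qed
    show "semi_riemannian_metric eucl_atlas ?S1 ?h1" "semi_riemannian_metric eucl_atlas ?S2 ?h2"
      using nd1 nd2 by (simp_all add: nondegenerate_submanifold_def)
  next
    fix a b and v w :: "'e1 \<times> 'e2" assume a: "a \<in> ?S1" and b: "b \<in> ?S2"
    note T = TS[OF a b] and a' = subsetD[OF r(2) a]
    have pab: "?\<psi> (a, b) = (cinv c a, cinv d b)" by (simp add: prod_param_def)
    have "mdiff eucl_atlas A (j \<circ> ?\<psi>) (a, b) v = dj (?\<psi> (a, b)) (mdiff eucl_atlas B ?\<psi> (a, b) v)" for v
      unfolding o_def
      by (rule mdiff_compose[OF smooth_manifold_eucl mB mA smooth_map_prod_param[OF mperp mT c(1) d(1)] j_smooth T]) simp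
    then have 1: "induced_metric eucl_atlas A g (j \<circ> ?\<psi>) (a, b) v w =
        gperp (cinv c a) (mdiff eucl_atlas Aperp (cinv c) a (fst v)) (mdiff eucl_atlas Aperp (cinv c) a (fst w)) +
        (f p0)\<^sup>2 * gT (cinv d b) (mdiff eucl_atlas AT (cinv d) b (snd v)) (mdiff eucl_atlas AT (cinv d) b (snd w))"
      using mdiff_prod_param[OF mperp mT c(1) d(1) T]
      by (simp add: induced_metric_def metric_dj) (simp add: pab f_const[OF a])
    have 2: "?h1 a v w = gperp (cinv c a) (mdiff eucl_atlas Aperp (cinv c) a v) (mdiff eucl_atlas Aperp (cinv c) a w)" for v w
      by (simp add: induced_metric_def mdiff_in_chart[OF mperp mA c(1) sl(1) a'] slice_metric)
    have 3: "?h2 b v w = (f p0)\<^sup>2 * gT (cinv d b) (mdiff eucl_atlas AT (cinv d) b v) (mdiff eucl_atlas AT (cinv d) b w)" for v w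
      by (simp add: induced_metric_def mdiff_in_chart[OF mT mA d(1) sl(2) b] slice_metric)
    show "induced_metric eucl_atlas A g (j \<circ> ?\<psi>) (a, b) v w = ?h1 a (fst v) (fst w) + ?h2 b (snd v) (snd w)"
      by (simp only: 1 2 3)
  next
    fix a b assume a: "a \<in> ?S1" and b: "b \<in> ?S2"
    note a' = subsetD[OF r(2) a]
    have "range (mdiff eucl_atlas B (\<lambda>a'. (cinv c a', cinv d b)) a) = range (mdiff Aperp B (\<lambda>p. (p, cinv d b)) (cinv c a))"
      by (rule range_mdiff_in_chart[OF mperp mB c(1) smooth_map_slices(1)[OF mperp mT] a'])
    then show "range (mdiff eucl_atlas B (\<lambda>a'. ?\<psi> (a', b)) a) = Dperp (?\<psi> (a, b))"
      by (simp add: prod_param_def range_mdiff_slices[OF mperp mT])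
    have "range (mdiff eucl_atlas B (\<lambda>b'. (cinv c a, cinv d b')) b) = range (mdiff AT B (\<lambda>q. (cinv c a, q)) (cinv d b))"
      by (rule range_mdiff_in_chart[OF mT mB d(1) smooth_map_slices(2)[OF mperp mT] b])
    then show "range (mdiff eucl_atlas B (\<lambda>b'. ?\<psi> (a, b')) b) = D (?\<psi> (a, b))"
      by (simp add: prod_param_def range_mdiff_slices[OF mperp mT])
  next
    fix b assume b: "b \<in> ?S2"
    show "totally_real_submanifold eucl_atlas ?S1 A \<phi> g (\<lambda>a. j (?\<psi> (a, b)))"
      using totally_real[of "cinv d b"] nd1[of "cinv d b"] rg1[of _ "cinv d b"] subsetD[OF r(2)]
      by (simp add: totally_real_submanifold_def prod_param_def)
  next
    fix a assume a: "a \<in> ?S1"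
    show "invariant_submanifold eucl_atlas ?S2 A \<phi> g (\<lambda>b. j (?\<psi> (a, b)))"
      using invariant[of "cinv c a"] nd2[of "cinv c a"] rg2[of _ "cinv c a"]
      by (simp add: invariant_submanifold_def prod_param_def)
    fix \<alpha> assume "\<alpha> \<in> {1..s}"
    then show "tangent_to eucl_atlas ?S2 A (\<lambda>b. j (?\<psi> (a, b))) (\<xi> \<alpha>)"
      using tan[of \<alpha> "cinv c a"] rg2[of _ "cinv c a"] by (simp add: tangent_to_def prod_param_def)
  qed
qed

end

end

theorem theorem3p2:
  fixes A :: "('m::{t2_space,second_countable_topology}, 'e::euclidean_space) atlas"
    and n s :: nat
    and \<phi> :: "'m \<Rightarrow> 'e \<Rightarrow> 'e"
    and \<xi> :: "nat \<Rightarrow> 'm \<Rightarrow> 'e"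
    and \<eta> :: "nat \<Rightarrow> 'm \<Rightarrow> 'e \<Rightarrow> real"
    and \<epsilon> :: "nat \<Rightarrow> real"
    and g :: "'m \<Rightarrow> 'e \<Rightarrow> 'e \<Rightarrow> real"
    and Aperp :: "('p::{t2_space,second_countable_topology}, 'e1::euclidean_space) atlas"
    and AT :: "('q::{t2_space,second_countable_topology}, 'e2::euclidean_space) atlas"
    and gperp :: "'p \<Rightarrow> 'e1 \<Rightarrow> 'e1 \<Rightarrow> real"
    and gT :: "'q \<Rightarrow> 'e2 \<Rightarrow> 'e2 \<Rightarrow> real"
    and f :: "'p \<Rightarrow> real"
    and j :: "'p \<times> 'q \<Rightarrow> 'm"
  assumes "indefinite_S_manifold A n s \<phi> \<xi> \<eta> \<epsilon> g"
    and "warped_product_submanifold Aperp AT gperp f gT A g j"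
    and "\<And>q. totally_real_submanifold Aperp UNIV A \<phi> g (\<lambda>p. j (p, q))"
    and "\<And>p. invariant_submanifold AT UNIV A \<phi> g (\<lambda>q. j (p, q))"
    and "(\<forall>\<alpha>\<in>{1..s}. \<forall>p. tangent_to AT UNIV A (\<lambda>q. j (p, q)) (\<xi> \<alpha>)) \<or>
         (\<forall>\<alpha>\<in>{1..s}. \<forall>q. tangent_to Aperp UNIV A (\<lambda>p. j (p, q)) (\<xi> \<alpha>))"
  shows "CR_product (prod_atlas Aperp AT) A s \<phi> \<xi> g j"
proof -
  interpret warped_product_CR A n s \<phi> \<xi> \<eta> \<epsilon> g Aperp AT gperp gT f j
    by (rule warped_product_CR.intro) (fact assms)+
  have tan: "tangent_to AT UNIV A (\<lambda>q. j (p, q)) (\<xi> \<alpha>)" if "\<alpha> \<in> {1..s}" for \<alpha> p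
    using assms(5) xi_not_tangent_to_perp that by blast
  show ?thesis
    unfolding CR_product_def
    by (intro exI[of _ "vertical_space Aperp AT"] exI[of _ "horizontal_space Aperp AT"] conjI allI contact_CR local_product tan)
qed

end
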